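(* Let $\mathsf{D}=(D_n)_{n\ge1}$ be a minimal regular elliptic divisibility sequence associated to the elliptic curve $E/\mathbb{Q}$ and the point $P\in E(\mathbb{Q})$. \begin{itemize} \item[(a)] If $n\in\mathcal{S}(\mathsf{D})$, $p$ is a prime and $p\mid D_n$, then $(n\to np)\in\operatorname{Arr}(\mathsf{D})$. \item[(b)] If $n\in\mathcal{S}(\mathsf{D})$, $d$ is an aliquot number for $\mathsf{D}$ (i.e. $d\in\mathcal{A}(\mathsf{D})$) and $\gcd(n,d)=1$, then $(n\to nd)\in\operatorname{Arr}(\mathsf{D})$. \item[(c)] If $p\ge 7$ is a prime of good reduction for $E$ and $(n\to np)\in\operatorname{Arr}(\mathsf{D})$, then either $p\mid D_n$ or $p$ is an aliquot number for $\mathsf{D}$. \item[(d)] Suppose $\gcd(n,d)=1$, $(n\to nd)\in\operatorname{Arr}(\mathsf{D})$, and $d=p_1p_2\cdots p_\ell$ is a product of $\ell\ge2$ distinct primes of good reduction for $E$ satisfying $\min_i p_i>\bigl(2^{-1/(2\ell)}-1\bigr)^{-2}$. Then $d$ is an aliquot number for $\mathsf{D}$. \end{itemize}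
   Context: Let $E/\mathbb{Q}$ be an elliptic curve given by a Weierstrass equation with integer coefficients and let $P\in E(\mathbb{Q})$ be a point of infinite order. The elliptic divisibility sequence (EDS) $\mathsf{D}=(D_n)_{n\ge1}$ associated to $(E,P)$ is the sequence of positive integers obtained by writing $x([n]P)=A_n/D_n^2$ as a fraction in lowest terms. It is minimal if the Weierstrass equation is a global minimal Weierstrass equation; $\operatorname{Disc}(E)$ denotes the minimal discriminant. For a prime $p$, $E_{\mathrm{ns}}(\mathbb{F}_p)$ denotes the group of nonsingular points of the reduction of $E$ modulo $p$, and "$P\in E_{\mathrm{ns}}(\mathbb{F}_p)$" means that $P$ reduces to a nonsingular point modulo $p$. For $n\ge1$ the rank of apparition is $r_n=\min\{r\ge1: n\mid D_r\}$. Regularity: $\mathsf{D}$ is called $2$-irregular if all of the following hold: (I1) $E$ has good reduction at $2$; (I2) $\#E(\mathbb{F}_2)=4$; (I3) $r_2=4$; (I4) $D_2$ is odd; (I5) $\operatorname{ord}_2(D_4)=1$. Otherwise $\mathsf{D}$ is $2$-regular. $\mathsf{D}$ is regular if it is $2$-regular and $P\in E_{\mathrm{ns}}(\mathbb{F}_p)$ for every prime $p\mid\operatorname{Disc}(E)$. Index divisibility graph: $\mathcal{S}(\mathsf{D})=\{n\ge1: n\mid D_n\}$. The arrow set $\operatorname{Arr}(\mathsf{D})$ consists of pairs $(n\to m)$ with $n,m\in\mathcal{S}(\mathsf{D})$, $n\mid m$, $n\ne m$, such that there is no $k\in\mathcal{S}(\mathsf{D})$ with $n\mid k\mid m$ other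 than $k=n$ and $k=m$. Aliquot cycles: an aliquot cycle for $\mathsf{D}$ is a tuple $(p_1,\dots,p_\ell)$, $\ell\ge1$, of distinct primes of good reduction for $E$ with $r_{p_i}=p_{i+1}$ for all $1\le i\le\ell$, where $p_{\ell+1}=p_1$. The set of aliquot numbers is $\mathcal{A}(\mathsf{D})=\{p_1\cdots p_\ell:(p_1,\dots,p_\ell)\text{ an aliquot cycle for }\mathsf{D}\}$. *)

theory Defs
  imports Complex_Main "HOL-Number_Theory.Number_Theory"
begin

text \<open>
  \<open>Weierstrass a1 a2 a3 a4 a6\<close> stands for the equation
  \<open>y\<^sup>2 + a1 x y + a3 y = x\<^sup>3 + a2 x\<^sup>2 + a4 x + a6\<close>.
\<close>

datatype 'a weierstrass =
  Weierstrass (wa1: 'a) (wa2: 'a) (wa3: 'a) (wa4: 'a) (wa6: 'a)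

definition disc :: "'a::comm_ring_1 weierstrass \<Rightarrow> 'a" where
  "disc W = (let b2 = (wa1 W)^2 + 4 * wa2 W;
                 b4 = 2 * wa4 W + wa1 W * wa3 W;
                 b6 = (wa3 W)^2 + 4 * wa6 W;
                 b8 = (wa1 W)^2 * wa6 W + 4 * wa2 W * wa6 W - wa1 W * wa3 W * wa4 W
                      + wa2 W * (wa3 W)^2 - (wa4 W)^2
             in - (b2^2 * b8) - 8 * b4^3 - 27 * b6^2 + 9 * b2 * b4 * b6)"

definition wpoly :: "'a::comm_ring_1 weierstrass \<Rightarrow> 'a \<Rightarrow> 'a \<Rightarrow> 'a" where
  "wpoly W x y = y^2 + wa1 W * x * y + wa3 W * y - x^3 - wa2 W * x^2 - wa4 W * x - wa6 W"

definition wpoly_dx :: "'a::comm_ring_1 weierstrass \<Rightarrow> 'a \<Rightarrow> 'a \<Rightarrow> 'a" where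
  "wpoly_dx W x y = wa1 W * y - 3 * x^2 - 2 * wa2 W * x - wa4 W"

definition wpoly_dy :: "'a::comm_ring_1 weierstrass \<Rightarrow> 'a \<Rightarrow> 'a \<Rightarrow> 'a" where
  "wpoly_dy W x y = 2 * y + wa1 W * x + wa3 W"

datatype 'a point = Infty | Affine 'a 'a

fun on_curve :: "'a::comm_ring_1 weierstrass \<Rightarrow> 'a point \<Rightarrow> bool" where
  "on_curve W Infty = True"
| "on_curve W (Affine x y) = (wpoly W x y = 0)"

text \<open>
  The chord-and-tangent law: \<open>y = l x + v\<close> is the line through the two points,
  respectively the tangent line if they coincide.
\<close>

fun point_add :: "'a::field weierstrass \<Rightarrow> 'a point \<Rightarrow> 'a point \<Rightarrow> 'a point" where
  "point_add W Infty Q = Q"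
| "point_add W P Infty = P"
| "point_add W (Affine x1 y1) (Affine x2 y2) =
    (if x1 = x2 \<and> y1 + y2 + wa1 W * x2 + wa3 W = 0 then Infty
     else let l = (if x1 = x2
                   then (3 * x1^2 + 2 * wa2 W * x1 + wa4 W - wa1 W * y1)
                          / (2 * y1 + wa1 W * x1 + wa3 W)
                   else (y2 - y1) / (x2 - x1));
              v = y1 - l * x1;
              x3 = l^2 + wa1 W * l - wa2 W - x1 - x2
          in Affine x3 (- (l + wa1 W) * x3 - v - wa3 W))"

fun point_mult :: "'a::field weierstrass \<Rightarrow> nat \<Rightarrow> 'a point \<Rightarrow> 'a point" where
  "point_mult W 0 P = Infty"
| "point_mult W (Suc n) P = point_add W (point_mult W n P) P"

abbreviation rat_curve :: "int weierstrass \<Rightarrow> rat weierstrass" where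
  "rat_curve W \<equiv> map_weierstrass of_int W"

definition infinite_order :: "rat weierstrass \<Rightarrow> rat point \<Rightarrow> bool" where
  "infinite_order W P \<longleftrightarrow> (\<forall>n\<ge>1. point_mult W n P \<noteq> Infty)"


subsection \<open>Minimal equations\<close>

text \<open>
  \<open>change_vars u r s t W W'\<close>: the substitution \<open>x = u\<^sup>2 x' + r\<close>,
  \<open>y = u\<^sup>3 y' + u\<^sup>2 s x' + t\<close> transforms \<open>W\<close> into \<open>W'\<close>.
\<close>

definition change_vars ::
  "'a::field \<Rightarrow> 'a \<Rightarrow> 'a \<Rightarrow> 'a \<Rightarrow> 'a weierstrass \<Rightarrow> 'a weierstrass \<Rightarrow> bool" where
  "change_vars u r s t W W' \<longleftrightarrow>
     u * wa1 W' = wa1 W + 2 * s \<and>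
     u^2 * wa2 W' = wa2 W - s * wa1 W + 3 * r - s^2 \<and>
     u^3 * wa3 W' = wa3 W + r * wa1 W + 2 * t \<and>
     u^4 * wa4 W' = wa4 W - s * wa3 W + 2 * r * wa2 W - (t + r * s) * wa1 W
                      + 3 * r^2 - 2 * s * t \<and>
     u^6 * wa6 W' = wa6 W + r * wa4 W + r^2 * wa2 W + r^3 - t * wa3 W - t^2 - r * t * wa1 W"

definition isomorphic :: "'a::field weierstrass \<Rightarrow> 'a weierstrass \<Rightarrow> bool" where
  "isomorphic W W' \<longleftrightarrow> (\<exists>u r s t. u \<noteq> 0 \<and> change_vars u r s t W W')"

definition p_integral :: "nat \<Rightarrow> rat \<Rightarrow> bool" where
  "p_integral p q \<longleftrightarrow> \<not> int p dvd snd (quotient_of q)"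

definition ord_rat :: "nat \<Rightarrow> rat \<Rightarrow> int" where
  "ord_rat p q = int (multiplicity (int p) (fst (quotient_of q)))
                 - int (multiplicity (int p) (snd (quotient_of q)))"

definition minimal_at :: "nat \<Rightarrow> int weierstrass \<Rightarrow> bool" where
  "minimal_at p W \<longleftrightarrow>
     (\<forall>W'. isomorphic (rat_curve W) W' \<and> (\<forall>a \<in> set_weierstrass W'. p_integral p a)
        \<longrightarrow> ord_rat p (disc (rat_curve W)) \<le> ord_rat p (disc W'))"

definition global_minimal :: "int weierstrass \<Rightarrow> bool" where
  "global_minimal W \<longleftrightarrow> (\<forall>p. prime p \<longrightarrow> minimal_at p W)"


subsection \<open>Reduction modulo primes\<close>

text \<open>
  \<open>\<F>\<^sub>p\<close> is represented by the residues \<open>{0..<p}\<close>.  Reduction always refers to the given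
  integral equation; for a global minimal equation \<open>disc W\<close> is the minimal discriminant
  of the curve, so the notions below are then the usual ones for the curve itself.
\<close>

definition good_reduction :: "int weierstrass \<Rightarrow> nat \<Rightarrow> bool" where
  "good_reduction W p \<longleftrightarrow> \<not> int p dvd disc W"

definition points_mod :: "int weierstrass \<Rightarrow> nat \<Rightarrow> int point set" where
  "points_mod W p = insert Infty
     {Affine x y | x y. x \<in> {0..<int p} \<and> y \<in> {0..<int p} \<and> [wpoly W x y = 0] (mod int p)}"

text \<open>The point at infinity is nonsingular on every Weierstrass curve.\<close>

definition ns_points_mod :: "int weierstrass \<Rightarrow> nat \<Rightarrow> int point set" where
  "ns_points_mod W p = insert Infty
     {Affine x y | x y. Affine x y \<in> points_mod W p \<and>
        \<not> ([wpoly_dx W x y = 0] (mod int p) \<and> [wpoly_dy W x y = 0] (mod int p))}"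

definition residue_mod :: "nat \<Rightarrow> rat \<Rightarrow> int" where
  "residue_mod p q =
     (fst (quotient_of q) * modular_inverse (int p) (snd (quotient_of q))) mod int p"

text \<open>
  On an integral equation, \<open>x\<close> and \<open>y\<close> have the same primes in their denominators, and
  a point with \<open>p\<close> in the denominators reduces to the point at infinity.
\<close>

fun reduce_point :: "nat \<Rightarrow> rat point \<Rightarrow> int point" where
  "reduce_point p Infty = Infty"
| "reduce_point p (Affine x y) =
     (if p_integral p x then Affine (residue_mod p x) (residue_mod p y) else Infty)"


subsection \<open>Elliptic divisibility sequences\<close>

text \<open>The sequence starts at index 1; the value \<open>D 0\<close> is irrelevant.\<close>

definition is_eds :: "int weierstrass \<Rightarrow> rat point \<Rightarrow> (nat \<Rightarrow> nat) \<Rightarrow> bool" where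
  "is_eds W P D \<longleftrightarrow>
     disc W \<noteq> 0 \<and> on_curve (rat_curve W) P \<and> infinite_order (rat_curve W) P \<and>
     (\<forall>n\<ge>1. D n > 0 \<and>
        (\<exists>A y. point_mult (rat_curve W) n P = Affine (of_int A / of_nat (D n) ^ 2) y \<and>
               coprime A (int (D n) ^ 2)))"

definition minimal_eds :: "int weierstrass \<Rightarrow> rat point \<Rightarrow> (nat \<Rightarrow> nat) \<Rightarrow> bool" where
  "minimal_eds W P D \<longleftrightarrow> is_eds W P D \<and> global_minimal W"

definition rank_app :: "(nat \<Rightarrow> nat) \<Rightarrow> nat \<Rightarrow> nat" where
  "rank_app D n = (LEAST r. r \<ge> 1 \<and> n dvd D r)"

definition two_irregular :: "int weierstrass \<Rightarrow> (nat \<Rightarrow> nat) \<Rightarrow> bool" where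
  "two_irregular W D \<longleftrightarrow>
     good_reduction W 2 \<and> card (points_mod W 2) = 4 \<and> rank_app D 2 = 4 \<and>
     odd (D 2) \<and> multiplicity 2 (D 4) = 1"

definition regular_eds :: "int weierstrass \<Rightarrow> rat point \<Rightarrow> (nat \<Rightarrow> nat) \<Rightarrow> bool" where
  "regular_eds W P D \<longleftrightarrow>
     \<not> two_irregular W D \<and>
     (\<forall>p. prime p \<and> int p dvd disc W \<longrightarrow> reduce_point p P \<in> ns_points_mod W p)"

definition index_set :: "(nat \<Rightarrow> nat) \<Rightarrow> nat set" where
  "index_set D = {n. n \<ge> 1 \<and> n dvd D n}"

definition Arr :: "(nat \<Rightarrow> nat) \<Rightarrow> (nat \<times> nat) set" where
  "Arr D = {(n, m). n \<in> index_set D \<and> m \<in> index_set D \<and> n dvd m \<and> n \<noteq> m \<and>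
     \<not> (\<exists>k \<in> index_set D. n dvd k \<and> k dvd m \<and> k \<noteq> n \<and> k \<noteq> m)}"

definition aliquot_cycle :: "int weierstrass \<Rightarrow> (nat \<Rightarrow> nat) \<Rightarrow> nat list \<Rightarrow> bool" where
  "aliquot_cycle W D ps \<longleftrightarrow>
     length ps \<ge> 1 \<and> distinct ps \<and> (\<forall>p \<in> set ps. prime p \<and> good_reduction W p) \<and>
     (\<forall>i < length ps. rank_app D (ps ! i) = ps ! ((i + 1) mod length ps))"

definition aliquot_numbers :: "int weierstrass \<Rightarrow> (nat \<Rightarrow> nat) \<Rightarrow> nat set" where
  "aliquot_numbers W D = {prod_list ps | ps. aliquot_cycle W D ps}"

end

theory Submission
  imports Defs "Berlekamp_Zassenhaus.Finite_Field"
begin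

text \<open>
  Write \<open>x\<^sub>n\<close> for the \<open>x\<close>-coordinate of \<open>[n]P\<close>.  Everything is read off these coordinates.  The
  polynomial \<open>\<Phi>(x, u, w) = (x - u)\<^sup>2 w\<^sup>2 - S(x, u) w + R(x, u)\<close> is symmetric in its three arguments and
  vanishes at \<open>w = x(A \<plusminus> B)\<close> when \<open>x = x(A)\<close>, \<open>u = x(B)\<close>.  The chord-and-tangent law gives this for
  \<open>B = P\<close>; with the elliptic sequence \<open>\<psi>\<close> defined by \<open>\<psi>\<^sub>n\<^sub>+\<^sub>1 \<psi>\<^sub>n\<^sub>-\<^sub>1 = (x\<^sub>1 - x\<^sub>n) \<psi>\<^sub>n\<^sup>2\<close> it follows for
  \<open>A = [m]P\<close>, \<open>B = [n]P\<close>, so associativity of the group law is never needed.  In terms of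
  \<open>z\<^sub>n = 1 / x\<^sub>n\<close> the roots of \<open>\<Phi>\<close> show that the indices \<open>n\<close> with \<open>p\<^sup>k\<close> dividing \<open>D\<^sub>n\<close> are closed under sums
  and differences and that \<open>z\<^sub>j\<^sub>n = j\<^sup>2 z\<^sub>n\<close> modulo \<open>p\<^sup>4\<^sup>k\<close>, whence \<open>p\<^sup>k\<^sup>+\<^sup>1\<close> divides \<open>D\<^sub>p\<^sub>n\<close> if \<open>k \<ge> 1\<close>.

  A pigeonhole argument modulo a prime \<open>p\<close> of good reduction gives \<open>r\<^sub>p \<le> #E(\<F>\<^sub>p)\<close>.  The Hasse bound is
  proved by Manin's method: over \<open>\<F>\<^sub>p(t)\<close>, starting from \<open>t\<^sup>p\<close>, pass repeatedly to the second root of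
  \<open>\<Phi>(x, t, w)\<close>; by Gauss's lemma the heights \<open>h\<^sub>n\<close> satisfy \<open>h\<^sub>n\<^sub>+\<^sub>1 + h\<^sub>n\<^sub>-\<^sub>1 \<le> 2 h\<^sub>n + 2\<close>, so
  \<open>0 \<le> h\<^sub>n \<le> n\<^sup>2 - A n + p\<close> with \<open>A = #E(\<F>\<^sub>p) - p - 1\<close>, which forces \<open>A\<^sup>2 \<le> 4 p + 1\<close> if \<open>A \<ge> 0\<close>.

  In part (d) every prime factor \<open>p\<close> of \<open>d\<close> has some prime factor \<open>q\<close> of \<open>d\<close> dividing \<open>r\<^sub>p\<close>; along a cycle
  of such primes the product of the quotients \<open>r\<^sub>p / q\<close> is below 2 by the Hasse bound, hence they are
  all 1 and the cycle is aliquot.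
\<close>

section \<open>The symmetric triquadratic form of a Kummer line\<close>

text \<open>If x = x(A) and u = x(B), then x(A + B) and x(A - B) have sum \<open>biq_sum\<close> /
  (x - u)^2 and product \<open>biq_prod\<close> / (x - u)^2, and \<open>biq\<close> is the quadratic
  with these roots. For x = u, \<open>biq_prod\<close> / \<open>biq_sum\<close> is the duplication
  formula.\<close>

definition biq_sum :: "'a::comm_ring_1 \<Rightarrow> 'a \<Rightarrow> 'a \<Rightarrow> 'a \<Rightarrow> 'a \<Rightarrow> 'a" where
  "biq_sum b2 b4 b6 x u = 2 * x * u * (x + u) + b2 * x * u + b4 * (x + u) + b6"

definition biq_prod :: "'a::comm_ring_1 \<Rightarrow> 'a \<Rightarrow> 'a \<Rightarrow> 'a \<Rightarrow> 'a \<Rightarrow> 'a" where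
  "biq_prod b4 b6 b8 x u = (x * u)^2 - b4 * x * u - b6 * (x + u) - b8"

definition biq :: "'a::comm_ring_1 \<Rightarrow> 'a \<Rightarrow> 'a \<Rightarrow> 'a \<Rightarrow> 'a \<Rightarrow> 'a \<Rightarrow> 'a \<Rightarrow> 'a" where
  "biq b2 b4 b6 b8 x u w = (x - u)^2 * w^2 - biq_sum b2 b4 b6 x u * w + biq_prod b4 b6 b8 x u"

lemma biq_perm: "biq b2 b4 b6 b8 x u w = biq b2 b4 b6 b8 u x w"
  "biq b2 b4 b6 b8 x u w = biq b2 b4 b6 b8 x w u"
  unfolding biq_def biq_sum_def biq_prod_def by (simp_all add: algebra_simps power2_eq_square)

text \<open>A cubic in x despite its name: the square of 2 y + a1 x + a3 on the curve, that is, of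
  the second division polynomial.\<close>

definition quartic :: "'a::comm_ring_1 \<Rightarrow> 'a \<Rightarrow> 'a \<Rightarrow> 'a \<Rightarrow> 'a" where
  "quartic b2 b4 b6 x = 4 * x^3 + b2 * x^2 + 2 * b4 * x + b6"

lemma biq_sum_same: "biq_sum b2 b4 b6 x x = quartic b2 b4 b6 x"
  by (simp add: biq_sum_def quartic_def algebra_simps power2_eq_square power3_eq_cube)

text \<open>Let h and e be the values of 2 y + a1 x + a3 at A and B, and M = (b2 + 4 x + 4 u) (x -
  u)^2. Then (h - e)^2 - M and (h + e)^2 - M are 4 (x - u)^2 times x(A + B) and x(A - B). Their sum
  and product involve only h^2 and e^2, which leads to this identity and the next.\<close>

lemma quartic_biq_sum:
  "2 * (quartic b2 b4 b6 x + quartic b2 b4 b6 u) - 2 * ((b2 + 4 * x + 4 * u) * (x - u)^2) = 4 * biq_sum b2 b4 b6 x u"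
  by (simp add: biq_sum_def quartic_def algebra_simps power2_eq_square power3_eq_cube)

lemma quartic_biq_prod:
  fixes x :: "'a::comm_ring_1"
  assumes "4 * b8 = b2 * b6 - b4^2"
  shows "(quartic b2 b4 b6 x - quartic b2 b4 b6 u)^2
      - 2 * (quartic b2 b4 b6 x + quartic b2 b4 b6 u) * ((b2 + 4 * x + 4 * u) * (x - u)^2)
      + ((b2 + 4 * x + 4 * u) * (x - u)^2)^2 = 16 * (x - u)^2 * biq_prod b4 b6 b8 x u"
proof -
  have "16 * biq_prod b4 b6 b8 x u = 16 * ((x * u)^2 - b4 * x * u - b6 * (x + u)) - 4 * (4 * b8)"
    by (simp add: biq_prod_def algebra_simps)
  also have "\<dots> = 16 * ((x * u)^2 - b4 * x * u - b6 * (x + u)) - 4 * (b2 * b6 - b4^2)"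
    unfolding assms ..
  finally have "(x - u)^2 * (16 * biq_prod b4 b6 b8 x u)
      = (x - u)^2 * (16 * ((x * u)^2 - b4 * x * u - b6 * (x + u)) - 4 * (b2 * b6 - b4^2))"
    by (rule arg_cong)
  then have "16 * (x - u)^2 * biq_prod b4 b6 b8 x u
      = (x - u)^2 * (16 * ((x * u)^2 - b4 * x * u - b6 * (x + u)) - 4 * (b2 * b6 - b4^2))"
    by (simp only: mult_ac)
  then show ?thesis
    by (simp add: quartic_def algebra_simps power2_eq_square power3_eq_cube)
qed

section \<open>Elliptic sequences\<close>

text \<open>Here p, q are the roots w of Phi(a, 0, w) and r, s those of Phi(e, 0, w). The two sides
  are Phi(a, 0, e) and Phi(e, 0, a), equal by the symmetry of Phi.\<close>

lemma root_product_swap: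
  fixes a e p q r s :: "'a::comm_ring_1"
  assumes "a^2 * (p + q) = b4 * a + b6" "a^2 * (p * q) = - (b6 * a + b8)"
    and "e^2 * (r + s) = b4 * e + b6" "e^2 * (r * s) = - (b6 * e + b8)"
  shows "(e - p) * (e - q) * a^2 = (a - r) * (a - s) * e^2"
proof -
  have "(e - p) * (e - q) * a^2 = e^2 * a^2 - e * (a^2 * (p + q)) + a^2 * (p * q)"
    by (simp add: algebra_simps power2_eq_square)
  also have "\<dots> = e^2 * a^2 - a * (e^2 * (r + s)) + e^2 * (r * s)"
    unfolding assms by (simp add: algebra_simps)
  finally show ?thesis by (simp add: algebra_simps power2_eq_square)
qed

text \<open>The x-coordinates of [n]P, translated so that x(P) = 0; \<open>c\<close> plays the role
  of 2 y + a1 x + a3 at P. By \<open>sum\<close> and \<open>pro\<close>, x (n + 1) and x (n - 1) are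
  the roots of Phi(x n, 0, w); these start at n = 2 because x 0 would be infinite.\<close>

locale kummer_seq =
  fixes b2 b4 b6 b8 c :: "'a::field" and x :: "nat \<Rightarrow> 'a"
  assumes b8: "4 * b8 = b2 * b6 - b4^2"
    and c: "c^2 = b6" "c \<noteq> 0"
    and x1: "x 1 = 0" and x2: "b6 * x 2 = - b8"
    and nz: "n \<ge> 2 \<Longrightarrow> x n \<noteq> 0"
    and sum: "n \<ge> 2 \<Longrightarrow> (x n)^2 * (x (n+1) + x (n-1)) = b4 * x n + b6"
    and pro: "n \<ge> 2 \<Longrightarrow> (x n)^2 * (x (n+1) * x (n-1)) = - (b6 * x n + b8)"
begin

lemma b8_eq: "b8 = - (b6 * x 2)"
  using x2 by simp

text \<open>The values of the division polynomials at P. Solving their recurrence for the next term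
  divides by an earlier one, which is nonzero by \<open>psi_nz\<close>.\<close>

fun psi :: "nat \<Rightarrow> 'a" where
  "psi 0 = 0"
| "psi (Suc 0) = 1"
| "psi (Suc (Suc 0)) = c"
| "psi (Suc (Suc (Suc n))) = - x (Suc (Suc n)) * psi (Suc (Suc n))^2 / psi (Suc n)"

lemma psi_nz: "n \<ge> 1 \<Longrightarrow> psi n \<noteq> 0"
proof (induction n rule: psi.induct)
  case (4 n) then show ?case using nz[of "Suc (Suc n)"] by auto
qed (use c in auto)

lemma psi_rec:
  assumes "n \<ge> 1" shows "psi (n+1) * psi (n-1) = - x n * (psi n)^2"
proof (cases "n = 1")
  case False
  then obtain m where m: "n = Suc (Suc m)" using assms that[of "n - 2"] by simp
  show ?thesis using psi_nz[of "Suc m"] unfolding m by simp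
qed (use x1 in auto)

declare psi.simps(4) [simp del]

lemma psi_2: "psi 2 = c"
  by (simp add: numeral_2_eq_2)

text \<open>Ward's relation for elliptic sequences, by induction on j. The relations for (k + 1, i)
  and (k - 1, i), multiplied together and divided by the one for (k, i - 1), give the one for (k, i
  + 1); \<open>root_product_swap\<close> exchanges the roles of k and i. For j = 2 the divisor would
  have index 0, so this case is computed from \<open>pro\<close>.\<close>

lemma psi_step:
  assumes "k \<ge> j" "j \<ge> 1"
  shows "psi (k+j) * psi (k-j) = psi (k+1) * psi (k-1) * (psi j)^2 - psi (j+1) * psi (j-1) * (psi k)^2"
  using assms
proof (induction j arbitrary: k rule: less_induct)
  case (less j)
  consider "j = 1" | "j = 2" | i where "j = i+1" "i \<ge> 2" proof -
    have "j = 1 \<or> j = 2 \<or> (\<exists>i. j = i + 1 \<and> i \<ge> 2)" using less.prems by presburger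
    then show ?thesis using that by blast
  qed
  then show ?case
  proof cases
    case 1 then show ?thesis by simp
  next
    case 2
    have k2: "k \<ge> 2" using less.prems 2 by simp
    have r0: "psi (k+1) * psi (k-1) = - x k * (psi k)^2" using psi_rec[of k] k2 by simp
    have r1: "psi (k+2) * psi k = - x (k+1) * (psi (k+1))^2" using psi_rec[of "k+1"] by simp
    have r2: "psi k * psi (k-2) = - x (k-1) * (psi (k-1))^2" using psi_rec[of "k-1"] k2
      by (simp add: Suc_diff_Suc numeral_2_eq_2)
    have r3: "psi 3 = - x 2 * c^2" using psi_rec[of 2] psi_2 by simp
    have "(psi (k+2) * psi (k-2)) * (psi k)^2 = (psi (k+2) * psi k) * (psi k * psi (k-2))"
      by (simp add: power2_eq_square)
    also have "\<dots> = x (k+1) * x (k-1) * (psi (k+1) * psi (k-1))^2"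
      unfolding r1 r2 by (simp add: power2_eq_square)
    also have "\<dots> = ((x k)^2 * (x (k+1) * x (k-1))) * (psi k)^2 * (psi k)^2"
      unfolding r0 by (simp add: power2_eq_square)
    also have "\<dots> = (- x k * (psi k)^2 * c^2 - psi 3 * (psi k)^2) * (psi k)^2"
      unfolding pro[OF k2] r3 c(1) b8_eq by (simp add: algebra_simps power2_eq_square)
    finally have "psi (k+2) * psi (k-2) = - x k * (psi k)^2 * c^2 - psi 3 * (psi k)^2"
      using psi_nz[of k] k2 by simp
    then show ?thesis using r0 2 psi_2 by simp
  next
    case 3
    have k: "k \<ge> i + 1" using less.prems 3 by simp
    obtain h where i: "i = Suc h" using 3(2) by (cases i) auto
    obtain d where d: "k = h + 2 + d" using k i using that[of "k - h - 2"] by simp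
    have IH1: "psi (k+1+i) * psi (k+1-i) = psi (k+2) * psi k * (psi i)^2 - psi (i+1) * psi (i-1) * (psi (k+1))^2"
      using less.IH[of i "k+1"] 3 k by simp
    have IH2: "psi (k-1+i) * psi (k-1-i) = psi k * psi (k-2) * (psi i)^2 - psi (i+1) * psi (i-1) * (psi (k-1))^2"
      using less.IH[of i "k-1"] 3 k by (simp add: d i)
    have IH3: "psi (k+(i-1)) * psi (k-(i-1)) = psi (k+1) * psi (k-1) * (psi (i-1))^2 - psi i * psi (i-2) * (psi k)^2"
      using less.IH[of "i-1" k] 3 k by (simp add: i numeral_2_eq_2)
    have p: "psi (k+1) * psi (k-1) = - x k * (psi k)^2" "psi (k+2) * psi k = - x (k+1) * (psi (k+1))^2"
      "psi k * psi (k-2) = - x (k-1) * (psi (k-1))^2" "psi (i+1) * psi (i-1) = - x i * (psi i)^2"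
      "psi (i+2) * psi i = - x (i+1) * (psi (i+1))^2" "psi i * psi (i-2) = - x (i-1) * (psi (i-1))^2"
      using psi_rec[of k] psi_rec[of "k+1"] psi_rec[of "k-1"] psi_rec[of i] psi_rec[of "i+1"] psi_rec[of "i-1"] k 3
      by (auto simp: d i numeral_2_eq_2 Suc_diff_Suc)
    define S where "S = psi (k+(i-1)) * psi (k-(i-1))"
    have S0: "S \<noteq> 0" using psi_nz k 3 by (simp add: S_def)
    have e1: "psi (k+1+i) * psi (k+1-i) = (psi (k+1))^2 * (psi i)^2 * (x i - x (k+1))"
      unfolding IH1 p by (simp add: algebra_simps)
    have e2: "psi (k-1+i) * psi (k-1-i) = (psi (k-1))^2 * (psi i)^2 * (x i - x (k-1))"
      unfolding IH2 p by (simp add: algebra_simps)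
    have e3: "S = (psi k)^2 * (psi (i-1))^2 * (x (i-1) - x k)"
      unfolding S_def IH3 p by (simp add: algebra_simps)
    have q: "psi (k+1+i) * psi (k+1-i) * (psi (k-1+i) * psi (k-1-i)) = psi (k+(i+1)) * psi (k-(i+1)) * S"
      unfolding S_def by (simp add: d i)
    have sw: "(x i - x (k+1)) * (x i - x (k-1)) * (x k)^2 = (x k - x (i+1)) * (x k - x (i-1)) * (x i)^2"
      by (rule root_product_swap[OF sum pro sum pro]) (use k 3(2) in simp_all)
    have a: "(psi (k+1))^2 * (psi (k-1))^2 = (x k)^2 * (psi k)^2 * (psi k)^2"
      "(psi (i+1))^2 * (psi (i-1))^2 = (x i)^2 * (psi i)^2 * (psi i)^2"
      using arg_cong[OF p(1), of "\<lambda>z. z^2"] arg_cong[OF p(4), of "\<lambda>z. z^2"]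
      by (simp_all only: power_mult_distrib power2_eq_square mult_minus_left mult_minus_right minus_minus mult_ac)
    have "psi (k+(i+1)) * psi (k-(i+1)) * S
        = ((psi (k+1))^2 * (psi (k-1))^2) * (psi i)^2 * (psi i)^2 * ((x i - x (k+1)) * (x i - x (k-1)))"
      unfolding q[symmetric] e1 e2 by (simp only: mult_ac)
    also have "\<dots> = (psi k)^2 * (psi k)^2 * (psi i)^2 * (psi i)^2 * ((x i - x (k+1)) * (x i - x (k-1)) * (x k)^2)"
      unfolding a by (simp only: mult_ac)
    also have "\<dots> = (psi k)^2 * (psi k)^2 * ((psi (i+1))^2 * (psi (i-1))^2) * ((x k - x (i+1)) * (x k - x (i-1)))"
      unfolding a sw by (simp only: mult_ac)
    also have "\<dots> = (psi k)^2 * (psi (i+1))^2 * (x (i+1) - x k) * S"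
      unfolding e3 by (simp add: algebra_simps)
    finally have "psi (k+(i+1)) * psi (k-(i+1)) * S = (psi k)^2 * (psi (i+1))^2 * (x (i+1) - x k) * S" .
    hence "psi (k+(i+1)) * psi (k-(i+1)) = (psi k)^2 * (psi (i+1))^2 * (x (i+1) - x k)" using S0 by simp
    then show ?thesis using p 3 by (simp add: algebra_simps)
  qed
qed

section \<open>The elliptic sequence on all integers and the addition formula for
  x-coordinates\<close>

definition Psi :: "int \<Rightarrow> 'a" where
  "Psi k = (if k \<ge> 0 then psi (nat k) else - psi (nat (- k)))"

lemma Psi_of_nat [simp]: "Psi (int n) = psi n"
  by (simp add: Psi_def)

lemma Psi_neg [simp]: "Psi (- k) = - Psi k"
  by (simp add: Psi_def)

lemma Psi_small [simp]: "Psi 0 = 0" "Psi 1 = 1"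
  by (simp_all add: Psi_def)

text \<open>Both sides change sign when k and j are exchanged and are fixed when j is negated, so
  \<open>psi_step\<close> extends to all integers.\<close>

lemma Psi_step:
  "Psi (k + j) * Psi (k - j) = Psi (k + 1) * Psi (k - 1) * (Psi j)^2 - Psi (j + 1) * Psi (j - 1) * (Psi k)^2"
proof -
  define E where "E k j \<longleftrightarrow> Psi (k + j) * Psi (k - j)
      = Psi (k + 1) * Psi (k - 1) * (Psi j)^2 - Psi (j + 1) * Psi (j - 1) * (Psi k)^2" for k j
  have swap: "E j k" if "E k j" for k j
    using that Psi_neg[of "k - j"] unfolding E_def by (simp add: algebra_simps)
  have neg: "E k (- j)" if "E k j" for k j
  proof -
    have "Psi (- j + 1) = - Psi (j - 1)" "Psi (- j - 1) = - Psi (j + 1)"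
      using Psi_neg[of "j - 1"] Psi_neg[of "j + 1"] by simp_all
    then show ?thesis using that unfolding E_def by (simp add: mult_ac)
  qed
  have nat: "E (int k) (int j)" if "j \<le> k" for k j
  proof (cases "j = 0")
    case True
    then show ?thesis using Psi_neg[of 1] unfolding E_def by (simp add: power2_eq_square del: Psi_neg)
  next
    case False
    then have "int k + int j = int (k + j)" "int k - int j = int (k - j)" "int k + 1 = int (k + 1)"
       "int k - 1 = int (k - 1)" "int j + 1 = int (j + 1)" "int j - 1 = int (j - 1)"
      using that by auto
    then show ?thesis unfolding E_def using psi_step[of j k] that False by (simp only: Psi_of_nat)
  qed
  have nat2: "E (int k) (int j)" for k j
    using nat[of j k] nat[of k j] swap by (cases "j \<le> k") auto
  have half: "E (int k) j" for k j
    by (cases j) (use nat2 neg in \<open>force simp del: of_nat_Suc\<close>)+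
  have "E k j"
    by (cases k) (use half neg swap in \<open>force simp del: of_nat_Suc\<close>)+
  then show ?thesis by (simp add: E_def)
qed

text \<open>\<open>L n u = (psi n)\<^sup>2 (u - x n)\<close> for \<open>n > 0\<close>; at \<open>n = 0\<close>, where \<open>x n\<close> should be infinite, it is \<open>- 1\<close>.\<close>

definition L :: "int \<Rightarrow> 'a \<Rightarrow> 'a" where
  "L k u = (Psi k)^2 * u + Psi (k + 1) * Psi (k - 1)"

lemma L_of_nat: "n \<ge> 1 \<Longrightarrow> L (int n) u = (psi n)^2 * (u - x n)"
proof -
  assume "n \<ge> 1"
  then have "int n + 1 = int (n + 1)" "int n - 1 = int (n - 1)" by auto
  then show ?thesis using psi_rec[OF \<open>n \<ge> 1\<close>] unfolding L_def
    by (simp only: Psi_of_nat) (simp add: algebra_simps)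
qed

lemma L_0: "L 0 u = - 1"
  using Psi_neg[of 1] by (simp add: L_def)

lemma L_eval:
  assumes "j \<ge> 1" shows "L k (x j) * (psi j)^2 = Psi (k + int j) * Psi (k - int j)"
proof -
  have "int j + 1 = int (j + 1)" "int j - 1 = int (j - 1)" using assms by auto
  then have "Psi (int j + 1) * Psi (int j - 1) = - x j * (psi j)^2"
    using psi_rec[OF assms] by (simp only: Psi_of_nat)
  then show ?thesis unfolding Psi_step[of k "int j"] L_def by (simp add: algebra_simps)
qed

abbreviation Phi :: "'a \<Rightarrow> 'a \<Rightarrow> 'a \<Rightarrow> 'a" where
  "Phi \<equiv> biq b2 b4 b6 b8"

definition F :: "nat \<Rightarrow> nat \<Rightarrow> 'a \<Rightarrow> 'a" where
  "F m n u = (psi m)^4 * (psi n)^4 * Phi (x m) (x n) u - L (int m + int n) u * L (int m - int n) u"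

text \<open>
  \<open>F m n u\<close> has no \<open>u\<^sup>2\<close> term because \<open>\<psi>\<close> is an elliptic sequence and no constant term because
  \<open>x 1 = 0\<close>.  By the symmetry of \<open>\<Phi>\<close> its remaining coefficient is proportional to
  \<open>x m * psi m ^ 4 * x n * psi n ^ 4\<close>, so a single vanishing instance is enough.
\<close>

lemma F_one: "m \<ge> 1 \<Longrightarrow> F m 1 u = 0"
proof (cases "m = 1")
  case True
  have "L 2 u = c^2 * (u - x 2)" using L_of_nat[of 2 u] by (simp add: numeral_2_eq_2)
  moreover have "F 1 1 u = Phi (x 1) (x 1) u + L 2 u" by (simp add: F_def L_0)
  moreover have "Phi (x 1) (x 1) u = - b6 * u - b8"
    unfolding x1 by (simp add: biq_def biq_sum_def biq_prod_def)
  ultimately have "F 1 1 u = - b6 * u - b8 + c^2 * (u - x 2)" by simp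
  also have "\<dots> = 0" unfolding c(1) using x2 by (simp add: algebra_simps)
  finally show ?thesis unfolding True .
next
  case False
  assume "m \<ge> 1"
  with False have m: "m \<ge> 2" by simp
  have i: "int m + int 1 = int (m + 1)" "int m - int 1 = int (m - 1)" using m by auto
  have "L (int m + int 1) u * L (int m - int 1) u
      = (psi (m+1) * psi (m-1))^2 * (u^2 - u * (x (m+1) + x (m-1)) + x (m+1) * x (m-1))"
    unfolding i using m by (subst (1 2) L_of_nat) (auto simp: algebra_simps power2_eq_square)
  also have "\<dots> = (psi m)^4 * ((x m)^2 * u^2 - u * ((x m)^2 * (x (m+1) + x (m-1))) + (x m)^2 * (x (m+1) * x (m-1)))"
    using m by (subst psi_rec) (auto simp: algebra_simps power2_eq_square power4_eq_xxxx)
  also have "\<dots> = (psi m)^4 * (psi 1)^4 * Phi (x m) (x 1) u"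
    unfolding sum[OF m] pro[OF m] x1 by (simp add: biq_def biq_sum_def biq_prod_def algebra_simps)
  finally show ?thesis by (simp add: F_def)
qed

lemma F_sym: "F m n u = F n m u"
proof -
  have "L (int n - int m) u = L (int m - int n) u"
  proof -
    have "int n - int m = - (int m - int n)" "- (int m - int n) + 1 = - (int m - int n - 1)"
      "- (int m - int n) - 1 = - (int m - int n + 1)" by simp_all
    then show ?thesis unfolding L_def by (simp only: Psi_neg power2_minus minus_mult_minus mult.commute)
  qed
  then show ?thesis unfolding F_def biq_perm(1)[of b2 b4 b6 b8 "x m" "x n" u]
    by (simp only: add.commute mult.commute)
qed

text \<open>By \<open>L_eval\<close> the subtracted part of F m n (x k) becomes a product of the
  four \<open>Psi\<close> at m \<plusminus> n \<plusminus> k, and the other part inherits the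
  symmetry of Phi; so n and k may be exchanged.\<close>

lemma F_swap:
  assumes "n \<ge> 1" "k \<ge> 1" shows "F m n (x k) * (psi k)^4 = F m k (x n) * (psi n)^4"
proof -
  have *: "L (int m + int n) (x k) * L (int m - int n) (x k) * (psi k)^4
      = Psi (int m + int n + int k) * Psi (int m + int n - int k) *
        (Psi (int m - int n + int k) * Psi (int m - int n - int k))" if "k \<ge> 1" for n k
    unfolding L_eval[OF that, symmetric] by (simp add: power4_eq_xxxx power2_eq_square mult_ac)
  have h: "L (int m + int n) (x k) * L (int m - int n) (x k) * (psi k)^4
      = L (int m + int k) (x n) * L (int m - int k) (x n) * (psi n)^4"
    unfolding *[OF assms(1)] *[OF assms(2)] by (simp add: algebra_simps)
  show ?thesis unfolding F_def biq_perm(2)[of b2 b4 b6 b8 "x m" "x n" "x k"] left_diff_distrib h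
    by (rule arg_cong2[of _ _ _ _ "(-)"]) (simp_all only: mult_ac)
qed

lemma F_linear:
  assumes "m \<ge> 1" "n \<ge> 1" shows "F m n u = u * F m n 1"
proof -
  have "F m n (x 1) * (psi 1)^4 = F m 1 (x n) * (psi n)^4"
    by (rule F_swap) (use assms in simp_all)
  then have F0: "F m n 0 = 0" unfolding F_one[OF assms(1)] x1 by simp
  have j: "int n + 1 = int (n + 1)" "int n - 1 = int (n - 1)" "int m + 1 = int (m + 1)" "int m - 1 = int (m - 1)"
    using assms by auto
  have P: "psi (m+1) * psi (m-1) = - x m * (psi m)^2" "psi (n+1) * psi (n-1) = - x n * (psi n)^2"
    using psi_rec assms by auto
  have E: "Psi (int m + int n) * Psi (int m - int n) = (psi m)^2 * (psi n)^2 * (x n - x m)"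
    unfolding Psi_step[of "int m" "int n"] j Psi_of_nat P by (simp add: algebra_simps)
  have E2: "(Psi (int m + int n) * Psi (int m - int n))^2 = (psi m)^4 * (psi n)^4 * (x m - x n)^2"
    unfolding E by (simp add: power2_eq_square power4_eq_xxxx algebra_simps)
  then have E3: "(Psi (int m + int n))^2 * (Psi (int m - int n))^2 = (psi m)^4 * (psi n)^4 * (x m - x n)^2"
    by (simp only: power_mult_distrib)
  define B where "B = (psi m)^4 * (psi n)^4 * (- biq_sum b2 b4 b6 (x m) (x n))
      - (Psi (int m + int n))^2 * (Psi (int m - int n + 1) * Psi (int m - int n - 1))
      - (Psi (int m - int n))^2 * (Psi (int m + int n + 1) * Psi (int m + int n - 1))"
  have "F m n v = ((psi m)^4 * (psi n)^4 * (x m - x n)^2 - (Psi (int m + int n))^2 * (Psi (int m - int n))^2) * v^2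
      + v * B + F m n 0" for v
    unfolding F_def L_def biq_def B_def by (simp add: algebra_simps power2_eq_square)
  then have "F m n v = v * B" for v unfolding E3 F0 by simp
  then show ?thesis by simp
qed

text \<open>An explicit computation. The recurrences at n = 2, 3, 4 express everything through a = x
  2, e = x 3 and g = b6 / a: b6 = a g, b8 = - a^2 g, b4 = a e - g, then b2 from the relation for 4
  b8, and x 4, x 5 with denominators cleared.\<close>

lemma F_3_2: "F 3 2 1 = 0"
proof -
  define a e p q g where "a = x 2" "e = x 3" "p = x 4" "q = x 5" "g = b6 / a"
  have a0: "a \<noteq> 0" "p \<noteq> 0" "e \<noteq> 0" using nz by (auto simp: a_e_p_q_g_def)
  have g0: "g \<noteq> 0" using a0 c by (auto simp: a_e_p_q_g_def)
  have b6: "b6 = a * g" using a0 by (simp add: a_e_p_q_g_def)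
  have b8': "b8 = - a * a * g" using b8_eq b6 a_e_p_q_g_def(1) by (metis mult.commute mult.assoc mult_minus_left)
  have "a^2 * e = b4 * a + b6" using sum[of 2] x1 by (simp add: a_e_p_q_g_def)
  then have "a * (a * e - g - b4) = 0" by (simp add: b6 algebra_simps power2_eq_square)
  then have b4: "b4 = a * e - g" using a0 by simp
  have "e^2 * (p * a) = - (b6 * e + b8)" using pro[of 3] by (simp add: a_e_p_q_g_def)
  then have "a * (e^2 * p + g * (e - a)) = 0" by (simp add: b6 b8' algebra_simps)
  then have p: "e^2 * p = - g * (e - a)" using a0 by (simp add: eq_neg_iff_add_eq_0)
  have "p^2 * (q + e) = b4 * p + b6" using sum[of 4] by (simp add: a_e_p_q_g_def)
  then have "(e^2 * p)^2 * (q + e) = b4 * e^2 * (e^2 * p) + e^4 * b6"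
    by (simp add: power_mult_distrib algebra_simps power4_eq_xxxx power2_eq_square)
  then have "g * (g * (e - a)^2 * (q + e) + b4 * e^2 * (e - a) - e^4 * a) = 0"
    unfolding p b6 by (simp add: algebra_simps power2_eq_square)
  then have "g * (e - a)^2 * (q + e) + b4 * e^2 * (e - a) - e^4 * a = 0" using g0 by (simp only: mult_eq_0_iff) simp
  then have q: "g * (e - a)^2 * (q + e) = e^4 * a - b4 * e^2 * (e - a)" by (simp add: algebra_simps)
  have b2: "b2 * a * g = (a * e - g)^2 - 4 * a * a * g" using b8 unfolding b6 b8' b4 by (simp add: algebra_simps)
  have "g * ((e - a)^2 * q - biq_sum b2 b4 b6 e a) =
     g * (e - a)^2 * (q + e) - g * (e - a)^2 * e - 2 * e * a * (e + a) * g - (b2 * a * g) * e - b4 * (e + a) * g - b6 * g"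
    by (simp add: biq_sum_def algebra_simps)
  also have "\<dots> = 0" unfolding q b2 b6 b4
    by (simp add: algebra_simps power2_eq_square power4_eq_xxxx)
  finally have S: "biq_sum b2 b4 b6 e a = (e - a)^2 * q" using g0 by simp
  have p5: "psi 5 = (psi 3)^2 * c^2 * (a - e)"
    using psi_step[of 2 3] psi_rec[of 2] psi_rec[of 3] 
    by (simp add: a_e_p_q_g_def algebra_simps eval_nat_numeral)
  have L1: "L 1 u = u" for u using L_of_nat[of 1 u] x1 by simp
  have L5: "L 5 u = (psi 5)^2 * (u - q)" for u using L_of_nat[of 5 u] by (simp add: a_e_p_q_g_def)
  have F32: "F 3 2 u = (psi 3)^4 * c^4 * Phi e a u - (psi 5)^2 * (u - q) * u" for u
    unfolding F_def using L1 L5 psi_2 by (simp add: a_e_p_q_g_def)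
  \<comment> \<open>Subtracting F 3 2 0 = 0 removes the constant terms, among them
    \<open>biq_prod\<close>, so that only \<open>biq_sum\<close> has to be matched.\<close>
  have "F 3 2 1 = F 3 2 1 - F 3 2 0"
    using F_linear[of 3 2 0] by simp
  also have "\<dots> = (psi 3)^4 * c^4 * ((e - a)^2 - biq_sum b2 b4 b6 e a) - (psi 5)^2 * (1 - q)"
    unfolding F32 by (simp add: biq_def algebra_simps)
  also have "\<dots> = 0"
    unfolding S p5 by (simp add: algebra_simps power2_eq_square power4_eq_xxxx)
  finally show ?thesis .
qed

text \<open>Two swaps spread the instance (3, 2): first to (2, m) through k = 3, then to (m, n)
  through k = 2. Dividing by x k is possible because k \<ge> 2.\<close>

lemma F_zero:
  assumes "m \<ge> 1" "n \<ge> 1" shows "F m n u = 0"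
proof -
  have sw: "F m n 1 = 0" if "F m k 1 = 0" "k \<ge> 2" "m \<ge> 1" "n \<ge> 1" for m n k
  proof -
    have "x k * F m n 1 * (psi k)^4 = x n * F m k 1 * (psi n)^4"
      using F_swap[of n k m] F_linear[of m n "x k"] F_linear[of m k "x n"] that by simp
    then show ?thesis using that nz[of k] psi_nz[of k] by simp
  qed
  have "F 2 m 1 = 0" using F_3_2 sw[of 2 3 m] F_sym[of 2 3] assms by simp
  then have "F m n 1 = 0" using sw[of m 2 n] F_sym[of 2 m] assms by simp
  then show ?thesis using F_linear[OF assms, of u] by simp
qed

lemma biq_diff:
  assumes "n \<ge> 1" "m > n"
  shows "Phi (x m) (x n) u = (x m - x n)^2 * ((u - x (m+n)) * (u - x (m-n)))"
proof -
  have i: "int m + int n = int (m + n)" "int m - int n = int (m - n)" using assms by auto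
  have j: "int n + 1 = int (n + 1)" "int n - 1 = int (n - 1)" "int m + 1 = int (m + 1)" "int m - 1 = int (m - 1)"
    using assms by auto
  have P: "psi (m+1) * psi (m-1) = - x m * (psi m)^2" "psi (n+1) * psi (n-1) = - x n * (psi n)^2"
    using psi_rec assms by auto
  have E: "psi (m+n) * psi (m-n) = (psi m)^2 * (psi n)^2 * (x n - x m)"
    using Psi_step[of "int m" "int n"] unfolding i j Psi_of_nat P by (simp add: algebra_simps)
  have "L (int m + int n) u * L (int m - int n) u = (psi (m+n) * psi (m-n))^2 * ((u - x (m+n)) * (u - x (m-n)))"
    unfolding i using assms by (subst (1 2) L_of_nat) (auto simp: algebra_simps power2_eq_square)
  also have "\<dots> = (psi m)^4 * (psi n)^4 * ((x m - x n)^2 * ((u - x (m+n)) * (u - x (m-n))))"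
    unfolding E by (simp add: algebra_simps power2_eq_square power4_eq_xxxx)
  finally show "Phi (x m) (x n) u = (x m - x n)^2 * ((u - x (m+n)) * (u - x (m-n)))"
    using F_zero[of m n u] psi_nz[of m] psi_nz[of n] assms by (simp add: F_def)
qed

text \<open>For A = B the factor \<open>L_0\<close> is constant, so Phi degenerates to a linear
  polynomial with root x (2 n).\<close>

lemma biq_same:
  assumes "n \<ge> 1"
  shows "\<exists>k. k \<noteq> 0 \<and> (\<forall>u. Phi (x n) (x n) u = k * (x (2*n) - u))"
proof -
  have i: "int n + int n = int (2*n)" "int n - int n = 0" by auto
  have "(psi n)^4 * (psi n)^4 * Phi (x n) (x n) u = L (int n + int n) u * L (int n - int n) u" for u
    using F_zero[of n n u] assms unfolding F_def by simp
  then have "(psi n)^4 * (psi n)^4 * Phi (x n) (x n) u = (psi (2*n))^2 * (x (2*n) - u)" for u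
    unfolding i L_0 using L_of_nat[of "2*n" u] assms by (simp add: algebra_simps)
  then have "Phi (x n) (x n) u = (psi (2*n))^2 / ((psi n)^4 * (psi n)^4) * (x (2*n) - u)" for u
    using psi_nz[of n] assms by (simp add: field_simps)
  then show ?thesis using psi_nz[of n] psi_nz[of "2*n"] assms
    by (intro exI[of _ "(psi (2*n))^2 / ((psi n)^4 * (psi n)^4)"]) simp
qed

end

section \<open>Weierstrass equations and the chord-and-tangent law\<close>

definition wb2 :: "'a::comm_ring_1 weierstrass \<Rightarrow> 'a" where "wb2 W = (wa1 W)^2 + 4 * wa2 W"
definition wb4 :: "'a::comm_ring_1 weierstrass \<Rightarrow> 'a" where "wb4 W = 2 * wa4 W + wa1 W * wa3 W"
definition wb6 :: "'a::comm_ring_1 weierstrass \<Rightarrow> 'a" where "wb6 W = (wa3 W)^2 + 4 * wa6 W"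
definition wb8 :: "'a::comm_ring_1 weierstrass \<Rightarrow> 'a" where
  "wb8 W = (wa1 W)^2 * wa6 W + 4 * wa2 W * wa6 W - wa1 W * wa3 W * wa4 W
     + wa2 W * (wa3 W)^2 - (wa4 W)^2"

lemmas wb_defs = wb2_def wb4_def wb6_def wb8_def

lemma wb8_rel: "4 * wb8 W = wb2 W * wb6 W - (wb4 W)^2"
  by (simp add: wb_defs algebra_simps power2_eq_square)

lemma disc_wb: "disc W = - ((wb2 W)^2 * wb8 W) - 8 * (wb4 W)^3 - 27 * (wb6 W)^2 + 9 * wb2 W * wb4 W * wb6 W"
  by (simp add: disc_def wb_defs Let_def)

lemma map_weierstrass_of_int:
  fixes W :: "int weierstrass"
  shows "wb2 (map_weierstrass of_int W) = (of_int (wb2 W) :: 'a::comm_ring_1)"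
    "wb4 (map_weierstrass of_int W) = (of_int (wb4 W) :: 'a)"
    "wb6 (map_weierstrass of_int W) = (of_int (wb6 W) :: 'a)"
    "wb8 (map_weierstrass of_int W) = (of_int (wb8 W) :: 'a)"
    "wpoly (map_weierstrass of_int W) (of_int x) (of_int y) = (of_int (wpoly W x y) :: 'a)"
  by (cases W; simp add: wb_defs wpoly_def)+

lemma wpoly_dy_square:
  "(wpoly_dy W x y)^2 = quartic (wb2 W) (wb4 W) (wb6 W) x + 4 * wpoly W x y"
  by (simp add: wpoly_dy_def wpoly_def quartic_def wb_defs algebra_simps power2_eq_square power3_eq_cube)

text \<open>Translation by r changes the b-invariants as written and moves both roots of Phi by r.
  Their sum falls by 2 r; the next lemma is the matching change of their product.\<close>

lemma biq_sum_shift: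
  fixes r :: "'a::comm_ring_1"
  shows "biq_sum (b2 + 12 * r) (b4 + b2 * r + 6 * r^2) (b6 + 2 * b4 * r + b2 * r^2 + 4 * r^3) (x - r) (u - r)
    = biq_sum b2 b4 b6 x u - 2 * r * (x - u)^2"
  by (simp add: biq_sum_def algebra_simps power2_eq_square power3_eq_cube)

lemma biq_prod_shift:
  fixes r :: "'a::comm_ring_1"
  shows "biq_prod (b4 + b2 * r + 6 * r^2) (b6 + 2 * b4 * r + b2 * r^2 + 4 * r^3)
      (b8 + 3 * b6 * r + 3 * b4 * r^2 + b2 * r^3 + 3 * r^4) (x - r) (u - r)
    = biq_prod b4 b6 b8 x u - r * biq_sum b2 b4 b6 x u + r^2 * (x - u)^2"
  by (simp add: biq_sum_def biq_prod_def algebra_simps power2_eq_square power3_eq_cube power4_eq_xxxx)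

text \<open>The situation of \<open>kummer_seq\<close> with x(P) arbitrary; the sublocale
  \<open>shifted\<close> moves x(P) to 0.\<close>

locale kummer_orbit =
  fixes b2 b4 b6 b8 c :: "'a::field" and x :: "nat \<Rightarrow> 'a"
  assumes b8: "4 * b8 = b2 * b6 - b4^2"
    and c: "c^2 = biq_sum b2 b4 b6 (x 1) (x 1)" "c \<noteq> 0"
    and x2: "c^2 * x 2 = biq_prod b4 b6 b8 (x 1) (x 1)"
    and neq1: "n \<ge> 2 \<Longrightarrow> x n \<noteq> x 1"
    and sum1: "n \<ge> 2 \<Longrightarrow> (x n - x 1)^2 * (x (n+1) + x (n-1)) = biq_sum b2 b4 b6 (x n) (x 1)"
    and prod1: "n \<ge> 2 \<Longrightarrow> (x n - x 1)^2 * (x (n+1) * x (n-1)) = biq_prod b4 b6 b8 (x n) (x 1)"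
begin

abbreviation "r \<equiv> x 1"

sublocale shifted: kummer_seq "b2 + 12 * r" "b4 + b2 * r + 6 * r^2" "b6 + 2 * b4 * r + b2 * r^2 + 4 * r^3"
  "b8 + 3 * b6 * r + 3 * b4 * r^2 + b2 * r^3 + 3 * r^4" c "\<lambda>n. x n - r"
proof
  show "4 * (b8 + 3 * b6 * r + 3 * b4 * r^2 + b2 * r^3 + 3 * r^4)
    = (b2 + 12 * r) * (b6 + 2 * b4 * r + b2 * r^2 + 4 * r^3) - (b4 + b2 * r + 6 * r^2)^2"
    using b8 by (simp add: algebra_simps power2_eq_square power3_eq_cube power4_eq_xxxx)
  show c': "c^2 = b6 + 2 * b4 * r + b2 * r^2 + 4 * r^3"
    unfolding c by (simp add: biq_sum_def algebra_simps power2_eq_square power3_eq_cube)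
  show "c \<noteq> 0" by (rule c)
  show "x 1 - r = 0" by simp
  show "(b6 + 2 * b4 * r + b2 * r^2 + 4 * r^3) * (x 2 - r)
     = - (b8 + 3 * b6 * r + 3 * b4 * r^2 + b2 * r^3 + 3 * r^4)"
    unfolding c'[symmetric] right_diff_distrib x2 unfolding c'
    by (simp add: biq_prod_def algebra_simps power2_eq_square power3_eq_cube power4_eq_xxxx)
next
  fix n :: nat assume n: "n \<ge> 2"
  then show "x n - r \<noteq> 0" using neq1 by simp
  have "(x n - r)^2 * (x (n+1) - r + (x (n-1) - r)) = biq_sum b2 b4 b6 (x n) r - 2 * r * (x n - r)^2"
    using sum1[OF n] by (simp add: algebra_simps)
  also have "\<dots> = (b4 + b2 * r + 6 * r^2) * (x n - r) + (b6 + 2 * b4 * r + b2 * r^2 + 4 * r^3)"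
    unfolding biq_sum_shift[symmetric] by (simp add: biq_sum_def)
  finally show "(x n - r)^2 * (x (n+1) - r + (x (n-1) - r)) = \<dots>" .
  have "(x n - r)^2 * ((x (n+1) - r) * (x (n-1) - r))
     = biq_prod b4 b6 b8 (x n) r - r * biq_sum b2 b4 b6 (x n) r + r^2 * (x n - r)^2"
    unfolding sum1[OF n, symmetric] prod1[OF n, symmetric] by (simp add: algebra_simps power2_eq_square)
  also have "\<dots> = - ((b6 + 2 * b4 * r + b2 * r^2 + 4 * r^3) * (x n - r)
      + (b8 + 3 * b6 * r + 3 * b4 * r^2 + b2 * r^3 + 3 * r^4))"
    unfolding biq_prod_shift[symmetric] by (simp add: biq_prod_def)
  finally show "(x n - r)^2 * ((x (n+1) - r) * (x (n-1) - r)) = \<dots>" .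
qed

lemma biq_shift:
  "shifted.Phi (u - r) (v - r) (w - r) = biq b2 b4 b6 b8 u v w"
  unfolding biq_def biq_sum_shift biq_prod_shift by (simp add: algebra_simps power2_eq_square)

context
  fixes m n :: nat
  assumes mn: "n \<ge> 1" "m > n"
begin

lemma biq_diff: "biq b2 b4 b6 b8 (x m) (x n) u = (x m - x n)^2 * ((u - x (m+n)) * (u - x (m-n)))"
  using shifted.biq_diff[OF mn, of "u - r"] unfolding biq_shift by simp

lemma prod_diff: "(x m - x n)^2 * (x (m+n) * x (m-n)) = biq_prod b4 b6 b8 (x m) (x n)"
  using biq_diff[of 0] by (simp add: biq_def)

lemma sum_diff: "(x m - x n)^2 * (x (m+n) + x (m-n)) = biq_sum b2 b4 b6 (x m) (x n)"
proof -
  have "(x m - x n)^2 - biq_sum b2 b4 b6 (x m) (x n) + (x m - x n)^2 * (x (m+n) * x (m-n))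
     = (x m - x n)^2 * ((1 - x (m+n)) * (1 - x (m-n)))"
    using biq_diff[of 1] unfolding prod_diff by (simp add: biq_def)
  then show ?thesis by (simp add: algebra_simps)
qed

end

lemma double:
  assumes "n \<ge> 1"
  shows "biq_sum b2 b4 b6 (x n) (x n) \<noteq> 0"
    and "biq_sum b2 b4 b6 (x n) (x n) * x (2*n) = biq_prod b4 b6 b8 (x n) (x n)"
proof -
  obtain k where k: "k \<noteq> 0" "\<And>u. shifted.Phi (x n - r) (x n - r) u = k * (x (2*n) - r - u)"
    using shifted.biq_same[OF assms] by auto
  have *: "biq b2 b4 b6 b8 (x n) (x n) u = k * (x (2*n) - u)" for u
    using k(2)[of "u - r"] unfolding biq_shift by simp
  have p: "biq_prod b4 b6 b8 (x n) (x n) = k * x (2*n)" using *[of 0] by (simp add: biq_def)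
  moreover have "biq_sum b2 b4 b6 (x n) (x n) = k"
    using *[of 1] unfolding p biq_def by (simp add: algebra_simps)
  ultimately show "biq_sum b2 b4 b6 (x n) (x n) \<noteq> 0"
    "biq_sum b2 b4 b6 (x n) (x n) * x (2*n) = biq_prod b4 b6 b8 (x n) (x n)"
    using k(1) by auto
qed

end

section \<open>The chord-and-tangent law in terms of x-coordinates\<close>

lemma point_add_affineE:
  fixes W :: "'a::field weierstrass"
  assumes "on_curve W (Affine x1 y1)" "on_curve W (Affine x2 y2)"
    and "point_add W (Affine x1 y1) (Affine x2 y2) = Affine x3 y3"
  obtains l where "x3 = l^2 + wa1 W * l - wa2 W - x1 - x2"
    and "y3 = - (l + wa1 W) * x3 - (y2 - l * x2) - wa3 W"
    and "y2 - y1 = l * (x2 - x1)"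
    and "x1 = x2 \<Longrightarrow> y1 = y2 \<and> wpoly_dy W x1 y1 \<noteq> 0 \<and> l * wpoly_dy W x1 y1 = - wpoly_dx W x1 y1"
proof (cases "x1 = x2")
  case True
  have e: "y1 + y2 + wa1 W * x2 + wa3 W \<noteq> 0" using assms(3) True by auto
  \<comment> \<open>Two points with the same x are equal or opposite. Opposite points would add up
    to \<open>Infty\<close>, so only the tangent remains.\<close>
  have "(y1 - y2) * (y1 + y2 + wa1 W * x2 + wa3 W) = wpoly W x1 y1 - wpoly W x2 y2"
    by (simp add: wpoly_def True algebra_simps power2_eq_square)
  then have y: "y1 = y2" using assms e by simp
  define l where "l = (3 * x1^2 + 2 * wa2 W * x1 + wa4 W - wa1 W * y1) / (2 * y1 + wa1 W * x1 + wa3 W)"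
  have d: "2 * y1 + wa1 W * x1 + wa3 W \<noteq> 0" using e y True by (simp add: algebra_simps)
  show ?thesis
    by (rule that[of l]) (use assms(3) True y d e in \<open>auto simp: Let_def wpoly_dy_def wpoly_dx_def l_def\<close>)
next
  case False
  define l where "l = (y2 - y1) / (x2 - x1)"
  have l: "y2 - y1 = l * (x2 - x1)" using False by (simp add: l_def)
  have "y1 - l * x1 = y2 - l * x2" using l by (simp add: algebra_simps)
  then show ?thesis
    by (intro that[of l]) (use assms(3) False l in \<open>auto simp: Let_def l_def[symmetric]\<close>)
qed

lemma wpoly_neg: "wpoly W x (- y - wa1 W * x - wa3 W) = wpoly W x y"
  by (simp add: wpoly_def algebra_simps power2_eq_square)

text \<open>On the line y = l t + v the curve equation is a cubic g(t) with roots x1 and x2. The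
  formula for x3 fixes its t^2 coefficient; once p is minus the second symmetric function of x1, x2,
  x3, it follows that g(x3) = g(x1) = 0. Reflection then yields y3.\<close>

lemma on_curve_point_add:
  fixes W :: "'a::field weierstrass"
  assumes A: "on_curve W (Affine x1 y1)" and B: "on_curve W (Affine x2 y2)"
    and C: "point_add W (Affine x1 y1) (Affine x2 y2) = Affine x3 y3"
  shows "on_curve W (Affine x3 y3)"
proof -
  obtain l where l: "x3 = l^2 + wa1 W * l - wa2 W - x1 - x2"
    "y3 = - (l + wa1 W) * x3 - (y2 - l * x2) - wa3 W" "y2 - y1 = l * (x2 - x1)"
    "x1 = x2 \<Longrightarrow> y1 = y2 \<and> wpoly_dy W x1 y1 \<noteq> 0 \<and> l * wpoly_dy W x1 y1 = - wpoly_dx W x1 y1"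
    using point_add_affineE[OF A B C] by metis
  define v where "v = y2 - l * x2"
  define g where "g t = wpoly W t (l * t + v)" for t
  define p where "p = 2 * l * v + wa1 W * v + wa3 W * l - wa4 W"
  have g: "g t = - (t^3) + (x1 + x2 + x3) * t^2 + p * t + g 0" for t
    unfolding g_def wpoly_def p_def l(1) by (simp add: algebra_simps power2_eq_square power3_eq_cube)
  have y: "y1 = l * x1 + v" "y2 = l * x2 + v" using l(3) by (auto simp: v_def algebra_simps)
  have g0: "g x1 = 0" "g x2 = 0" using A B by (simp_all add: g_def y)
  have p: "p = - (x1 * x2 + x1 * x3 + x2 * x3)"
  proof (cases "x1 = x2")
    case False
    have "(x1 - x2) * (p + (x1 * x2 + x1 * x3 + x2 * x3)) = g x1 - g x2"
      unfolding g[of x1] g[of x2] by (simp add: algebra_simps power2_eq_square power3_eq_cube)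
    then have "p + (x1 * x2 + x1 * x3 + x2 * x3) = 0" using g0 False by simp
    then show ?thesis by (simp only: eq_neg_iff_add_eq_0)
  next
    case True
    \<comment> \<open>The left side is the derivative of g at x1, which vanishes for a
      tangent.\<close>
    have "wpoly_dx W x1 y1 + l * wpoly_dy W x1 y1 = p + (x1 * x1 + 2 * x1 * x3)"
      unfolding wpoly_dx_def wpoly_dy_def p_def l(1) y True
      by (simp add: algebra_simps power2_eq_square)
    moreover have "y1 = y2" "l * wpoly_dy W x1 y1 = - wpoly_dx W x1 y1" using l(4)[OF True] by auto
    ultimately have "p + (x1 * x1 + 2 * x1 * x3) = 0" by simp
    then show ?thesis using True by (simp add: eq_neg_iff_add_eq_0 algebra_simps)
  qed
  have "g x3 = g x1"
    unfolding g[of x3] g[of x1] p by (simp add: algebra_simps power2_eq_square power3_eq_cube)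
  then have "wpoly W x3 (l * x3 + v) = 0" using g0 by (simp add: g_def)
  moreover have y3: "y3 = - (l * x3 + v) - wa1 W * x3 - wa3 W" using l(2) by (simp add: v_def algebra_simps)
  have "wpoly W x3 y3 = wpoly W x3 (l * x3 + v)" unfolding y3 by (rule wpoly_neg)
  ultimately show ?thesis by simp
qed

text \<open>l and k are the slopes of the lines from A = (x, y) to B = (u, w) and to -B, so z = x(A
  + B) and v = x(A - B).\<close>

lemma point_sum_diff:
  fixes W :: "'a::field_char_0 weierstrass"
  assumes "wpoly W x y = 0" "wpoly W u w = 0" "x \<noteq> u"
    and l: "y - w = l * (x - u)" and k: "y + w + wa1 W * u + wa3 W = k * (x - u)"
    and z: "z = l^2 + wa1 W * l - wa2 W - x - u" and v: "v = k^2 + wa1 W * k - wa2 W - x - u"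
  shows "(x - u)^2 * (z + v) = biq_sum (wb2 W) (wb4 W) (wb6 W) x u"
    and "(x - u)^2 * (z * v) = biq_prod (wb4 W) (wb6 W) (wb8 W) x u"
proof -
  define h e M where "h = wpoly_dy W x y" "e = wpoly_dy W u w"
    "M = (wb2 W + 4 * x + 4 * u) * (x - u)^2"
  have h: "h^2 = quartic (wb2 W) (wb4 W) (wb6 W) x" and e: "e^2 = quartic (wb2 W) (wb4 W) (wb6 W) u"
    using assms(1,2) by (simp_all add: h_e_M_def wpoly_dy_square)
  have hl: "h - e = (2 * l + wa1 W) * (x - u)"
  proof -
    have "h - e = 2 * (y - w) + wa1 W * (x - u)" by (simp add: h_e_M_def wpoly_dy_def algebra_simps)
    then show ?thesis unfolding l by (simp add: algebra_simps)
  qed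
  have ke: "h + e = (2 * k + wa1 W) * (x - u)"
  proof -
    have "h + e = 2 * (y + w + wa1 W * u + wa3 W) + wa1 W * (x - u)"
      by (simp add: h_e_M_def wpoly_dy_def algebra_simps)
    then show ?thesis unfolding k by (simp add: algebra_simps)
  qed
  have Z: "4 * (x - u)^2 * z = (h - e)^2 - M" unfolding hl
    unfolding z h_e_M_def wb2_def by (simp add: algebra_simps power2_eq_square)
  have V: "4 * (x - u)^2 * v = (h + e)^2 - M" unfolding ke
    unfolding v h_e_M_def wb2_def by (simp add: algebra_simps power2_eq_square)
  have "4 * ((x - u)^2 * (z + v)) = 2 * (h^2 + e^2) - 2 * M"
  proof -
    have "4 * ((x - u)^2 * (z + v)) = 4 * (x - u)^2 * z + 4 * (x - u)^2 * v" by (simp add: algebra_simps)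
    then show ?thesis unfolding Z V by (simp add: algebra_simps power2_eq_square)
  qed
  also have "\<dots> = 4 * biq_sum (wb2 W) (wb4 W) (wb6 W) x u"
    unfolding h e unfolding h_e_M_def(3) quartic_biq_sum ..
  finally show "(x - u)^2 * (z + v) = biq_sum (wb2 W) (wb4 W) (wb6 W) x u" by simp
  have "16 * (x - u)^2 * ((x - u)^2 * (z * v)) = (4 * (x - u)^2 * z) * (4 * (x - u)^2 * v)" by simp
  also have "\<dots> = (h^2 - e^2)^2 - 2 * (h^2 + e^2) * M + M^2" unfolding Z V
    by (simp add: algebra_simps power2_eq_square)
  also have "\<dots> = 16 * (x - u)^2 * biq_prod (wb4 W) (wb6 W) (wb8 W) x u"
    unfolding h e unfolding h_e_M_def(3) by (rule quartic_biq_prod[OF wb8_rel])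
  finally show "(x - u)^2 * (z * v) = biq_prod (wb4 W) (wb6 W) (wb8 W) x u" using assms(3) by simp
qed

text \<open>A recurrence linking [n + 1]P, [n]P and [n - 1]P is wanted, while the definition only
  provides [n]P + P. The line used for [n]P = [n - 1]P + P, reflected, passes through [n]P and -P,
  so it also yields [n]P - P.\<close>

lemma kummer_orbit_point_mult:
  fixes W :: "'a::field_char_0 weierstrass"
  assumes S: "\<And>n. n \<ge> 1 \<Longrightarrow> point_mult W n P = Affine (x n) (y n)" and P: "on_curve W P"
  shows "kummer_orbit (wb2 W) (wb4 W) (wb6 W) (wb8 W) (wpoly_dy W (x 1) (y 1)) x"
    and "\<And>n. n \<ge> 1 \<Longrightarrow> wpoly W (x n) (y n) = 0"
proof -
  have P1: "P = Affine (x 1) (y 1)" using S[of 1] by simp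
  have step: "point_add W (Affine (x n) (y n)) (Affine (x 1) (y 1)) = Affine (x (n+1)) (y (n+1))" if "n \<ge> 1" for n
    using S[of "n+1"] S[OF that] P1 by simp
  show on: "wpoly W (x n) (y n) = 0" if "n \<ge> 1" for n
    using that
  proof (induction n rule: nat_induct_at_least)
    case base then show ?case using P P1 by simp
  next
    case (Suc n)
    then show ?case using on_curve_point_add[OF _ _ step[of n]] P P1 by simp
  qed
  have prev: "\<exists>l. x n = l^2 + wa1 W * l - wa2 W - x (n-1) - x 1 \<and>
      y n = - (l + wa1 W) * x n - (y 1 - l * x 1) - wa3 W" if "n \<ge> 2" for n
  proof -
    have m: "n - 1 \<ge> 1" "n - 1 + 1 = n" using that by auto
    have "on_curve W (Affine (x (n-1)) (y (n-1)))" "on_curve W (Affine (x 1) (y 1))"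
      using on[OF m(1)] on[of 1] by simp_all
    from point_add_affineE[OF this step[OF m(1), unfolded m(2)]] show ?thesis by metis
  qed
  \<comment> \<open>Otherwise [n]P = -P, and [n + 1]P would be \<open>Infty\<close>.\<close>
  have neq: "x n \<noteq> x 1" if n: "n \<ge> 2" for n
  proof
    assume e: "x n = x 1"
    obtain l where l: "y n = - (l + wa1 W) * x n - (y 1 - l * x 1) - wa3 W" using prev[OF n] by blast
    have "y n + y 1 + wa1 W * x 1 + wa3 W = 0" unfolding l e by (simp add: algebra_simps)
    then show False using step[of n] n e by simp
  qed
  show "kummer_orbit (wb2 W) (wb4 W) (wb6 W) (wb8 W) (wpoly_dy W (x 1) (y 1)) x"
  proof
    show "4 * wb8 W = wb2 W * wb6 W - (wb4 W)^2" by (rule wb8_rel)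
    show c: "(wpoly_dy W (x 1) (y 1))^2 = biq_sum (wb2 W) (wb4 W) (wb6 W) (x 1) (x 1)"
      using on[of 1] by (simp add: wpoly_dy_square biq_sum_same)
    obtain l where l: "x 2 = l^2 + wa1 W * l - wa2 W - x 1 - x 1" "wpoly_dy W (x 1) (y 1) \<noteq> 0"
      "l * wpoly_dy W (x 1) (y 1) = - wpoly_dx W (x 1) (y 1)"
    proof -
      have "on_curve W (Affine (x 1) (y 1))" using on[of 1] by simp
      moreover have "point_add W (Affine (x 1) (y 1)) (Affine (x 1) (y 1)) = Affine (x 2) (y 2)"
        using step[of 1] by (simp add: numeral_2_eq_2)
      ultimately show ?thesis using point_add_affineE that by metis
    qed
    then show "wpoly_dy W (x 1) (y 1) \<noteq> 0" by simp
    let ?c = "wpoly_dy W (x 1) (y 1)" and ?r = "x 1"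
    \<comment> \<open>Twice the tangent slope plus a1, times \<open>?c\<close>, is half the
      derivative of \<open>quartic\<close> at \<open>?r\<close>.\<close>
    have "4 * (?c^2 * x 2) = (2 * (l * ?c) + wa1 W * ?c)^2 - (wb2 W + 8 * ?r) * ?c^2"
      unfolding l(1) wb2_def by (simp add: algebra_simps power2_eq_square)
    also have "2 * (l * ?c) + wa1 W * ?c = 6 * ?r^2 + wb2 W * ?r + wb4 W"
      unfolding l(3) by (simp add: wpoly_dx_def wpoly_dy_def wb_defs algebra_simps power2_eq_square)
    also have "(6 * ?r^2 + wb2 W * ?r + wb4 W)^2 - (wb2 W + 8 * ?r) * ?c^2
       = 4 * ((?r * ?r)^2 - wb4 W * ?r * ?r - wb6 W * (?r + ?r)) - (wb2 W * wb6 W - (wb4 W)^2)"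
      unfolding c biq_sum_same by (simp add: quartic_def algebra_simps power2_eq_square power3_eq_cube)
    also have "\<dots> = 4 * biq_prod (wb4 W) (wb6 W) (wb8 W) ?r ?r"
      unfolding wb8_rel[symmetric] by (simp add: biq_prod_def algebra_simps)
    finally show "?c^2 * x 2 = biq_prod (wb4 W) (wb6 W) (wb8 W) ?r ?r" by simp
  next
    fix n :: nat assume n: "n \<ge> 2"
    then show "x n \<noteq> x 1" by (rule neq)
    obtain l where l: "x n = l^2 + wa1 W * l - wa2 W - x (n-1) - x 1"
      "y n = - (l + wa1 W) * x n - (y 1 - l * x 1) - wa3 W" using prev[OF n] by blast
    obtain k where k: "x (n+1) = k^2 + wa1 W * k - wa2 W - x n - x 1" "y 1 - y n = k * (x 1 - x n)"
    proof -
      have "on_curve W (Affine (x n) (y n))" "on_curve W (Affine (x 1) (y 1))"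
        using on[of n] on[of 1] n by simp_all
      from point_add_affineE[OF this step[of n]] show ?thesis using that n by (metis one_le_numeral order_trans)
    qed
    have "y n - y 1 = k * (x n - x 1)" using k(2) by (simp add: algebra_simps)
    \<comment> \<open>The slope from [n]P to -P is -(l + a1), where l is the slope of the previous
      addition.\<close>
    moreover have "y n + y 1 + wa1 W * x 1 + wa3 W = (- (l + wa1 W)) * (x n - x 1)"
      using l(2) by (simp add: algebra_simps)
    moreover have "x (n-1) = (- (l + wa1 W))^2 + wa1 W * (- (l + wa1 W)) - wa2 W - x n - x 1"
      using l(1) by (simp add: algebra_simps power2_eq_square)
    ultimately show "(x n - x 1)^2 * (x (n+1) + x (n-1)) = biq_sum (wb2 W) (wb4 W) (wb6 W) (x n) (x 1)"
      "(x n - x 1)^2 * (x (n+1) * x (n-1)) = biq_prod (wb4 W) (wb6 W) (wb8 W) (x n) (x 1)"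
      using point_sum_diff[OF on on neq] k(1) n by auto
  qed
qed

section \<open>Divisibility by prime powers\<close>

text \<open>The ideal p^k Z_(p) in the localisation of the integers at p.\<close>

definition padic :: "nat \<Rightarrow> nat \<Rightarrow> rat set" where
  "padic p k = {of_int (int p ^ k * a) / of_int b | a b. \<not> int p dvd b}"

context
  fixes p :: nat
  assumes p: "prime p"
begin

lemma padicI: "q * of_int b = of_int (int p ^ k * a) \<Longrightarrow> \<not> int p dvd b \<Longrightarrow> q \<in> padic p k"
  unfolding padic_def by (rule CollectI, rule exI[of _ a], rule exI[of _ b]) (cases "b = 0"; simp add: field_simps)

lemma padicE:
  assumes "q \<in> padic p k"
  obtains a b where "q * of_int b = of_int (int p ^ k * a)" "\<not> int p dvd b"
  using assms unfolding padic_def by (force simp: field_simps)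

lemma padic_of_int_iff: "of_int a \<in> padic p k \<longleftrightarrow> int p ^ k dvd a"
proof
  assume "of_int a \<in> padic p k"
  then obtain c b where cb: "of_int a * of_int b = (of_int (int p ^ k * c) :: rat)" "\<not> int p dvd b" by (rule padicE)
  then have "a * b = int p ^ k * c" by (metis of_int_eq_iff of_int_mult)
  then have "int p ^ k dvd a * b" by simp
  moreover have "coprime (int p ^ k) b"
    using cb(2) p prime_imp_coprime by (metis coprime_power_left_iff prime_nat_int_transfer)
  ultimately show "int p ^ k dvd a" by (simp add: coprime_dvd_mult_left_iff)
next
  assume "int p ^ k dvd a"
  then obtain c where "a = int p ^ k * c" by (rule dvdE)
  then show "of_int a \<in> padic p k" using p by (intro padicI[of _ 1 _ c]) (auto dest: prime_gt_1_nat)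
qed

lemma padic_add:
  assumes "q \<in> padic p k" "r \<in> padic p k" shows "q + r \<in> padic p k"
proof -
  obtain a b c d where "q * of_int b = of_int (int p ^ k * a)" "\<not> int p dvd b"
     "r * of_int d = of_int (int p ^ k * c)" "\<not> int p dvd d"
    using assms by (metis padicE)
  then show ?thesis using p
    by (intro padicI[of _ "b * d" _ "a * d + c * b"]) (auto simp: algebra_simps prime_dvd_mult_iff)
qed

lemma padic_mult:
  assumes "q \<in> padic p k" "r \<in> padic p j" shows "q * r \<in> padic p (k + j)"
proof -
  obtain a b c d where *: "q * of_int b = of_int (int p ^ k * a)" "\<not> int p dvd b"
     "r * of_int d = of_int (int p ^ j * c)" "\<not> int p dvd d"
    using assms by (metis padicE)
  have "q * r * of_int (b * d) = (q * of_int b) * (r * of_int d)" by simp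
  also have "\<dots> = of_int (int p ^ (k + j) * (a * c))" unfolding * by (simp add: power_add)
  finally show ?thesis using p * by (intro padicI[of _ "b * d" _ "a * c"]) (auto simp: prime_dvd_mult_iff)
qed

lemma padic_mono:
  assumes "q \<in> padic p k" "j \<le> k" shows "q \<in> padic p j"
proof -
  obtain a b where *: "q * of_int b = of_int (int p ^ k * a)" "\<not> int p dvd b"
    using assms by (metis padicE)
  then have "q * of_int b = of_int (int p ^ j * (int p ^ (k - j) * a))"
    using assms(2) by (simp add: power_add[symmetric] flip: mult.assoc of_int_power of_int_mult)
  then show ?thesis using * by (intro padicI)
qed

lemma padic_of_int [simp]: "of_int a \<in> padic p 0"
  by (simp add: padic_of_int_iff)

lemma padic_num [simp]: "0 \<in> padic p k" "1 \<in> padic p 0" "numeral n \<in> padic p 0"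
  using padic_of_int_iff[of 0 k] padic_of_int[of 1] padic_of_int[of "numeral n"] by simp_all

lemma padic_int_mult: "q \<in> padic p 0 \<Longrightarrow> r \<in> padic p k \<Longrightarrow> q * r \<in> padic p k"
  using padic_mult[of q 0 r k] by simp

lemma padic_mult_int: "q \<in> padic p k \<Longrightarrow> r \<in> padic p 0 \<Longrightarrow> q * r \<in> padic p k"
  using padic_mult[of q k r 0] by simp

lemma padic_neg: "q \<in> padic p k \<Longrightarrow> - q \<in> padic p k"
  using padic_int_mult[OF padic_of_int[of "-1"], of q k] by simp

lemma padic_diff: "q \<in> padic p k \<Longrightarrow> r \<in> padic p k \<Longrightarrow> q - r \<in> padic p k"
  using padic_add[of q k "- r"] padic_neg[of r k] by simp

lemma padic_power: "q \<in> padic p k \<Longrightarrow> q ^ n \<in> padic p (n * k)"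
  by (induction n) (auto intro: padic_mult)

lemma padic_power_0: "q \<in> padic p 0 \<Longrightarrow> q ^ n \<in> padic p 0"
  using padic_power[of q 0 n] by simp

lemmas padic_intros = padic_add padic_diff padic_neg padic_int_mult padic_mult_int padic_power_0

lemma one_not_padic: "1 \<notin> padic p (Suc k)"
proof
  assume "1 \<in> padic p (Suc k)"
  then have "int p ^ Suc k dvd 1" using padic_of_int_iff[of 1 "Suc k"] by simp
  then show False using p by (metis dvd_mult_left int_dvd_int_iff not_prime_unit of_nat_1 power_Suc)
qed

lemma padic_unit:
  assumes "q - 1 \<in> padic p 1" shows "q \<noteq> 0" "1 / q \<in> padic p 0"
proof -
  obtain a b where ab: "(q - 1) * of_int b = of_int (int p ^ 1 * a)" "\<not> int p dvd b"
    using assms by (metis padicE)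
  have q: "q * of_int b = of_int (b + int p * a)" using ab(1) by (simp add: algebra_simps)
  have n: "\<not> int p dvd b + int p * a" using ab(2) by (simp add: dvd_add_left_iff)
  show q0: "q \<noteq> 0" using q n by (metis dvd_0_right mult_zero_left of_int_eq_0_iff)
  show "1 / q \<in> padic p 0"
    by (rule padicI[of _ "b + int p * a" 0 b]) (use q n q0 in \<open>auto simp: field_simps\<close>)
qed

lemma padic_div_unit: "r \<in> padic p k \<Longrightarrow> q - 1 \<in> padic p 1 \<Longrightarrow> r / q \<in> padic p k"
  using padic_mult_int[of r k "1 / q"] padic_unit[of q] by simp

lemma padic_or_inverse: "q \<in> padic p 0 \<or> (q \<noteq> 0 \<and> 1 / q \<in> padic p 1)"
proof -
  obtain a b where ab: "q = of_int a / of_int b" "coprime a b" "b > 0"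
    using quotient_of_div quotient_of_coprime quotient_of_denom_pos by (metis surj_pair)
  show ?thesis
  proof (cases "int p dvd b")
    case False
    then show ?thesis using ab by (intro disjI1 padicI[of _ b _ a]) auto
  next
    case True
    then have na: "\<not> int p dvd a" using ab(2) p
      by (metis coprime_common_divisor not_prime_unit prime_nat_int_transfer)
    then have "a \<noteq> 0" by auto
    obtain d where "b = int p * d" using True by (rule dvdE)
    then show ?thesis using ab na \<open>a \<noteq> 0\<close> prime_gt_0_nat[OF p] by (intro disjI2 conjI padicI[of _ a _ d]) auto
  qed
qed

text \<open>Z_(p) is integrally closed: if z were not integral, dividing by z^2 would put 1 into the
  maximal ideal.\<close>

lemma padic_quadratic_root_0:
  assumes "z^2 + u * z + w = 0" "u \<in> padic p 0" "w \<in> padic p 0"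
  shows "z \<in> padic p 0"
proof (rule ccontr)
  assume n: "z \<notin> padic p 0"
  then have z: "z \<noteq> 0" "1 / z \<in> padic p 1" using padic_or_inverse by auto
  have "1 = - (u * (1 / z) + w * (1 / z) * (1 / z))"
    using assms(1) z(1) by (simp add: field_simps power2_eq_square eq_neg_iff_add_eq_0)
  moreover have "- (u * (1 / z) + w * (1 / z) * (1 / z)) \<in> padic p 1"
    using z(2) assms(2,3) padic_mono[OF z(2), of 0] by (intro padic_intros) auto
  ultimately show False using one_not_padic[of 0] by simp
qed

text \<open>Apply the previous lemma to z / p^k, whose equation has the integral coefficients u /
  p^k and w / p^(2 k).\<close>

lemma padic_quadratic_root:
  assumes "z^2 + u * z + w = 0" "u \<in> padic p k" "w \<in> padic p (2 * k)"
  shows "z \<in> padic p k"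
proof -
  let ?q = "of_nat p ^ k :: rat"
  have q0: "?q \<noteq> 0" using p by (simp add: prime_gt_0_nat)
  have scale: "t \<in> padic p (j + i) \<Longrightarrow> t / of_nat p ^ j \<in> padic p i" for t i j
    using p by (elim padicE, intro padicI) (auto simp: power_add field_simps)
  have "(z / ?q)^2 + (u / ?q) * (z / ?q) + w / ?q^2 = (z^2 + u * z + w) / ?q^2"
    using q0 by (simp add: field_simps power2_eq_square)
  then have e: "(z / ?q)^2 + (u / ?q) * (z / ?q) + w / ?q^2 = 0" using assms(1) by simp
  have "?q^2 = of_nat p ^ (2 * k)" by (subst mult.commute) (rule power_mult[symmetric])
  then have "w / ?q^2 \<in> padic p 0" using scale[of w "2 * k" 0] assms(3) by simp
  moreover have "u / ?q \<in> padic p 0" using scale[of u k 0] assms(2) by simp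
  ultimately have "z / ?q \<in> padic p 0" using padic_quadratic_root_0[OF e] by blast
  moreover have "?q \<in> padic p k" using padic_of_int_iff[of "int p ^ k" k] by simp
  ultimately have "(z / ?q) * ?q \<in> padic p k" by (rule padic_int_mult)
  then show ?thesis by (simp only: times_divide_eq_left nonzero_mult_div_cancel_right[OF q0])
qed

end

section \<open>The orbit near infinity: p-adic behaviour of 1 / x\<close>

locale padic_orbit = kummer_orbit "of_int B2" "of_int B4" "of_int B6" "of_int B8" c x
  for B2 B4 B6 B8 :: int and c :: rat and x :: "nat \<Rightarrow> rat" +
  fixes p :: nat
  assumes p: "prime p"
begin

abbreviation Sum :: "rat \<Rightarrow> rat \<Rightarrow> rat" where "Sum \<equiv> biq_sum (of_int B2) (of_int B4) (of_int B6)"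
abbreviation Prod :: "rat \<Rightarrow> rat \<Rightarrow> rat" where "Prod \<equiv> biq_prod (of_int B4) (of_int B6) (of_int B8)"

text \<open>\<open>biq_sum\<close> and \<open>biq_prod\<close>, divided by (t u)^2 and written in z
  = 1 / t and w = 1 / u. The quotient \<open>recip_sum\<close> / \<open>recip_prod\<close> is 1 /
  x(A + B) + 1 / x(A - B).\<close>

definition recip_sum :: "rat \<Rightarrow> rat \<Rightarrow> rat" where
  "recip_sum z w = 2 * (z + w) + (z * w) * (of_int B2 + of_int B4 * (z + w) + of_int B6 * (z * w))"

definition recip_prod :: "rat \<Rightarrow> rat \<Rightarrow> rat" where
  "recip_prod z w = 1 - (z * w) * (of_int B4 + of_int B6 * (z + w) + of_int B8 * (z * w))"

lemma Sum_inverse: "t \<noteq> 0 \<Longrightarrow> u \<noteq> 0 \<Longrightarrow> Sum t u = (t * u)^2 * recip_sum (1 / t) (1 / u)"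
  by (simp add: biq_sum_def recip_sum_def field_simps power2_eq_square)

lemma Prod_inverse: "t \<noteq> 0 \<Longrightarrow> u \<noteq> 0 \<Longrightarrow> Prod t u = (t * u)^2 * recip_prod (1 / t) (1 / u)"
  by (simp add: biq_prod_def recip_prod_def field_simps power2_eq_square)

lemmas padic_rules = padic_add[OF p] padic_diff[OF p] padic_neg[OF p] padic_int_mult[OF p] padic_mult_int[OF p]
  padic_power_0[OF p] padic_of_int[OF p] padic_num[OF p]

text \<open>All correction terms contain z w, which lies in p^(4 k). So \<open>recip_prod\<close> is
  a unit congruent to 1, and the quotient is 2 (z + w) up to p^(4 k).\<close>

lemma
  assumes "z \<in> padic p (2 * k)" "w \<in> padic p (2 * k)" "k \<ge> 1"
  shows recip_prod_unit: "recip_prod z w - 1 \<in> padic p 1"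
    and recip_quotient_approx: "recip_sum z w / recip_prod z w - 2 * (z + w) \<in> padic p (4 * k)"
    and recip_quotient_integral: "recip_sum z w / recip_prod z w \<in> padic p (2 * k)"
proof -
  have zw: "z * w \<in> padic p (4 * k)" using padic_mult[OF p assms(1,2)] by simp
  have i: "z \<in> padic p 0" "w \<in> padic p 0" "z * w \<in> padic p 0"
    using assms(1,2) zw padic_mono[OF p] by blast+
  have "recip_prod z w - 1 = - ((z * w) * (of_int B4 + of_int B6 * (z + w) + of_int B8 * (z * w)))"
    by (simp add: recip_prod_def)
  also have "\<dots> \<in> padic p (4 * k)" by (intro padic_rules zw i)
  finally have pr: "recip_prod z w - 1 \<in> padic p (4 * k)" .
  then show unit: "recip_prod z w - 1 \<in> padic p 1" using padic_mono[OF p] assms(3) by simp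
  have "recip_sum z w / recip_prod z w - 2 * (z + w)
     = ((z * w) * (of_int B2 + of_int B4 * (z + w) + of_int B6 * (z * w)) - 2 * (z + w) * (recip_prod z w - 1)) / recip_prod z w"
    using padic_unit(1)[OF p unit] by (simp add: recip_sum_def field_simps)
  also have "\<dots> \<in> padic p (4 * k)"
    by (intro padic_div_unit[OF p] unit padic_rules zw i pr)
  finally show *: "recip_sum z w / recip_prod z w - 2 * (z + w) \<in> padic p (4 * k)" .
  have "(recip_sum z w / recip_prod z w - 2 * (z + w)) + 2 * (z + w) \<in> padic p (2 * k)"
    by (intro padic_rules assms padic_mono[OF p *]) simp
  then show "recip_sum z w / recip_prod z w \<in> padic p (2 * k)" by simp
qed

text \<open>As x n will have denominator D n ^ 2, this expresses for k \<ge> 1 that p^k divides D n;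
  see \<open>level_iff\<close>.\<close>

definition level :: "nat \<Rightarrow> nat \<Rightarrow> bool" where
  "level k n \<longleftrightarrow> x n \<noteq> 0 \<and> 1 / x n \<in> padic p (2 * k)"

text \<open>1 / x (m + n) and 1 / x (m - n) have their sum in p^(2 k) and their product in p^(4 k),
  so \<open>padic_quadratic_root\<close> applies to the monic quadratic with these roots.\<close>

lemma level_diff:
  assumes "n \<ge> 1" "m > n" "k \<ge> 1" "level k m" "level k n"
  shows "level k (m + n)" "level k (m - n)"
    and "1 / x (m + n) + 1 / x (m - n) = recip_sum (1 / x m) (1 / x n) / recip_prod (1 / x m) (1 / x n)"
proof -
  let ?z = "1 / x m" and ?w = "1 / x n" and ?u = "1 / x (m+n)" and ?v = "1 / x (m-n)"
  have nz: "x m \<noteq> 0" "x n \<noteq> 0" and zw: "?z \<in> padic p (2 * k)" "?w \<in> padic p (2 * k)"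
    using assms by (auto simp: level_def)
  have d: "(x m - x n)^2 = (x m * x n)^2 * (?w - ?z)^2"
    using nz by (simp add: field_simps power2_eq_square)
  have unit: "recip_prod ?z ?w - 1 \<in> padic p 1" by (rule recip_prod_unit[OF zw assms(3)])
  have pr: "(?w - ?z)^2 * (x (m+n) * x (m-n)) = recip_prod ?z ?w"
    using prod_diff[OF assms(1,2)] nz unfolding d Prod_inverse[OF nz] by simp
  have sg: "(?w - ?z)^2 * (x (m+n) + x (m-n)) = recip_sum ?z ?w"
    using sum_diff[OF assms(1,2)] nz unfolding d Sum_inverse[OF nz] by simp
  have pr0: "recip_prod ?z ?w \<noteq> 0" by (rule padic_unit[OF p unit])
  then have xnz: "x (m+n) \<noteq> 0" "x (m-n) \<noteq> 0" "?w - ?z \<noteq> 0" using pr by auto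
  show s: "?u + ?v = recip_sum ?z ?w / recip_prod ?z ?w"
  proof -
    have "D^2 * (a + b) / (D^2 * (a * b)) = 1 / a + 1 / b" if "D \<noteq> 0" "a \<noteq> 0" "b \<noteq> 0" for D a b :: rat
      using that by (simp add: field_simps)
    from this[OF xnz(3,1,2)] show ?thesis unfolding pr sg by simp
  qed
  have q: "?u * ?v = (?w - ?z)^2 / recip_prod ?z ?w"
  proof -
    have "D^2 / (D^2 * (a * b)) = 1 / a * (1 / b)" if "D \<noteq> 0" "a \<noteq> 0" "b \<noteq> 0" for D a b :: rat
      using that by (simp add: field_simps)
    from this[OF xnz(3,1,2)] show ?thesis unfolding pr by simp
  qed
  have "(?w - ?z)^2 \<in> padic p (2 * (2 * k))"
    using padic_power[OF p padic_diff[OF p zw(2,1)], of 2] by simp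
  then have Q: "?u * ?v \<in> padic p (2 * (2 * k))"
    unfolding q by (rule padic_div_unit[OF p _ unit])
  have S: "- (?u + ?v) \<in> padic p (2 * k)"
    unfolding s by (rule padic_neg[OF p recip_quotient_integral[OF zw assms(3)]])
  have "?u^2 + (- (?u + ?v)) * ?u + ?u * ?v = 0" "?v^2 + (- (?u + ?v)) * ?v + ?u * ?v = 0"
    by (simp_all add: algebra_simps power2_eq_square)
  then have "?u \<in> padic p (2 * k)" "?v \<in> padic p (2 * k)"
    using padic_quadratic_root[OF p _ S Q] by blast+
  then show "level k (m + n)" "level k (m - n)" using xnz by (simp_all add: level_def)
qed

lemma level_double:
  assumes "n \<ge> 1" "k \<ge> 1" "level k n"
  shows "level k (2 * n)" "1 / x (2 * n) = recip_sum (1 / x n) (1 / x n) / recip_prod (1 / x n) (1 / x n)"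
proof -
  let ?z = "1 / x n"
  have nz: "x n \<noteq> 0" and z: "?z \<in> padic p (2 * k)" using assms by (auto simp: level_def)
  have pr0: "recip_prod ?z ?z \<noteq> 0" by (rule padic_unit[OF p recip_prod_unit[OF z z assms(2)]])
  have sg: "recip_sum ?z ?z \<noteq> 0" "recip_sum ?z ?z * x (2*n) = recip_prod ?z ?z"
    using double[OF assms(1)] nz unfolding Sum_inverse[OF nz nz] Prod_inverse[OF nz nz] by auto
  then have "x (2*n) \<noteq> 0" using pr0 by auto
  moreover have "1 / x (2*n) = recip_sum ?z ?z / recip_prod ?z ?z" unfolding sg(2)[symmetric] using sg(1) by simp
  ultimately have x: "x (2*n) \<noteq> 0" "1 / x (2*n) = recip_sum ?z ?z / recip_prod ?z ?z" by auto
  then show "level k (2 * n)" "1 / x (2 * n) = recip_sum ?z ?z / recip_prod ?z ?z"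
    using recip_quotient_integral[OF z z assms(2)] by (simp_all add: level_def)
qed

text \<open>Modulo p^(4 k) the reciprocals a(j) = 1 / x (j n) obey the parallelogram law a(i + 1) +
  a(i - 1) = 2 a(i) + 2 a(1), whose solution is j^2 a(1).\<close>

lemma level_mult:
  assumes "n \<ge> 1" "k \<ge> 1" "level k n" "j \<ge> 1"
  shows "level k (j * n) \<and> 1 / x (j * n) - of_nat j ^ 2 * (1 / x n) \<in> padic p (4 * k)"
  using assms(4)
proof (induction j rule: less_induct)
  case (less j)
  have n: "1 / x n \<in> padic p (2 * k)" using assms(3) by (simp add: level_def)
  consider "j = 1" | "j = 2" | i where "j = i + 1" "i \<ge> 2"
    using less.prems that(3)[of "j - 1"] by fastforce
  then show ?case
  proof cases
    case 1 then show ?thesis using assms(3) padic_num[OF p] by simp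
  next
    case 2
    show ?thesis using recip_quotient_approx[OF n n assms(2)] unfolding 2 level_double(2)[OF assms(1-3)]
      using level_double(1)[OF assms(1-3)] by simp
  next
    case 3
    have i: "i * n > n" "i * n + n = j * n" "i * n - n = (i - 1) * n" using 3 assms(1)
      by (auto simp: algebra_simps)
    have IH: "level k (i * n)" "1 / x (i * n) - of_nat i ^ 2 * (1 / x n) \<in> padic p (4 * k)"
      "1 / x ((i-1) * n) - of_nat (i-1) ^ 2 * (1 / x n) \<in> padic p (4 * k)"
      using less.IH[of i] less.IH[of "i-1"] 3 by auto
    note L = level_diff[OF assms(1) i(1) assms(2) IH(1) assms(3), unfolded i]
    have m: "1 / x (i * n) \<in> padic p (2 * k)" using IH(1) by (simp add: level_def)
    have "1 / x (j * n) - of_nat j ^ 2 * (1 / x n)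
      = (1 / x (j * n) + 1 / x ((i-1) * n) - 2 * (1 / x (i * n) + 1 / x n))
        + 2 * (1 / x (i * n) - of_nat i ^ 2 * (1 / x n)) - (1 / x ((i-1) * n) - of_nat (i-1) ^ 2 * (1 / x n))"
      using 3 by (simp add: algebra_simps power2_eq_square of_nat_diff)
    also have "\<dots> \<in> padic p (4 * k)" unfolding L(3)
      by (intro padic_rules recip_quotient_approx[OF m n assms(2)] IH)
    finally show ?thesis using L(1) by simp
  qed
qed

text \<open>The main term p^2 / x n gains two powers of p, and the error in p^(4 k) is no larger
  because 4 k \<ge> 2 + 2 k.\<close>

lemma level_prime_mult:
  assumes "n \<ge> 1" "k \<ge> 1" "level k n" shows "level (k + 1) (p * n)"
proof -
  have n: "1 / x n \<in> padic p (2 * k)" using assms(3) by (simp add: level_def)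
  have L: "level k (p * n)" "1 / x (p * n) - of_nat p ^ 2 * (1 / x n) \<in> padic p (4 * k)"
    using level_mult[OF assms, of p] prime_ge_1_nat[OF p] by auto
  have "of_nat p ^ 2 \<in> padic p 2" using padic_of_int_iff[OF p, of "int p ^ 2" 2] by simp
  then have "of_nat p ^ 2 * (1 / x n) \<in> padic p (2 + 2 * k)" using padic_mult[OF p] n by blast
  moreover have "1 / x (p * n) - of_nat p ^ 2 * (1 / x n) \<in> padic p (2 + 2 * k)"
    using padic_mono[OF p L(2)] assms(2) by simp
  ultimately have "(1 / x (p * n) - of_nat p ^ 2 * (1 / x n)) + of_nat p ^ 2 * (1 / x n) \<in> padic p (2 + 2 * k)"
    by (rule padic_add[OF p, rotated])
  then show ?thesis using L(1) by (simp add: level_def)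
qed

text \<open>A Bezout identity: the discriminant is a combination of the numerator and the
  denominator of the duplication formula, which therefore have no common zero at a prime of good
  reduction.\<close>

lemma resultant:
  fixes t :: rat
  shows "(12 * t^3 - of_int B2 * t^2 - 10 * of_int B4 * t + of_int B2 * of_int B4 - 27 * of_int B6) * Sum t t
    - (48 * t^2 + 8 * of_int B2 * t + 32 * of_int B4 - of_int B2 ^ 2) * Prod t t
    = of_int (- (B2^2 * B8) - 8 * B4^3 - 27 * B6^2 + 9 * B2 * B4 * B6)"
proof -
  let ?B2 = "of_int B2 :: rat" and ?B4 = "of_int B4 :: rat" and ?B6 = "of_int B6 :: rat" and ?B8 = "of_int B8 :: rat"
  let ?u = "12 * t^3 - ?B2 * t^2 - 10 * ?B4 * t + ?B2 * ?B4 - 27 * ?B6" and ?v = "48 * t^2 + 8 * ?B2 * t + 32 * ?B4 - ?B2^2"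
  have "?u * Sum t t - ?v * Prod t t = ?u * Sum t t - ?v * (t^4 - ?B4 * t^2 - 2 * ?B6 * t)
      + (12 * t^2 + 2 * ?B2 * t + 8 * ?B4) * (4 * ?B8) - ?B2^2 * ?B8"
    by (simp add: biq_prod_def algebra_simps power2_eq_square power4_eq_xxxx)
  also have "\<dots> = - (?B2^2 * ?B8) - 8 * ?B4^3 - 27 * ?B6^2 + 9 * ?B2 * ?B4 * ?B6"
    unfolding b8
    by (simp add: biq_sum_def algebra_simps power2_eq_square power3_eq_cube power4_eq_xxxx)
  finally show ?thesis by simp
qed

section \<open>Congruent x-coordinates at a prime of good reduction\<close>

context
  assumes good: "\<not> int p dvd - (B2^2 * B8) - 8 * B4^3 - 27 * B6^2 + 9 * B2 * B4 * B6"
begin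

lemma not_both_divisible:
  assumes "t \<in> padic p 0" "Sum t t \<in> padic p 1" shows "Prod t t \<notin> padic p 1"
proof
  assume "Prod t t \<in> padic p 1"
  then have "of_int (- (B2^2 * B8) - 8 * B4^3 - 27 * B6^2 + 9 * B2 * B4 * B6) \<in> padic p 1"
    unfolding resultant[of t, symmetric]
    by (intro padic_rules assms)
  then show False using good by (simp only: padic_of_int_iff[OF p] power_one_right)
qed

text \<open>The congruence means [m]P = \<plusminus> [n]P modulo p, so the difference or the sum
  reduces to infinity. If both stayed integral, \<open>sum_diff\<close> and \<open>prod_diff\<close>
  would make \<open>Sum\<close> and \<open>Prod\<close> vanish modulo p on the diagonal.\<close>

lemma congruent_imp:
  assumes "n \<ge> 1" "m > n" "x m \<in> padic p 0" "x n \<in> padic p 0" "x m - x n \<in> padic p 1"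
  shows "x (m + n) \<notin> padic p 0 \<or> x (m - n) \<notin> padic p 0"
proof (rule ccontr)
  assume "\<not> ?thesis"
  then have i: "x (m + n) \<in> padic p 0" "x (m - n) \<in> padic p 0" by auto
  have "(x m - x n) * (x m - x n) \<in> padic p 1" by (intro padic_rules assms)
  then have d: "(x m - x n)^2 \<in> padic p 1" by (simp add: power2_eq_square)
  have "Sum (x m) (x n) \<in> padic p 1" "Prod (x m) (x n) \<in> padic p 1"
    unfolding sum_diff[OF assms(1,2), symmetric] prod_diff[OF assms(1,2), symmetric]
    by (intro padic_rules d i)+
  moreover have "Sum (x n) (x n) = Sum (x m) (x n) - (x m - x n)
       * (2 * x n * (x m + x n + x n) + of_int B2 * x n + of_int B4)"
    "Prod (x n) (x n) = Prod (x m) (x n) - (x m - x n)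
       * ((x m + x n) * x n^2 - of_int B4 * x n - of_int B6)"
    by (simp_all add: biq_sum_def biq_prod_def algebra_simps power2_eq_square)
  ultimately have "Sum (x n) (x n) \<in> padic p 1" "Prod (x n) (x n) \<in> padic p 1"
    using assms by (auto intro!: padic_rules simp del: One_nat_def)
  then show False using not_both_divisible assms(4) by blast
qed

text \<open>Here [n]P has order 2 modulo p, so its double reduces to infinity.\<close>

lemma double_imp:
  assumes "n \<ge> 1" "x n \<in> padic p 0" "Sum (x n) (x n) \<in> padic p 1"
  shows "x (2 * n) \<notin> padic p 0"
proof
  assume "x (2 * n) \<in> padic p 0"
  then have "Prod (x n) (x n) \<in> padic p 1"
    unfolding double(2)[OF assms(1), symmetric] by (intro padic_rules assms)
  then show False using not_both_divisible assms by blast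
qed

end

end

section \<open>The Hasse bound\<close>

text \<open>
  \<open>hbiq\<close> is \<open>biq\<close> made homogeneous in its first and third argument, \<open>f / g\<close> and \<open>F / G\<close>, with
  middle argument \<open>t\<close>.
\<close>

definition hbiq_lead :: "'a::comm_ring_1 \<Rightarrow> 'a \<Rightarrow> 'a \<Rightarrow> 'a" where
  "hbiq_lead t f g = (f - t * g)^2"

definition hbiq_mid :: "'a::comm_ring_1 \<Rightarrow> 'a \<Rightarrow> 'a \<Rightarrow> 'a \<Rightarrow> 'a \<Rightarrow> 'a \<Rightarrow> 'a" where
  "hbiq_mid b2 b4 b6 t f g = 2 * f * t * (f + t * g) + b2 * f * t * g + b4 * (f + t * g) * g + b6 * g^2"

definition hbiq_const :: "'a::comm_ring_1 \<Rightarrow> 'a \<Rightarrow> 'a \<Rightarrow> 'a \<Rightarrow> 'a \<Rightarrow> 'a \<Rightarrow> 'a" where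
  "hbiq_const b4 b6 b8 t f g = (f * t)^2 - b4 * f * t * g - b6 * (f + t * g) * g - b8 * g^2"

definition hbiq :: "'a::comm_ring_1 \<Rightarrow> 'a \<Rightarrow> 'a \<Rightarrow> 'a \<Rightarrow> 'a \<Rightarrow> 'a \<Rightarrow> 'a \<Rightarrow> 'a \<Rightarrow> 'a \<Rightarrow> 'a" where
  "hbiq b2 b4 b6 b8 t f g F G = hbiq_lead t f g * F^2 - hbiq_mid b2 b4 b6 t f g * F * G + hbiq_const b4 b6 b8 t f g * G^2"

lemma hbiq_sym: "hbiq b2 b4 b6 b8 t f g F G = hbiq b2 b4 b6 b8 t F G f g"
  by (simp add: hbiq_def hbiq_lead_def hbiq_mid_def hbiq_const_def algebra_simps power2_eq_square)

lemma hbiq_scale: "hbiq b2 b4 b6 b8 t f g (c * F) (c * G) = c^2 * hbiq b2 b4 b6 b8 t f g F G"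
  by (simp add: hbiq_def algebra_simps power2_eq_square)

text \<open>Gauss's lemma: the form d X^2 - s X Y + q Y^2 with the zero (f : g) in lowest terms
  factors as (g X - f Y) (u X - v Y). Its other root is v / u.\<close>

lemma quadratic_form_factor:
  fixes f g :: "'a::{idom_divide,semiring_gcd}"
  assumes "coprime f g" and e: "d * f^2 - s * f * g + q * g^2 = 0"
  obtains u v where "d = g * u" "q = f * v" "s = u * f + v * g"
proof -
  have c2: "coprime g (f^2)" "coprime f (g^2)" using assms(1) by (simp_all add: coprime_commute)
  have "d * f^2 = g * (s * f - q * g)" "q * g^2 = f * (s * g - d * f)"
    using e by (simp_all add: algebra_simps power2_eq_square)
  then have "g dvd d * f^2" "f dvd q * g^2" by simp_all
  then have "g dvd d" "f dvd q" using c2 by (simp_all add: coprime_dvd_mult_left_iff)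
  then obtain u v where uv: "d = g * u" "q = f * v" by (elim dvdE)
  show ?thesis
  proof (cases "f = 0 \<or> g = 0")
    case False
    have "f * g * (u * f + v * g - s) = 0" using e unfolding uv by (simp add: algebra_simps power2_eq_square)
    then have "s = u * f + v * g" using False by simp
    then show ?thesis using that uv by blast
  next
    case True
    then show ?thesis
    proof
      assume f: "f = 0"
      then have "is_unit g" using assms(1) by simp
      then have "g \<noteq> 0" "g dvd s" by (auto intro: unit_imp_dvd)
      moreover have "q = 0" using e f \<open>g \<noteq> 0\<close> by simp
      moreover obtain w where "s = g * w" using \<open>g dvd s\<close> by (elim dvdE)
      ultimately show ?thesis using that[of u w] uv f by (simp add: mult.commute)
    next
      assume g: "g = 0"
      then have "is_unit f" using assms(1) by simp
      then have "f \<noteq> 0" "f dvd s" by (auto intro: unit_imp_dvd)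
      moreover have "d = 0" using e g \<open>f \<noteq> 0\<close> by simp
      moreover obtain w where "s = f * w" using \<open>f dvd s\<close> by (elim dvdE)
      ultimately show ?thesis using that[of w v] uv g by (simp add: mult.commute)
    qed
  qed
qed

text \<open>For coprime f and g, the degree of f / g as a rational function.\<close>

definition height :: "'a::zero poly \<Rightarrow> 'a poly \<Rightarrow> nat" where
  "height f g = max (degree f) (degree g)"

text \<open>The bounds concern the coefficients of (g X - f Y) (u X - v Y). As for a Gauss norm,
  maximal degrees add up in a product: in each case some coefficient has a leading term that cannot
  cancel.\<close>

lemma height_mult:
  fixes f g u v :: "'a::idom poly"
  assumes "f \<noteq> 0 \<or> g \<noteq> 0" "u \<noteq> 0 \<or> v \<noteq> 0"
    and N: "degree (g * u) \<le> N" "degree (u * f + v * g) \<le> N" "degree (f * v) \<le> N"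
  shows "height f g + height u v \<le> N"
proof -
  have f: "(f \<noteq> 0 \<and> degree g \<le> degree f) \<or> (g \<noteq> 0 \<and> (f = 0 \<or> degree f < degree g))"
    using assms(1) by (cases "f = 0"; cases "g = 0"; auto)
  have u: "(v \<noteq> 0 \<and> degree u \<le> degree v) \<or> (u \<noteq> 0 \<and> (v = 0 \<or> degree v < degree u))"
    using assms(2) by (cases "u = 0"; cases "v = 0"; auto)
  consider "f \<noteq> 0" "degree g \<le> degree f" "v \<noteq> 0" "degree u \<le> degree v"
    | "g \<noteq> 0" "f = 0 \<or> degree f < degree g" "u \<noteq> 0" "v = 0 \<or> degree v < degree u"
    | "f \<noteq> 0" "degree g \<le> degree f" "u \<noteq> 0" "v = 0 \<or> degree v < degree u"
    | "g \<noteq> 0" "f = 0 \<or> degree f < degree g" "v \<noteq> 0" "degree u \<le> degree v"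
    using f u by blast
  then show ?thesis
  proof cases
    case 1 then show ?thesis using N(3) by (simp add: height_def degree_mult_eq)
  next
    case 2 then show ?thesis using N(1) by (auto simp: height_def degree_mult_eq)
  next
    case 3
    have "v * g = 0 \<or> degree (v * g) < degree (u * f)"
      using 3 by (cases "v = 0"; cases "g = 0") (auto simp: degree_mult_eq)
    then have "degree (u * f + v * g) = degree (u * f)" by (auto simp: degree_add_eq_left)
    then show ?thesis using N(2) 3 by (auto simp: height_def degree_mult_eq)
  next
    case 4
    have "u * f = 0 \<or> degree (u * f) < degree (v * g)"
      using 4 by (cases "u = 0"; cases "f = 0") (auto simp: degree_mult_eq)
    then have "degree (u * f + v * g) = degree (v * g)" by (auto simp: degree_add_eq_right)
    then show ?thesis using N(2) 4 by (auto simp: height_def degree_mult_eq)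
  qed
qed

lemma degree_mult_le': "degree p \<le> m \<Longrightarrow> degree q \<le> n \<Longrightarrow> degree (p * q) \<le> m + n"
  using degree_mult_le[of p q] by linarith

lemma degree_power_le': "degree p \<le> m \<Longrightarrow> degree (p ^ n) \<le> m * n"
  using degree_power_le[of p n] mult_le_mono1[of "degree p" m n] by linarith

lemma poly_reduce:
  fixes f g :: "'a::field_gcd poly"
  assumes "f \<noteq> 0 \<or> g \<noteq> 0"
  obtains f' g' where "f = gcd f g * f'" "g = gcd f g * g'" "coprime f' g'"
     "height f' g' + degree (gcd f g) = height f g" "f' \<noteq> 0 \<or> g' \<noteq> 0"
proof -
  have g0: "gcd f g \<noteq> 0" using assms by auto
  obtain f' g' where fg: "f = gcd f g * f'" "g = gcd f g * g'" by (metis dvdE gcd_dvd1 gcd_dvd2)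
  have c: "coprime f' g'"
    using gcd_coprime[OF g0, of f' g'] fg by (simp add: mult.commute)
  have n: "f' \<noteq> 0 \<or> g' \<noteq> 0" using assms fg by auto
  have d: "degree f = degree (gcd f g) + degree f'" if "f' \<noteq> 0"
    using fg(1) g0 that by (metis degree_mult_eq)
  have e: "degree g = degree (gcd f g) + degree g'" if "g' \<noteq> 0"
    using fg(2) g0 that by (metis degree_mult_eq)
  have h: "height f' g' + degree (gcd f g) = height f g"
  proof -
    consider "f' = 0" "g' \<noteq> 0" | "f' \<noteq> 0" "g' = 0" | "f' \<noteq> 0" "g' \<noteq> 0" using n by auto
    then show ?thesis
    proof cases
      case 1 then have "f = 0" using fg by auto
      then show ?thesis using e 1 by (simp add: height_def)
    next
      case 2 then have "g = 0" using fg by auto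
      then show ?thesis using d 2 by (simp add: height_def)
    next
      case 3 then show ?thesis using d e by (simp add: height_def max_def)
    qed
  qed
  show ?thesis using that fg c h n by blast
qed

lemma degree_mono:
  "degree p \<le> m \<Longrightarrow> m \<le> n \<Longrightarrow> degree p \<le> n"
  by simp

section \<open>Heights along a sequence of rational functions over a finite field\<close>

locale cubic_mod =
  fixes B2 B4 B6 B8 :: "'k::{finite_field, field_gcd}" and p :: nat
  assumes B8: "4 * B8 = B2 * B6 - B4^2" and p: "p = CARD('k)" "CHAR('k) = p" "odd p"
begin

abbreviation T :: "'k poly" where "T \<equiv> [:0, 1:]"
abbreviation b2 where "b2 \<equiv> [:B2:]"
abbreviation b4 where "b4 \<equiv> [:B4:]"
abbreviation b6 where "b6 \<equiv> [:B6:]"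
abbreviation b8 where "b8 \<equiv> [:B8:]"
abbreviation lam where "lam \<equiv> quartic b2 b4 b6 T"
abbreviation Q2 where "Q2 \<equiv> hbiq_lead T"
abbreviation Q1 where "Q1 \<equiv> hbiq_mid b2 b4 b6 T"
abbreviation Q0 where "Q0 \<equiv> hbiq_const b4 b6 b8 T"
abbreviation H where "H \<equiv> hbiq b2 b4 b6 b8 T"

lemma prime_p: "prime p"
  using prime_CHAR_semidom[where ?'a = 'k] p CHAR_pos[where ?'a='k] by simp

lemma two: "(2::'k) \<noteq> 0"
proof
  assume "(2::'k) = 0"
  then have "of_nat 2 = (0::'k)" by simp
  then have "p dvd 2" unfolding of_nat_eq_0_iff_char_dvd p(2) .
  then have "p = 2" using prime_p primes_dvd_imp_eq two_is_prime_nat by blast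
  then show False using p(3) by simp
qed

lemma four: "(4::'k) \<noteq> 0"
  using two by (metis mult_2 mult_eq_0_iff numeral_Bit0)

lemma b8: "4 * b8 = b2 * b6 - b4^2"
  using B8 by (simp add: power2_eq_square numeral_poly mult.commute)

lemma lam_nz: "lam \<noteq> 0"
proof -
  have "coeff lam 3 = 4" by (simp add: quartic_def numeral_poly power2_eq_square power3_eq_cube numeral_3_eq_3)
  then show ?thesis using four by auto
qed

lemma degree_forms:
  assumes "degree f \<le> h" "degree g \<le> h"
  shows "degree (Q2 f g) \<le> 2 * h + 2" "degree (Q1 f g) \<le> 2 * h + 2" "degree (Q0 f g) \<le> 2 * h + 2"
proof -
  have T: "degree T \<le> 1" and n: "degree (2 :: 'k poly) \<le> 0" by simp_all
  have Tg: "degree (T * g) \<le> 1 + h" by (rule degree_mult_le'[OF T assms(2)])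
  have f1: "degree f \<le> 1 + h" using assms(1) by simp
  have fT: "degree (f * T) \<le> h + 1" by (rule degree_mult_le'[OF assms(1) T])
  have c: "degree [:B:] \<le> 0" for B :: 'k by simp
  have g2: "degree (g^2) \<le> h * 2" by (rule degree_power_le'[OF assms(2)])
  have s: "degree (f + T * g) \<le> 1 + h" by (rule degree_add_le[OF f1 Tg])
  show "degree (Q2 f g) \<le> 2 * h + 2"
    using degree_power_le'[OF degree_diff_le[OF f1 Tg], of 2] by (simp add: hbiq_lead_def)
  have a: "degree (2 * f * T * (f + T * g)) \<le> 2 * h + 2"
    by (rule degree_mono[OF degree_mult_le'[OF degree_mult_le'[OF degree_mult_le'[OF n assms(1)] T] s]]) simp
  have b: "degree (b2 * f * T * g) \<le> 2 * h + 2"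
    by (rule degree_mono[OF degree_mult_le'[OF degree_mult_le'[OF degree_mult_le'[OF c assms(1)] T] assms(2)]]) simp
  have b': "degree (b4 * f * T * g) \<le> 2 * h + 2"
    by (rule degree_mono[OF degree_mult_le'[OF degree_mult_le'[OF degree_mult_le'[OF c assms(1)] T] assms(2)]]) simp
  have d: "degree ([:B:] * (f + T * g) * g) \<le> 2 * h + 2" for B
    by (rule degree_mono[OF degree_mult_le'[OF degree_mult_le'[OF c s] assms(2)]]) simp
  have e: "degree ([:B:] * g^2) \<le> 2 * h + 2" for B
    by (rule degree_mono[OF degree_mult_le'[OF c g2]]) simp
  have f2: "degree ((f * T)^2) \<le> 2 * h + 2"
    by (rule degree_mono[OF degree_power_le'[OF fT]]) simp
  show "degree (Q1 f g) \<le> 2 * h + 2"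
    unfolding hbiq_mid_def by (intro degree_add_le a b d e)
  show "degree (Q0 f g) \<le> 2 * h + 2"
    unfolding hbiq_const_def by (intro degree_diff_le b' d e f2)
qed

text \<open>One root of the quadratic form attached to f / g is f0 / g0, the other is v / u.
  Reducing v / u only lowers its height, and \<open>height_mult\<close> with
  \<open>degree_forms\<close> bounds the sum of both heights.\<close>

lemma height_step:
  assumes c: "coprime f g" "coprime f0 g0" and H: "H f g f0 g0 = 0"
  obtains f1 g1 where "coprime f1 g1" "H f1 g1 f g = 0" "height f1 g1 + height f0 g0 \<le> 2 * height f g + 2"
proof -
  have e: "Q2 f g * f0^2 - Q1 f g * f0 * g0 + Q0 f g * g0^2 = 0" using H by (simp add: hbiq_def)
  obtain u v where uv: "Q2 f g = g0 * u" "Q0 f g = f0 * v" "Q1 f g = u * f0 + v * g0"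
    by (rule quadratic_form_factor[OF c(2) e])
  \<comment> \<open>If u = v = 0, the form vanishes identically. Then f / g = T, but there
    \<open>Q1\<close> is g^2 times \<open>lam\<close>, which is not zero.\<close>
  have nz: "v \<noteq> 0 \<or> u \<noteq> 0"
  proof (rule ccontr)
    assume "\<not> ?thesis"
    then have z: "Q2 f g = 0" "Q1 f g = 0" using uv by auto
    then have f: "f = T * g" by (simp add: hbiq_lead_def)
    then have g: "is_unit g" using c(1) by (metis coprime_common_divisor dvd_refl dvd_triv_right)
    have "g^2 * lam = Q1 f g" unfolding f hbiq_mid_def quartic_def
      by (simp only: algebra_simps power2_eq_square power3_eq_cube) (simp add: algebra_simps)
    then show False using z lam_nz g by auto
  qed
  have "f0 \<noteq> 0 \<or> g0 \<noteq> 0" using c(2) by auto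
  moreover have "degree (Q2 f g) \<le> 2 * height f g + 2" "degree (Q1 f g) \<le> 2 * height f g + 2" "degree (Q0 f g) \<le> 2 * height f g + 2"
    by (rule degree_forms; simp add: height_def)+
  ultimately have h: "height f0 g0 + height u v \<le> 2 * height f g + 2"
    using nz unfolding uv by (intro height_mult) auto
  obtain f1 g1 where r: "v = gcd v u * f1" "u = gcd v u * g1" "coprime f1 g1"
     "height f1 g1 + degree (gcd v u) = height v u" using poly_reduce[OF nz] by metis
  have "H f g v u = 0" unfolding hbiq_def uv by (simp add: algebra_simps power2_eq_square)
  then have "(gcd v u)^2 * H f g f1 g1 = 0" using hbiq_scale r by metis
  then have "H f1 g1 f g = 0" using nz hbiq_sym[of _ _ _ _ _ f g] by auto
  moreover have "height f1 g1 + height f0 g0 \<le> 2 * height f g + 2" using h r(4) by (simp add: height_def max.commute)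
  ultimately show ?thesis using that r(3) by blast
qed

text \<open>Differences of consecutive heights grow by at most 2 per step, starting from at most 1 -
  A. The induction carries two consecutive functions; the claim is that a height is never
  negative.\<close>

lemma heights_quadratic:
  assumes "coprime f0 g0" "coprime f1 g1" "H f1 g1 f0 g0 = 0"
    and "int (height f0 g0) = a" "int (height f1 g1) \<le> a + 1 - A"
  shows "0 \<le> int n ^ 2 - int n * A + a"
proof -
  have "\<exists>f g f' g'. coprime f g \<and> coprime f' g' \<and> H f' g' f g = 0 \<and>
     int (height f' g') - int (height f g) \<le> 2 * int n + 1 - A \<and>
     int (height f' g') \<le> (int n + 1)^2 - (int n + 1) * A + a" for n
  proof (induction n)
    case 0
    then show ?case using assms by (intro exI[of _ f0] exI[of _ g0] exI[of _ f1] exI[of _ g1]) auto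
  next
    case (Suc n)
    then obtain f g f' g' where IH: "coprime f g" "coprime f' g'" "H f' g' f g = 0"
      "int (height f' g') - int (height f g) \<le> 2 * int n + 1 - A"
      "int (height f' g') \<le> (int n + 1)^2 - (int n + 1) * A + a" by blast
    obtain f2 g2 where s: "coprime f2 g2" "H f2 g2 f' g' = 0" "height f2 g2 + height f g \<le> 2 * height f' g' + 2"
      using height_step[OF IH(2,1,3)] by blast
    have 1: "int (height f2 g2) - int (height f' g') \<le> 2 * int (Suc n) + 1 - A" using s(3) IH(4) by simp
    then have "int (height f2 g2) \<le> (int (Suc n) + 1)^2 - (int (Suc n) + 1) * A + a"
      using IH(5) by (simp add: algebra_simps power2_eq_square)
    then show ?case using IH(2) s 1 by blast
  qed
  note * = this
  show ?thesis
  proof (cases n)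
    case 0 then show ?thesis using assms(4) by simp
  next
    case (Suc m)
    have "\<exists>h::nat. int h \<le> (int m + 1)^2 - (int m + 1) * A + a"
      using *[of m] by (elim exE conjE) (rule exI)
    then obtain h :: nat where "int h \<le> (int m + 1)^2 - (int m + 1) * A + a" by (elim exE)
    then show ?thesis unfolding Suc using of_nat_0_le_iff[of h] by (simp add: algebra_simps)
  qed
qed

end

section \<open>The Frobenius point on the twist by \<open>lam\<close>, and the common zeros of
  \<open>num\<close> and \<open>den\<close>\<close>

context cubic_mod
begin

definition xp :: "'k poly" where "xp = T ^ p"
definition yp :: "'k poly" where "yp = lam ^ ((p - 1) div 2)"
definition Mp :: "'k poly" where "Mp = (b2 + 4 * xp + 4 * T) * (xp - T)^2"
text \<open>
  \<open>(xp, yp)\<close> and \<open>(T, 1)\<close> lie on the twist \<open>lam * y\<^sup>2 = quartic x\<close>, and \<open>num / den\<close> is the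
  \<open>x\<close>-coordinate of their sum.
\<close>

definition num :: "'k poly" where "num = lam * (yp - 1)^2 - Mp"
definition den :: "'k poly" where "den = 4 * (xp - T)^2"

lemma pow_p: "(z::'k) ^ p = z"
  using finite_field_power_card_eq_same[of z] unfolding p(1)[symmetric] .

lemma const_frob: "[:c:] ^ p = [:c:]" for c :: 'k
proof -
  have "[:c:] ^ n = [:c ^ n:]" for n by (induction n) (auto simp: one_pCons)
  from this[of p] show ?thesis unfolding pow_p .
qed

lemma lam_frob: "lam ^ p = quartic b2 b4 b6 xp"
proof -
  have fd: "(f + g) ^ p = f ^ p + g ^ p" for f g :: "'k poly"
    by (rule freshmans_dream) (simp_all only: semiring_char_poly p(2) prime_p)
  have n: "(4::'k poly)^p = 4" "(2::'k poly)^p = 2"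
    using const_frob[of 4] const_frob[of 2] by (simp_all add: numeral_poly)
  show ?thesis unfolding quartic_def fd power_mult_distrib const_frob n xp_def
    by (simp only: power_mult[symmetric] mult.commute[of p])
qed

lemma lam_yp: "lam * yp^2 = quartic b2 b4 b6 xp"
proof -
  have "lam * yp^2 = lam ^ (Suc (2 * ((p - 1) div 2)))" by (simp add: yp_def power_mult[symmetric] mult.commute)
  also have "Suc (2 * ((p - 1) div 2)) = p" using p(3) by presburger
  finally show ?thesis by (simp add: lam_frob)
qed

lemma H_num_den: "H xp 1 num den = 0"
proof -
  let ?S = "biq_sum b2 b4 b6 xp T" and ?P = "biq_prod b4 b6 b8 xp T"
  \<comment> \<open>N / \<open>den\<close> is the x-coordinate of the difference of the two points,
    so \<open>num\<close> / \<open>den\<close> and N / \<open>den\<close> are the two roots of the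
    form at \<open>xp\<close>.\<close>
  define N where "N = lam * (yp + 1)^2 - Mp"
  have h: "Q2 xp 1 = (xp - T)^2" "Q1 xp 1 = ?S" "Q0 xp 1 = ?P"
    by (simp_all only: hbiq_lead_def hbiq_mid_def hbiq_const_def biq_sum_def biq_prod_def mult_1_right power_one)
  have "4 * ?S = 2 * (lam * yp^2 + lam) - 2 * Mp"
    unfolding quartic_biq_sum[symmetric] lam_yp Mp_def ..
  also have "\<dots> = num + N" unfolding num_def N_def by (simp add: algebra_simps power2_eq_square)
  finally have S: "4 * ?S = num + N" .
  have "16 * (xp - T)^2 * ?P = (lam * yp^2 - lam)^2 - 2 * (lam * yp^2 + lam) * Mp + Mp^2"
    unfolding quartic_biq_prod[OF b8, symmetric] lam_yp Mp_def ..
  also have "\<dots> = num * N" unfolding num_def N_def by (simp add: algebra_simps power2_eq_square)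
  finally have P: "16 * (xp - T)^2 * ?P = num * N" .
  have "H xp 1 num den = (xp - T)^2 * (num^2 - (4 * ?S) * num + 16 * (xp - T)^2 * ?P)"
    unfolding hbiq_def h den_def by (simp add: algebra_simps power2_eq_square)
  also have "\<dots> = 0" unfolding S P by (simp add: algebra_simps power2_eq_square)
  finally show ?thesis .
qed

lemma degree_xp: "degree xp = p"
  unfolding xp_def by (simp add: degree_power_eq)

lemma xp_neq: "xp - T \<noteq> 0"
proof
  assume "xp - T = 0"
  then have "degree xp = degree T" by simp
  then show False using degree_xp prime_gt_1_nat[OF prime_p] by simp
qed

lemma den_nz: "den \<noteq> 0"
  using xp_neq four unfolding den_def by (simp add: numeral_poly)

lemma degree_lam: "degree lam \<le> 3"
proof -
  have c: "degree [:a:] \<le> 0" for a :: 'k by simp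
  have n: "degree (numeral m :: 'k poly) \<le> 0" for m by simp
  have T: "degree T \<le> 1" by simp
  have "degree (4 * T^3) \<le> 3"
    by (rule degree_mono[OF degree_mult_le'[OF n degree_power_le'[OF T]]]) simp
  moreover have "degree (b2 * T^2) \<le> 3"
    by (rule degree_mono[OF degree_mult_le'[OF c degree_power_le'[OF T]]]) simp
  moreover have "degree (2 * b4 * T) \<le> 3"
    by (rule degree_mono[OF degree_mult_le'[OF degree_mult_le'[OF n c] T]]) simp
  moreover have "degree b6 \<le> 3" by simp
  ultimately show ?thesis unfolding quartic_def by (intro degree_add_le)
qed

lemma height_num_den: "height num den \<le> 2 * p + 1"
proof -
  have p1: "p \<ge> 1" using prime_p prime_ge_1_nat by blast
  have c: "degree [:a:] \<le> 0" for a :: 'k by simp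
  have n: "degree (numeral m :: 'k poly) \<le> 0" for m by simp
  have T: "degree T \<le> 1" and x: "degree xp \<le> p" using degree_xp by simp_all
  have "num = lam * yp^2 - 2 * (lam * yp) + lam - Mp"
    unfolding num_def by (simp add: algebra_simps power2_eq_square)
  \<comment> \<open>The terms 4 \<open>xp\<close>^3 and \<open>b2\<close> \<open>xp\<close>^2 of the
    quartic at \<open>xp\<close> cancel against \<open>Mp\<close>, which leaves degree at most 2 p +
    1 instead of 3 p.\<close>
  also have "\<dots> = (4 * xp^2 * T + 4 * xp * T^2 + 2 * b2 * xp * T + 2 * b4 * xp + b6 - b2 * T^2 - 4 * T^3)
      - 2 * (lam * yp) + lam"
    unfolding lam_yp unfolding Mp_def quartic_def[of _ _ _ xp]
    by (simp only: algebra_simps power2_eq_square power3_eq_cube) (simp add: algebra_simps)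
  finally have num: "num = \<dots>" .
  have l: "degree (2 * (lam * yp)) \<le> 2 * p + 1"
  proof -
    have "degree (2 * (lam * yp)) \<le> 0 + (3 + 3 * ((p - 1) div 2))"
      unfolding yp_def by (intro degree_mult_le' n degree_lam degree_power_le')
    also have "\<dots> \<le> 2 * p + 1" using p1 p(3) by presburger
    finally show ?thesis .
  qed
  have l': "degree lam \<le> 2 * p + 1" using degree_lam p1 by simp
  have m1: "degree (4 * xp^2 * T) \<le> 2 * p + 1"
    by (rule degree_mono[OF degree_mult_le'[OF degree_mult_le'[OF n degree_power_le'[OF x]] T]]) simp
  have m2: "degree (4 * xp * T^2) \<le> 2 * p + 1"
    by (rule degree_mono[OF degree_mult_le'[OF degree_mult_le'[OF n x] degree_power_le'[OF T]]]) (use p1 in simp)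
  have m3: "degree (2 * b2 * xp * T) \<le> 2 * p + 1"
    by (rule degree_mono[OF degree_mult_le'[OF degree_mult_le'[OF degree_mult_le'[OF n c] x] T]]) simp
  have m4: "degree (2 * b4 * xp) \<le> 2 * p + 1"
    by (rule degree_mono[OF degree_mult_le'[OF degree_mult_le'[OF n c] x]]) simp
  have m5: "degree b6 \<le> 2 * p + 1" by simp
  have m6: "degree (b2 * T^2) \<le> 2 * p + 1"
    by (rule degree_mono[OF degree_mult_le'[OF c degree_power_le'[OF T]]]) (use p1 in simp)
  have m7: "degree (4 * T^3) \<le> 2 * p + 1"
    by (rule degree_mono[OF degree_mult_le'[OF n degree_power_le'[OF T]]]) (use p1 in simp)
  have "degree num \<le> 2 * p + 1"
    unfolding num by (intro degree_add_le degree_diff_le m1 m2 m3 m4 m5 m6 m7 l l')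
  moreover have "degree den \<le> 0 + p * 2" unfolding den_def
    by (intro degree_mult_le' degree_power_le' degree_diff_le n x degree_mono[OF T p1])
  ultimately show ?thesis by (simp add: height_def)
qed

text \<open>The number of points above a, hence 0, 1 or 2. It serves as the exponent of T - a in a
  common divisor of \<open>num\<close> and \<open>den\<close>.\<close>

definition mult_at :: "'k \<Rightarrow> nat" where
  "mult_at a = card {z. z^2 = quartic B2 B4 B6 a}"

lemma poly_lam: "poly lam a = quartic B2 B4 B6 a"
  by (simp add: quartic_def)

lemma mult_at_cases:
  obtains "mult_at a = 0"
  | "mult_at a = 1" "quartic B2 B4 B6 a = 0"
  | z where "mult_at a = 2" "quartic B2 B4 B6 a = z^2" "z \<noteq> 0"
proof -
  consider "\<nexists>z. z^2 = quartic B2 B4 B6 a" | "quartic B2 B4 B6 a = 0"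
    | z where "z^2 = quartic B2 B4 B6 a" "z \<noteq> 0" by (metis power_zero_numeral)
  then show ?thesis
  proof cases
    case 1 then show ?thesis using that(1) by (simp add: mult_at_def)
  next
    case 2 then show ?thesis using that(2) by (simp add: mult_at_def)
  next
    case 3
    have "{w. w^2 = z^2} = {z, - z}" by (auto simp: power2_eq_iff)
    moreover have "z \<noteq> - z"
    proof
      assume "z = - z"
      then have "2 * z = 0" by (metis add.right_inverse mult_2)
      then show False using two 3 by simp
    qed
    ultimately have "mult_at a = 2" unfolding mult_at_def 3(1)[symmetric] by simp
    then show ?thesis using that(3)[OF _ 3(1)[symmetric] 3(2)] by blast
  qed
qed

text \<open>T^p - T vanishes at a, so its square handles \<open>den\<close> and \<open>Mp\<close>.
  If the quartic is zero at a, then so is \<open>lam\<close>; if it is a nonzero square z^2, then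
  \<open>yp\<close> takes the value z^(p - 1) = 1 there and (\<open>yp\<close> - 1)^2 has a double
  zero.\<close>

lemma linear_power_dvd:
  "[:- a, 1:] ^ mult_at a dvd num" "[:- a, 1:] ^ mult_at a dvd den"
proof -
  let ?l = "[:- a, 1:]"
  have "poly (xp - T) a = 0" by (simp add: xp_def pow_p)
  then have x: "?l dvd xp - T" by (simp only: poly_eq_0_iff_dvd)
  have x2: "?l^2 dvd (xp - T)^2" using x by (rule dvd_power_same)
  have le: "mult_at a \<le> 2" by (cases rule: mult_at_cases[of a]) auto
  have dv: "?l ^ mult_at a dvd (xp - T)^2" using le_imp_power_dvd[OF le] x2 by (rule dvd_trans)
  then show "?l ^ mult_at a dvd den" unfolding den_def by (rule dvd_mult)
  have "?l ^ mult_at a dvd lam * (yp - 1)^2"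
  proof (cases rule: mult_at_cases[of a])
    case 1 then show ?thesis by simp
  next
    case 2
    then have "?l dvd lam" by (simp add: poly_eq_0_iff_dvd[symmetric] poly_lam)
    then show ?thesis using 2 by simp
  next
    case (3 z)
    have "poly yp a = (z^2) ^ ((p - 1) div 2)" using 3 poly_lam by (simp add: yp_def)
    also have "\<dots> = z ^ (p - 1)" using p(3) by (simp add: power_mult[symmetric] odd_two_times_div_two_nat)
    also have "\<dots> = 1"
    proof -
      have "z ^ (p - 1) * z = z ^ p" using prime_gt_0_nat[OF prime_p] by (metis power_minus_mult)
      also have "\<dots> = z" by (rule pow_p)
      finally show ?thesis using 3(3) by simp
    qed
    finally have "?l dvd yp - 1" by (simp add: poly_eq_0_iff_dvd[symmetric])
    then show ?thesis using 3(1) by (simp add: dvd_power_same)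
  qed
  moreover have "?l ^ mult_at a dvd Mp" unfolding Mp_def using dv by (rule dvd_mult)
  ultimately show "?l ^ mult_at a dvd num" unfolding num_def by (rule dvd_diff)
qed

lemma coprime_linear: "a \<noteq> b \<Longrightarrow> coprime [:- a, 1:] [:- b, 1 :: 'k:]"
proof (rule coprimeI)
  fix d assume ab: "a \<noteq> b" and "d dvd [:- a, 1:]" "d dvd [:- b, 1 :: 'k:]"
  then have "d dvd [:- a, 1:] - [:- b, 1:]" by (rule_tac dvd_diff)
  then have "d dvd [:b - a:]" by simp
  moreover have "is_unit [:b - a:]" using ab by (simp add: is_unit_const_poly_iff)
  ultimately show "is_unit d" by (rule dvd_unit_imp_unit)
qed

lemma prod_linear_dvd:
  assumes "\<And>a. [:- a, 1:] ^ mult_at a dvd f"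
  shows "(\<Prod>a\<in>UNIV. [:- a, 1:] ^ mult_at a) dvd f"
proof -
  have "finite S \<Longrightarrow> (\<Prod>a\<in>S. [:- a, 1:] ^ mult_at a) dvd f" for S
  proof (induction S rule: finite_induct)
    case (insert a S)
    have "coprime ([:- a, 1:] ^ mult_at a) (\<Prod>a\<in>S. [:- a, 1:] ^ mult_at a)"
    proof (rule prod_coprime_right)
      fix b assume "b \<in> S"
      then have "coprime [:- a, 1:] [:- b, 1:]" using insert.hyps by (intro coprime_linear) auto
      then show "coprime ([:- a, 1:] ^ mult_at a) ([:- b, 1:] ^ mult_at b)" by simp
    qed
    then show ?case using insert assms by (simp add: divides_mult)
  qed simp
  then show ?thesis by simp
qed

text \<open>Each affine point removes one degree from \<open>num\<close> / \<open>den\<close>, so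
  the reduced fraction has height at most 2 p + 1 minus their number, which is p + 1 - A.\<close>

lemma hasse_count:
  fixes A :: int
  defines "A \<equiv> (\<Sum>a\<in>UNIV. int (mult_at a)) - int p"
  assumes "A \<ge> 0"
  shows "A^2 \<le> 4 * int p + 1"
proof -
  let ?G = "\<Prod>a\<in>UNIV. [:- a, 1:] ^ mult_at a"
  have G: "degree ?G = (\<Sum>a\<in>UNIV. mult_at a)"
    by (subst degree_prod_eq_sum_degree) (auto simp: degree_power_eq)
  have nz: "num \<noteq> 0 \<or> den \<noteq> 0" using den_nz by simp
  obtain f g where fg: "num = gcd num den * f" "den = gcd num den * g" "coprime f g"
     "height f g + degree (gcd num den) = height num den" using poly_reduce[OF nz] by metis
  have "?G dvd gcd num den"
    by (intro gcd_greatest prod_linear_dvd linear_power_dvd)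
  then have "degree ?G \<le> degree (gcd num den)" using nz by (intro dvd_imp_degree_le) auto
  then have h1: "height f g + (\<Sum>a\<in>UNIV. mult_at a) \<le> 2 * p + 1" using fg(4) height_num_den G by linarith
  have h1': "int (height f g) \<le> int p + 1 - A"
  proof -
    have "(\<Sum>a\<in>UNIV. int (mult_at a)) = int (\<Sum>a\<in>UNIV. mult_at a)" by simp
    then show ?thesis using h1 unfolding A_def by linarith
  qed
  have "(gcd num den)^2 * H xp 1 f g = 0" using H_num_den hbiq_scale fg(1,2) by metis
  then have "H f g xp 1 = 0" using nz hbiq_sym[of _ _ _ _ _ xp] by auto
  moreover have "int (height xp 1) = int p" by (simp add: height_def degree_xp)
  ultimately have *: "0 \<le> int n ^ 2 - int n * A + int p" for n
    using heights_quadratic[of xp 1 f g "int p" A n] fg(3) h1' by simp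
  \<comment> \<open>The integer part of A / 2 minimises n^2 - n A + p over the integers. For A = 2 n
    + 1 the result is A^2 \<le> 4 p + 1, for A = 2 n even A^2 \<le> 4 p.\<close>
  define n where "n = nat (A div 2)"
  have n: "A = 2 * int n \<or> A = 2 * int n + 1" using assms(2) unfolding n_def by auto
  then show ?thesis using *[of n] by (auto simp: power2_eq_square algebra_simps)
qed

end

section \<open>Counting points on Weierstrass equations modulo p\<close>

definition excess :: "int weierstrass \<Rightarrow> nat \<Rightarrow> int" where
  "excess W p = int (card (points_mod W p)) - int p - 1"

text \<open>As 2 is invertible, (x, y) \<mapsto> (x, 2 y + a1 x + a3) is a bijection onto the points
  counted by \<open>mult_at\<close>. At good reduction \<open>excess\<close> is minus the trace of
  Frobenius.\<close>

lemma hasse_bound_mod_ring: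
  assumes odd: "odd CARD('b::prime_card)" and nn: "excess W CARD('b) \<ge> 0"
  shows "(excess W CARD('b))^2 \<le> 4 * int CARD('b) + 1"
proof -
  define p where "p = CARD('b)"
  define V :: "'b mod_ring weierstrass" where "V = map_weierstrass of_int W"
  note V = map_weierstrass_of_int[where W = W, where ?'a = "'b mod_ring", folded V_def]
  interpret cubic_mod "wb2 V" "wb4 V" "wb6 V" "wb8 V" p
    by standard (use odd wb8_rel in \<open>auto simp: p_def\<close>)
  have dvd: "of_int k = (0 :: 'b mod_ring) \<longleftrightarrow> int p dvd k" for k
    using of_int_eq_0_iff_char_dvd[of k, where ?'a = "'b mod_ring"] by (simp add: p_def)
  have inj: "x = y" if "x \<in> {0..<int p}" "y \<in> {0..<int p}" "of_int x = (of_int y :: 'b mod_ring)" for x y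
  proof -
    have "of_int (x - y) = (0 :: 'b mod_ring)" using that(3) by simp
    then have "int p dvd x - y" by (simp only: dvd)
    then have "x mod int p = y mod int p" by (simp only: mod_eq_dvd_iff)
    then show ?thesis using that(1,2) by simp
  qed
  have surj: "\<exists>x\<in>{0..<int p}. of_int x = a" for a :: "'b mod_ring"
    using range_to_int_mod_ring[where ?'a = 'b] of_int_mod_ring_to_int_mod_ring[of a]
    unfolding of_int_of_int_mod_ring p_def by (metis rangeI)
  define Aff where "Aff = {(x, y). x \<in> {0..<int p} \<and> y \<in> {0..<int p} \<and> [wpoly W x y = 0] (mod int p)}"
  have fin: "finite Aff"
    by (rule finite_subset[of _ "{0..<int p} \<times> {0..<int p}"]) (auto simp: Aff_def)
  have pts: "points_mod W p = insert Infty ((\<lambda>(x, y). Affine x y) ` Aff)"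
    unfolding points_mod_def Aff_def by auto
  have "card (points_mod W p) = Suc (card ((\<lambda>(x, y). Affine x y) ` Aff))"
    unfolding pts using fin by (subst card_insert_disjoint) auto
  also have "card ((\<lambda>(x, y). Affine x y) ` Aff) = card Aff"
    by (rule card_image) (auto simp: inj_on_def)
  finally have c1: "card (points_mod W p) = Suc (card Aff)" .
  let ?S = "SIGMA a:(UNIV :: 'b mod_ring set). {z. z^2 = quartic (wb2 V) (wb4 V) (wb6 V) a}"
  let ?h = "\<lambda>(x, y). (of_int x :: 'b mod_ring, wpoly_dy V (of_int x) (of_int y))"
  have on: "(wpoly_dy V (of_int x) (of_int y))^2 = quartic (wb2 V) (wb4 V) (wb6 V) (of_int x)
     \<longleftrightarrow> [wpoly W x y = 0] (mod int p)" for x y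
    unfolding wpoly_dy_square V(5) using four dvd[of "wpoly W x y"] by (simp add: cong_0_iff)
  have "bij_betw ?h Aff ?S"
  proof (rule bij_betwI')
    fix u v assume "u \<in> Aff" "v \<in> Aff"
    then show "?h u = ?h v \<longleftrightarrow> u = v"
      using inj two by (fastforce simp: Aff_def wpoly_dy_def)
  next
    fix u assume "u \<in> Aff"
    then show "?h u \<in> ?S" using on by (auto simp: Aff_def)
  next
    fix w assume w: "w \<in> ?S"
    obtain a z where az: "w = (a, z)" by (cases w)
    obtain x where x: "x \<in> {0..<int p}" "of_int x = a" using surj by blast
    obtain y where y: "y \<in> {0..<int p}" "of_int y = (z - wa1 V * a - wa3 V) / 2" using surj by blast
    have z: "wpoly_dy V (of_int x) (of_int y) = z" using two by (simp add: wpoly_dy_def x y)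
    then have "(x, y) \<in> Aff" using w on[of x y] x y by (auto simp: Aff_def az)
    then show "\<exists>u\<in>Aff. w = ?h u" using z x az by force
  qed
  then have "card Aff = card ?S" by (rule bij_betw_same_card)
  also have "\<dots> = (\<Sum>a\<in>UNIV. mult_at a)" by (simp add: mult_at_def)
  finally have "excess W p = (\<Sum>a\<in>UNIV. int (mult_at a)) - int p"
    unfolding excess_def c1 by simp
  then show ?thesis using hasse_count nn unfolding p_def[symmetric] by simp
qed

text \<open>
  A type cannot depend on a prime \<open>p\<close>.  But one closed type suffices: its cardinality is chosen to be a
  prime violating the bound if there is one, so the bound for this type implies it for all primes.
\<close>

definition violates_hasse :: "nat \<Rightarrow> bool" where
  "violates_hasse p \<longleftrightarrow> prime p \<and> odd p \<and> (\<exists>W. excess W p \<ge> 0 \<and> (excess W p)^2 > 4 * int p + 1)"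

definition test_prime :: nat where
  "test_prime = (if \<exists>p. violates_hasse p then SOME p. violates_hasse p else 2)"

lemma test_prime: "prime test_prime" "violates_hasse p \<Longrightarrow> violates_hasse test_prime"
proof -
  have *: "violates_hasse test_prime" if "violates_hasse p" for p
    unfolding test_prime_def using that by (auto intro: someI)
  then show "violates_hasse p \<Longrightarrow> violates_hasse test_prime" .
  show "prime test_prime"
    using * by (cases "\<exists>p. violates_hasse p") (auto simp: violates_hasse_def test_prime_def)
qed

typedef prime_index = "{..<test_prime}"
  using prime_gt_0_nat[OF test_prime(1)] by auto

lemma card_prime_index: "CARD(prime_index) = test_prime"
  using type_definition.card[OF type_definition_prime_index] by simp

instance prime_index :: prime_card
  by standard (simp add: card_prime_index test_prime)

theorem hasse_bound:
  assumes "prime p" "odd p" "excess W p \<ge> 0"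
  shows "(excess W p)^2 \<le> 4 * int p + 1"
proof (rule ccontr)
  assume "\<not> ?thesis"
  then have "violates_hasse test_prime" using assms by (intro test_prime(2)) (auto simp: violates_hasse_def)
  then obtain V where "odd test_prime" "excess V test_prime \<ge> 0" "(excess V test_prime)^2 > 4 * int test_prime + 1"
    by (auto simp: violates_hasse_def)
  then show False using hasse_bound_mod_ring[where ?'b = prime_index, of V] by (simp add: card_prime_index)
qed

section \<open>Index divisibility\<close>

lemma ex_residue:
  assumes p: "prime p" and q: "q \<in> padic p 0"
  shows "\<exists>c\<in>{0..<int p}. q - of_int c \<in> padic p 1"
proof -
  obtain a b where ab: "q * of_int b = of_int (int p ^ 0 * a)" "\<not> int p dvd b"
    using q by (rule padicE[OF p])
  have "coprime b (int p)" using ab(2) p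
    by (metis coprime_commute prime_imp_coprime prime_nat_int_transfer)
  then obtain b' where b': "[b * b' = 1] (mod int p)" by (rule cong_solve_coprime_int[THEN exE])
  define c where "c = (a * b') mod int p"
  have "[b * c = (b * b') * a] (mod int p)" unfolding c_def
    by (metis cong_mod_left cong_refl cong_scalar_left mult.assoc mult.commute)
  also have "[(b * b') * a = 1 * a] (mod int p)" by (rule cong_scalar_right[OF b'])
  finally have "int p dvd b * c - 1 * a" by (simp only: cong_iff_dvd_diff)
  then have "int p dvd a - b * c" by (simp add: dvd_diff_commute)
  then obtain d where d: "a - b * c = int p * d" by (rule dvdE)
  have "(q - of_int c) * of_int b = of_int (a - b * c)" using ab(1) by (simp add: algebra_simps)
  then have "q - of_int c \<in> padic p 1" using ab(2) unfolding d by (intro padicI[OF p, of _ b 1 d]) simp_all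
  moreover have "c \<in> {0..<int p}" using prime_gt_0_nat[OF p] by (simp add: c_def)
  ultimately show ?thesis by blast
qed

definition residue :: "nat \<Rightarrow> rat \<Rightarrow> int" where
  "residue p q = (SOME c. c \<in> {0..<int p} \<and> q - of_int c \<in> padic p 1)"

lemma residue:
  assumes "prime p" "q \<in> padic p 0"
  shows "residue p q \<in> {0..<int p}" "q - of_int (residue p q) \<in> padic p 1"
  using someI_ex[of "\<lambda>c. c \<in> {0..<int p} \<and> q - of_int c \<in> padic p 1"] ex_residue[OF assms]
  unfolding residue_def by blast+

lemma residue_eqD:
  assumes p: "prime p" and "q \<in> padic p 0" "r \<in> padic p 0" "residue p q = residue p r"
  shows "q - r \<in> padic p 1"
  using padic_diff[OF p residue(2)[OF p assms(2)] residue(2)[OF p assms(3)]] assms(4) by simp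

text \<open>Iterate f up to the first repetition a i = a j; the values from i to j - 1 form the
  cycle.\<close>

lemma ex_functional_cycle:
  fixes f :: "'a \<Rightarrow> 'a"
  assumes "finite S" "S \<noteq> {}" "f ` S \<subseteq> S"
  obtains cs where "cs \<noteq> []" "distinct cs" "set cs \<subseteq> S"
    "\<And>i. i < length cs \<Longrightarrow> f (cs ! i) = cs ! ((i + 1) mod length cs)"
proof -
  obtain s where s: "s \<in> S" using assms(2) by blast
  define a where "a i = (f ^^ i) s" for i
  have aS: "a i \<in> S" for i by (induction i) (use s assms(3) in \<open>auto simp: a_def\<close>)
  have "\<not> inj a" using assms(1) aS finite_imageD[of a UNIV] finite_subset[of "range a" S] by auto
  then have ex: "\<exists>j. \<exists>i<j. a i = a j" by (metis injI linorder_neqE_nat)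
  define j where "j = (LEAST j. \<exists>i<j. a i = a j)"
  obtain i where i: "i < j" "a i = a j" using LeastI_ex[OF ex] unfolding j_def by blast
  have inj: "inj_on a {..<j}"
  proof (rule linorder_inj_onI)
    fix x y assume "x < y" "y \<in> {..<j}"
    then show "a x \<noteq> a y" using not_less_Least[of y "\<lambda>j. \<exists>i<j. a i = a j"] unfolding j_def by auto
  qed auto
  let ?cs = "map a [i..<j]"
  show ?thesis
  proof (rule that[of ?cs])
    show "distinct ?cs" unfolding distinct_map
      by (intro conjI distinct_upt inj_on_subset[OF inj]) auto
    fix t assume t: "t < length ?cs"
    have "f (?cs ! t) = a (i + t + 1)" using t by (simp add: a_def)
    also have "\<dots> = ?cs ! ((t + 1) mod length ?cs)"
    proof (cases "t + 1 = length ?cs")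
      case True
      then have "i + t + 1 = j" using i by simp
      then show ?thesis using True i by simp
    next
      case False
      then show ?thesis using t by simp
    qed
    finally show "f (?cs ! t) = ?cs ! ((t + 1) mod length ?cs)" .
  qed (use i aS in auto)
qed

lemma prod_cyclic_shift: "(\<Prod>i<n. g ((i + 1) mod n)) = (\<Prod>i<n. g i)" for g :: "nat \<Rightarrow> 'a::comm_monoid_mult"
proof (cases n)
  case (Suc m)
  have "(\<Prod>i<m. g ((i + 1) mod Suc m)) = (\<Prod>i<m. g (Suc i))" by (intro prod.cong) auto
  then show ?thesis unfolding Suc prod.lessThan_Suc_shift[of g] by (simp add: mult.commute)
qed simp

lemma prod_list_primes_dvd:
  fixes x :: nat
  assumes "distinct ps" "\<And>q. q \<in> set ps \<Longrightarrow> prime q \<and> q dvd x"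
  shows "prod_list ps dvd x"
  using assms
proof (induction ps)
  case (Cons q ps)
  have "coprime q (prod_list ps)"
  proof (rule prod_list_coprime_right)
    fix r assume "r \<in> set ps"
    then show "coprime q r" using Cons.prems by (intro primes_coprime) auto
  qed
  then show ?case using Cons by (simp add: divides_mult)
qed simp

lemma elem_dvd_prod_list: "q \<in> set ps \<Longrightarrow> q dvd prod_list ps" for q :: nat
  by (induction ps) auto

lemma prime_dvd_prod_list_primes:
  fixes q :: nat
  assumes "prime q" "\<And>r. r \<in> set ps \<Longrightarrow> prime r" "q dvd prod_list ps"
  shows "q \<in> set ps"
proof -
  have "\<exists>r\<in>set ps. q dvd r" using assms(3)
    by (induction ps) (use assms(1) in \<open>auto simp: prime_dvd_mult_iff\<close>)
  then obtain r where "r \<in> set ps" "q dvd r" by blast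
  then show ?thesis using assms(1,2) primes_dvd_imp_eq by blast
qed

lemma cyclic_closed:
  assumes "i < n" "P i" "\<And>i. i < n \<Longrightarrow> P i \<Longrightarrow> P ((i + 1) mod n)" "j < n"
  shows "P (j :: nat)"
proof -
  have "P ((i + t) mod n)" for t
  proof (induction t)
    case (Suc t)
    then show ?case using assms(3)[of "(i + t) mod n"] assms(1) by (simp add: mod_Suc_eq)
  qed (use assms in simp)
  from this[of "j + (n - i)"] show ?thesis using assms(1,4) by simp
qed

lemma ArrI:
  assumes "n \<in> index_set D" "m \<in> index_set D" "n dvd m" "n \<noteq> m"
    and "\<And>k. k \<in> index_set D \<Longrightarrow> n dvd k \<Longrightarrow> k dvd m \<Longrightarrow> k = n \<or> k = m"
  shows "(n, m) \<in> Arr D"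
  using assms unfolding Arr_def by blast

lemma Arr_basic:
  assumes "(n, m) \<in> Arr D" shows "n \<in> index_set D" "m \<in> index_set D" "n \<noteq> m"
  using assms unfolding Arr_def by blast+

lemma ArrD:
  assumes "(n, m) \<in> Arr D" "k \<in> index_set D" "n dvd k" "k dvd m"
  shows "k = n \<or> k = m"
  using assms unfolding Arr_def by blast

section \<open>Divisibility in an elliptic divisibility sequence and the rank of apparition\<close>

locale eds =
  fixes W :: "int weierstrass" and P :: "rat point" and D :: "nat \<Rightarrow> nat"
  assumes eds: "is_eds W P D"
begin

definition X :: "nat \<Rightarrow> rat" where
  "X n = (case point_mult (rat_curve W) n P of Affine x y \<Rightarrow> x | Infty \<Rightarrow> 0)"

definition Y :: "nat \<Rightarrow> rat" where
  "Y n = (case point_mult (rat_curve W) n P of Affine x y \<Rightarrow> y | Infty \<Rightarrow> 0)"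

lemma D_pos: "n \<ge> 1 \<Longrightarrow> D n > 0"
  using eds by (simp add: is_eds_def)

lemma
  assumes "n \<ge> 1"
  shows XY: "point_mult (rat_curve W) n P = Affine (X n) (Y n)"
    and X_fraction: "\<exists>A. X n * of_int (int (D n)^2) = of_int A \<and> coprime A (int (D n))"
proof -
  obtain A y where A: "point_mult (rat_curve W) n P = Affine (of_int A / of_nat (D n) ^ 2) y" "coprime A (int (D n)^2)"
    using eds assms unfolding is_eds_def by blast
  then have x: "X n = of_int A / of_nat (D n)^2" "Y n = y" by (simp_all add: X_def Y_def)
  then show "point_mult (rat_curve W) n P = Affine (X n) (Y n)" using A(1) by simp
  have "X n * of_int (int (D n)^2) = of_int A" using x D_pos[OF assms] by simp
  moreover have "coprime A (int (D n))" using A(2) by simp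
  ultimately show "\<exists>A. X n * of_int (int (D n)^2) = of_int A \<and> coprime A (int (D n))" by blast
qed

lemma on_curve_P: "on_curve (rat_curve W) P"
  using eds by (simp add: is_eds_def)

lemma orbit: "prime p \<Longrightarrow> padic_orbit (wb2 W) (wb4 W) (wb6 W) (wb8 W) (wpoly_dy (rat_curve W) (X 1) (Y 1)) X p"
  using kummer_orbit_point_mult(1)[OF XY on_curve_P]
  by (simp add: padic_orbit_def padic_orbit_axioms_def map_weierstrass_of_int)

lemma on_XY: "n \<ge> 1 \<Longrightarrow> wpoly (rat_curve W) (X n) (Y n) = 0"
  using kummer_orbit_point_mult(2)[OF XY on_curve_P] .

context
  fixes p :: nat
  assumes p: "prime p"
begin

interpretation padic_orbit "wb2 W" "wb4 W" "wb6 W" "wb8 W" "wpoly_dy (rat_curve W) (X 1) (Y 1)" X p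
  by (rule orbit[OF p])

text \<open>With X n = A / D n ^ 2 and A prime to D n, the reciprocal 1 / X n carries exactly the
  factor D n ^ 2 at the primes dividing D n.\<close>

lemma level_iff:
  assumes "n \<ge> 1" "k \<ge> 1" shows "level k n \<longleftrightarrow> p ^ k dvd D n"
proof -
  obtain A where A: "X n * of_int (int (D n)^2) = of_int A" "coprime A (int (D n))"
    using X_fraction[OF assms(1)] by blast
  have D0: "of_int (int (D n)^2) \<noteq> (0::rat)" using D_pos[OF assms(1)] by simp
  show ?thesis
  proof
    assume "level k n"
    then have l: "X n \<noteq> 0" "1 / X n \<in> padic p (2 * k)" by (auto simp: level_def)
    have "1 / X n * of_int A = of_int (int (D n)^2)" using A(1) l(1) by (simp add: field_simps)
    then have "of_int (int (D n)^2) \<in> padic p (2 * k)"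
      using padic_mult_int[OF p l(2) padic_of_int[OF p, of A]] by simp
    then have "int p ^ (2 * k) dvd int (D n)^2" unfolding padic_of_int_iff[OF p] .
    then have "(int p ^ k)^2 dvd int (D n)^2" by (simp add: power_mult[symmetric] mult.commute)
    then have "int p ^ k dvd int (D n)" by simp
    then show "p ^ k dvd D n" by (metis int_dvd_int_iff of_nat_power)
  next
    assume d: "p ^ k dvd D n"
    then have "p dvd D n" using assms(2) by (meson dvd_power dvd_trans not_gr_zero not_one_le_zero less_le_trans zero_less_one)
    then have nA: "\<not> int p dvd A" using A(2) p
      by (metis coprime_common_divisor int_dvd_int_iff not_prime_unit prime_nat_int_transfer)
    then have "A \<noteq> 0" by auto
    then have x0: "X n \<noteq> 0" using A(1) by auto
    obtain e where e: "D n = p ^ k * e" using d by (rule dvdE)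
    have "1 / X n * of_int A = of_int (int (D n)^2)" using A(1) x0 by (simp add: field_simps)
    also have "\<dots> = of_int (int p ^ (2 * k) * int e^2)"
      unfolding e by (simp add: power_mult_distrib power_mult[symmetric] mult.commute)
    finally show "level k n" using nA x0 padicI[OF p] unfolding level_def by blast
  qed
qed

lemma integral_iff: "n \<ge> 1 \<Longrightarrow> X n \<in> padic p 0 \<longleftrightarrow> \<not> p dvd D n"
proof
  assume n: "n \<ge> 1" and x: "X n \<in> padic p 0"
  show "\<not> p dvd D n"
  proof
    assume "p dvd D n"
    then have "level 1 n" using level_iff[OF n, of 1] by simp
    then have "X n \<noteq> 0" "1 / X n \<in> padic p 2" by (auto simp: level_def)
    then have "1 \<in> padic p 2" using padic_mult_int[OF p _ x, of "1 / X n" 2] by simp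
    then show False using one_not_padic[OF p, of 1] by (simp add: numeral_2_eq_2)
  qed
next
  assume n: "n \<ge> 1" and d: "\<not> p dvd D n"
  obtain A where A: "X n * of_int (int (D n)^2) = of_int A" using X_fraction[OF n] by blast
  have "\<not> int p dvd int (D n)^2" using d p by (simp add: prime_dvd_power_iff)
  then show "X n \<in> padic p 0" using A by (intro padicI[OF p, of _ "int (D n)^2" 0 A]) simp_all
qed

lemma prime_power_dvd_mult:
  assumes "n \<ge> 1" "j \<ge> 1" "p ^ k dvd D n" shows "p ^ k dvd D (j * n)"
proof (cases "k = 0")
  case False
  then have "level k n" using assms level_iff by simp
  then have "level k (j * n)" using level_mult[OF assms(1) _ _ assms(2), of k] False by simp
  then show ?thesis using level_iff[of "j * n" k] assms False by simp
qed simp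

lemma prime_power_dvd_prime_mult:
  assumes "n \<ge> 1" "k \<ge> 1" "p ^ k dvd D n" shows "p ^ (k + 1) dvd D (p * n)"
  using level_prime_mult[OF assms(1,2)] level_iff assms prime_ge_1_nat[OF p] by simp

lemma dvd_diff_index:
  assumes "n \<ge> 1" "m > n" "p dvd D m" "p dvd D n" shows "p dvd D (m - n)"
proof -
  have "level 1 m" "level 1 n" using assms level_iff[of _ 1] by simp_all
  then have "level 1 (m - n)" using level_diff(2)[OF assms(1,2), of 1] by simp
  then show ?thesis using level_iff[of "m - n" 1] assms by simp
qed

end

lemma D_dvd_D_mult:
  assumes "n \<ge> 1" "j \<ge> 1" shows "D n dvd D (j * n)"
proof (rule multiplicity_le_imp_dvd)
  show "D n \<noteq> 0" using D_pos[OF assms(1)] by simp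
  fix q :: nat assume q: "prime q"
  have "q ^ multiplicity q (D n) dvd D (j * n)"
    by (rule prime_power_dvd_mult[OF q assms multiplicity_dvd])
  then show "multiplicity q (D n) \<le> multiplicity q (D (j * n))"
    using D_pos[of "j * n"] assms q by (intro multiplicity_geI) auto
qed

lemma D_dvd: "n \<ge> 1 \<Longrightarrow> m \<ge> 1 \<Longrightarrow> n dvd m \<Longrightarrow> D n dvd D m"
  using D_dvd_D_mult[of n "m div n"] by (auto elim!: dvdE simp: mult.commute)

lemma
  assumes "prime p" "\<exists>n\<ge>1. p dvd D n"
  shows rank_app: "rank_app D p \<ge> 1 \<and> p dvd D (rank_app D p)"
    and rank_app_least: "1 \<le> n \<Longrightarrow> n < rank_app D p \<Longrightarrow> \<not> p dvd D n"
  unfolding rank_app_def using LeastI_ex[of "\<lambda>r. r \<ge> 1 \<and> p dvd D r"] assms(2)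
    not_less_Least[of n "\<lambda>r. r \<ge> 1 \<and> p dvd D r"] by blast+

text \<open>By \<open>dvd_diff_index\<close> the least index can be subtracted repeatedly, and this
  must end at the least index itself.\<close>

lemma rank_app_dvd_iff:
  assumes p: "prime p" and ex: "\<exists>n\<ge>1. p dvd D n" and n: "n \<ge> 1"
  shows "p dvd D n \<longleftrightarrow> rank_app D p dvd n"
proof
  let ?r = "rank_app D p"
  have r: "?r \<ge> 1" "p dvd D ?r" using rank_app[OF p ex] by auto
  show "p dvd D n" if "?r dvd n" using D_dvd[OF r(1) n that] r(2) by (rule dvd_trans[rotated])
  show "?r dvd n" if "p dvd D n"
    using n that
  proof (induction n rule: less_induct)
    case (less n)
    have "?r \<le> n" using rank_app_least[OF p ex less.prems(1)] less.prems(2) by (meson not_less)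
    show ?case
    proof (cases "n = ?r")
      case False
      then have "p dvd D (n - ?r)" using dvd_diff_index[OF p r(1) _ less.prems(2) r(2)] \<open>?r \<le> n\<close> by simp
      then have "?r dvd n - ?r" using less.IH[of "n - ?r"] r(1) \<open>?r \<le> n\<close> False by simp
      then show ?thesis using \<open>?r \<le> n\<close> by (metis dvd_diffD dvd_refl)
    qed simp
  qed
qed

section \<open>The rank of apparition at a prime of good reduction\<close>

context
  fixes p :: nat
  assumes p: "prime p" and good: "good_reduction W p"
begin

interpretation padic_orbit "wb2 W" "wb4 W" "wb6 W" "wb8 W" "wpoly_dy (rat_curve W) (X 1) (Y 1)" X p
  by (rule orbit[OF p])

lemma not_dvd_disc: "\<not> int p dvd - ((wb2 W)^2 * wb8 W) - 8 * (wb4 W)^3 - 27 * (wb6 W)^2 + 9 * wb2 W * wb4 W * wb6 W"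
  using good by (simp add: good_reduction_def disc_wb)

lemma congruent_imp_dvd:
  assumes "n \<ge> 1" "m > n" "X m \<in> padic p 0" "X n \<in> padic p 0" "residue p (X m) = residue p (X n)"
  shows "p dvd D (m + n) \<or> p dvd D (m - n)"
  using congruent_imp[OF not_dvd_disc assms(1-4) residue_eqD[OF p assms(3-5)]]
    integral_iff[OF p, of "m + n"] integral_iff[OF p, of "m - n"] assms by auto

text \<open>Otherwise all X n are p-integral, and two of the first p + 1 agree modulo p, so p
  divides D (m + n) or D (m - n).\<close>

lemma ex_dvd: "\<exists>n\<ge>1. p dvd D n"
proof (rule ccontr)
  assume nex: "\<not> ?thesis"
  then have i: "X n \<in> padic p 0" if "n \<ge> 1" for n using that integral_iff[OF p] by blast
  have "\<not> inj_on (\<lambda>n. residue p (X n)) {1..p+1}"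
  proof
    assume "inj_on (\<lambda>n. residue p (X n)) {1..p+1}"
    then have "card {1..p+1} \<le> card {0..<int p}"
      by (rule card_inj_on_le) (use residue(1)[OF p i] in auto)
    then show False by simp
  qed
  then obtain m n where mn: "n \<ge> 1" "m > n" "residue p (X m) = residue p (X n)"
    unfolding inj_on_def by (metis atLeastAtMost_iff linorder_neqE_nat)
  then have "p dvd D (m + n) \<or> p dvd D (m - n)" using congruent_imp_dvd i by simp
  moreover have "m + n \<ge> 1" "m - n \<ge> 1" using mn by auto
  ultimately show False using nex by blast
qed

lemma Y_integral:
  assumes "n \<ge> 1" "X n \<in> padic p 0" shows "Y n \<in> padic p 0"
proof (rule padic_quadratic_root_0[OF p])
  let ?V = "rat_curve W"
  show "Y n ^ 2 + (wa1 ?V * X n + wa3 ?V) * Y n + (- (X n ^ 3) - wa2 ?V * X n ^ 2 - wa4 ?V * X n - wa6 ?V) = 0"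
    using on_XY[OF assms(1)] by (simp add: wpoly_def algebra_simps)
  have c: "wa1 ?V \<in> padic p 0" "wa2 ?V \<in> padic p 0" "wa3 ?V \<in> padic p 0" "wa4 ?V \<in> padic p 0" "wa6 ?V \<in> padic p 0"
    by (cases W; simp add: padic_of_int[OF p])+
  show "wa1 ?V * X n + wa3 ?V \<in> padic p 0" "- (X n ^ 3) - wa2 ?V * X n ^ 2 - wa4 ?V * X n - wa6 ?V \<in> padic p 0"
    by (intro padic_rules c assms)+
qed

lemma residue_on_curve:
  assumes x: "x \<in> padic p 0" and y: "y \<in> padic p 0" and on: "wpoly (rat_curve W) x y = 0"
  shows "Affine (residue p x) (residue p y) \<in> points_mod W p"
proof -
  let ?V = "rat_curve W" let ?a = "of_int (residue p x) :: rat" and ?b = "of_int (residue p y) :: rat"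
  have c: "wa1 ?V \<in> padic p 0" "wa2 ?V \<in> padic p 0" "wa3 ?V \<in> padic p 0" "wa4 ?V \<in> padic p 0" "wa6 ?V \<in> padic p 0"
    by (cases W; simp add: padic_of_int[OF p])+
  have "of_int (wpoly W (residue p x) (residue p y)) = wpoly ?V ?a ?b"
    by (rule map_weierstrass_of_int(5)[symmetric])
  also have "\<dots> = wpoly ?V ?a ?b - wpoly ?V x y" using on by simp
  also have "\<dots> = - ((y - ?b) * (y + ?b + wa1 ?V * x + wa3 ?V)
      + (x - ?a) * (wa1 ?V * ?b - (x * x + x * ?a + ?a * ?a) - wa2 ?V * (x + ?a) - wa4 ?V))"
    by (simp add: wpoly_def algebra_simps power2_eq_square power3_eq_cube)
  also have "\<dots> \<in> padic p 1"
    by (intro padic_rules c x y residue[OF p])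
  finally have "int p dvd wpoly W (residue p x) (residue p y)"
    unfolding padic_of_int_iff[OF p] by simp
  then show ?thesis using residue(1)[OF p x] residue(1)[OF p y] by (auto simp: points_mod_def cong_0_iff)
qed

text \<open>With r the rank, r - 1 distinct affine points are exhibited, and infinity is one more.
  Up to index r / 2 the x-coordinates are pairwise incongruent; the other half consists of
  negatives, told apart by their y-coordinates.\<close>

lemma rank_le_card: "rank_app D p \<le> card (points_mod W p)"
proof -
  let ?r = "rank_app D p"
  let ?V = "rat_curve W"
  note least = rank_app_least[OF p ex_dvd]
  have c: "wa1 ?V \<in> padic p 0" "wa3 ?V \<in> padic p 0"
    by (cases W; simp add: padic_of_int[OF p])+
  define Z where "Z n = - Y n - wa1 ?V * X n - wa3 ?V" for n
  have X: "X n \<in> padic p 0" if "1 \<le> n" "n < ?r" for n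
    using integral_iff[OF p that(1)] least[OF that] by simp
  have Y: "Y n \<in> padic p 0" if "1 \<le> n" "n < ?r" for n using Y_integral X that by simp
  have Z: "Z n \<in> padic p 0" if "1 \<le> n" "n < ?r" for n
    unfolding Z_def by (intro padic_rules c X Y that)
  have onZ: "wpoly ?V (X n) (Z n) = 0" if "1 \<le> n" for n
    unfolding Z_def wpoly_neg using on_XY[OF that] .
  \<comment> \<open>A congruence would make p divide D at i + j or at the difference, both below
    r.\<close>
  have Xeq: "i = j" if "1 \<le> i" "1 \<le> j" "2 * i \<le> ?r" "2 * j \<le> ?r" "residue p (X i) = residue p (X j)" for i j
  proof (rule ccontr)
    have *: False if "1 \<le> i" "i < j" "2 * j \<le> ?r" "residue p (X j) = residue p (X i)" for i j
    proof -
      have "p dvd D (j + i) \<or> p dvd D (j - i)"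
        using congruent_imp_dvd[OF that(1,2) X X that(4)] that by simp
      then show False using least[of "j + i"] least[of "j - i"] that by auto
    qed
    assume "i \<noteq> j"
    then show False using *[of i j] *[of j i] that by (cases "i < j") auto
  qed
  \<comment> \<open>Equality would make the reduction of [i]P its own negative, so p would divide D
    (2 i) with 2 i < r.\<close>
  have YZ: "residue p (Y i) \<noteq> residue p (Z i)" if "1 \<le> i" "2 * i < ?r" for i
  proof
    have i: "i < ?r" using that by simp
    assume "residue p (Y i) = residue p (Z i)"
    then have "Y i - Z i \<in> padic p 1" using residue_eqD[OF p Y Z] that i by simp
    also have "Y i - Z i = wpoly_dy ?V (X i) (Y i)" by (simp add: Z_def wpoly_dy_def)
    finally have d: "wpoly_dy ?V (X i) (Y i) \<in> padic p 1" .
    have "biq_sum (of_int (wb2 W)) (of_int (wb4 W)) (of_int (wb6 W)) (X i) (X i) = (wpoly_dy ?V (X i) (Y i))^2"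
      unfolding biq_sum_same wpoly_dy_square using on_XY[OF that(1)]
      by (simp add: map_weierstrass_of_int)
    also have "\<dots> \<in> padic p 1"
      unfolding power2_eq_square by (intro padic_mult_int[OF p] d padic_mono[OF p d]) simp
    finally have "X (2 * i) \<notin> padic p 0"
      by (rule double_imp[OF not_dvd_disc that(1) X[OF that(1) i]])
    then have "p dvd D (2 * i)" using integral_iff[OF p, of "2 * i"] that by simp
    then show False using least[of "2 * i"] that by simp
  qed
  \<comment> \<open>\<open>g i\<close> is the reduction of \<open>[i]P\<close>, written as \<open>-[r - i]P\<close> if \<open>i > r / 2\<close>\<close>
  define g where "g i = (if 2 * i \<le> ?r then Affine (residue p (X i)) (residue p (Y i))
      else Affine (residue p (X (?r - i))) (residue p (Z (?r - i))))" for i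
  have "inj_on g {1..<?r}"
  proof (rule inj_onI)
    fix i j assume ij: "i \<in> {1..<?r}" "j \<in> {1..<?r}" "g i = g j"
    consider "2 * i \<le> ?r" "2 * j \<le> ?r" | "\<not> 2 * i \<le> ?r" "\<not> 2 * j \<le> ?r"
      | "2 * i \<le> ?r" "\<not> 2 * j \<le> ?r" | "\<not> 2 * i \<le> ?r" "2 * j \<le> ?r" by blast
    then show "i = j"
    proof cases
      case 1 then show ?thesis using Xeq[of i j] ij by (simp add: g_def)
    next
      case 2 then have "?r - i = ?r - j" using Xeq[of "?r - i" "?r - j"] ij by (simp add: g_def)
      then show ?thesis using ij by auto
    next
      case 3
      then have e: "i = ?r - j" using Xeq[of i "?r - j"] ij by (simp add: g_def)
      then have "2 * i < ?r" using 3 ij by auto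
      then show ?thesis using YZ[of i] 3 ij e by (simp add: g_def)
    next
      case 4
      then have e: "j = ?r - i" using Xeq[of j "?r - i"] ij by (simp add: g_def)
      then have "2 * j < ?r" using 4 ij by auto
      then show ?thesis using YZ[of j] 4 ij e by (simp add: g_def)
    qed
  qed
  moreover have fin: "finite (points_mod W p)"
  proof (rule finite_subset)
    show "points_mod W p \<subseteq> insert Infty ((\<lambda>(x, y). Affine x y) ` ({0..<int p} \<times> {0..<int p}))"
      by (auto simp: points_mod_def)
  qed auto
  moreover have "g ` {1..<?r} \<subseteq> points_mod W p - {Infty}"
    using residue_on_curve[OF X Y on_XY] residue_on_curve[OF X Z onZ] by (auto simp: g_def)
  ultimately have "card {1..<?r} \<le> card (points_mod W p - {Infty})"
    by (intro card_inj_on_le[of g]) auto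
  moreover have I: "Infty \<in> points_mod W p" by (simp add: points_mod_def)
  moreover have "card (points_mod W p) > 0" using I fin by (auto simp: card_gt_0_iff)
  ultimately show ?thesis by (simp add: card_Diff_singleton)
qed

lemma rank_bound: "int (rank_app D p) \<le> int p + 1 + excess W p"
  using rank_le_card by (simp add: excess_def)

end

section \<open>Arrows of the index divisibility graph\<close>

lemma Arr_prime:
  assumes "n \<in> index_set D" "prime p" "p dvd D n"
  shows "(n, n * p) \<in> Arr D"
proof -
  have n: "n \<ge> 1" "n dvd D n" using assms(1) by (auto simp: index_set_def)
  have p: "p \<ge> 2" using assms(2) by (rule prime_ge_2_nat)
  \<comment> \<open>Exponents are compared prime by prime. A prime other than p has the same
    exponent in n p as in n; the exponent of p grows by one, and so does the power of p known to
    divide D.\<close>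
  have "n * p dvd D (n * p)"
  proof (rule multiplicity_le_imp_dvd)
    show "n * p \<noteq> 0" using n p by simp
    fix q :: nat assume q: "prime q"
    let ?k = "multiplicity q n"
    have k: "q ^ ?k dvd D n" using multiplicity_dvd n(2) by (rule dvd_trans)
    have "q ^ multiplicity q (n * p) dvd D (n * p)"
    proof (cases "q = p")
      case True
      have m: "multiplicity q (n * p) = ?k + 1"
        using n p q True by (simp add: prime_elem_multiplicity_mult_distrib multiplicity_self)
      show ?thesis
      \<comment> \<open>If p does not divide n, then p dividing D n already suffices;
        \<open>prime_power_dvd_prime_mult\<close> starts at exponent 1.\<close>
      proof (cases "?k = 0")
        case 0: True
        show ?thesis unfolding m using prime_power_dvd_mult[OF assms(2) n(1), of p 1] assms(3) 0 True p
          by (simp add: mult.commute)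
      next
        case False
        then show ?thesis unfolding m using prime_power_dvd_prime_mult[OF q n(1) _ k] True
          by (simp add: mult.commute)
      qed
    next
      case False
      have "multiplicity q (n * p) = ?k"
        using n p q False assms(2) by (simp add: prime_elem_multiplicity_mult_distrib prime_multiplicity_other)
      then show ?thesis using prime_power_dvd_mult[OF q n(1) _ k, of p] p by (simp add: mult.commute)
    qed
    then show "multiplicity q (n * p) \<le> multiplicity q (D (n * p))"
      using D_pos[of "n * p"] n p q by (intro multiplicity_geI) auto
  qed
  then have S: "n * p \<in> index_set D" using n p by (simp add: index_set_def)
  have between: "k = n \<or> k = n * p" if "n dvd k" "k dvd n * p" for k
  proof -
    obtain m where m: "k = n * m" using \<open>n dvd k\<close> by (rule dvdE)
    then have "m dvd p" using that(2) n by simp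
    then show ?thesis using assms(2) m by (auto simp: prime_nat_iff)
  qed
  have "n \<noteq> n * p" using n p by simp
  then show ?thesis using ArrI[OF assms(1) S] between by simp
qed

lemma aliquotD:
  assumes "aliquot_cycle W D ps" "q \<in> set ps"
  shows "prime q" "rank_app D q \<in> set ps" "\<exists>n\<ge>1. q dvd D n"
proof -
  show q: "prime q" using assms by (simp add: aliquot_cycle_def)
  obtain i where "i < length ps" "q = ps ! i" using assms(2) by (metis in_set_conv_nth)
  moreover from this(1) have "(i + 1) mod length ps < length ps" by (intro mod_less_divisor) auto
  ultimately show "rank_app D q \<in> set ps" using assms(1) nth_mem unfolding aliquot_cycle_def by metis
  show "\<exists>n\<ge>1. q dvd D n" using assms ex_dvd[OF q] by (simp add: aliquot_cycle_def)
qed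

text \<open>The rank of each prime of the cycle is another prime of the cycle and so divides d,
  which puts n d into the index set. Conversely, if n e is in the index set and a prime of the cycle
  divides e, then its rank divides n e and, being prime to n, divides e; going round the cycle, d
  divides e.\<close>

lemma Arr_aliquot:
  assumes "n \<in> index_set D" "d \<in> aliquot_numbers W D" "coprime n d"
  shows "(n, n * d) \<in> Arr D"
proof -
  have n: "n \<ge> 1" "n dvd D n" using assms(1) by (auto simp: index_set_def)
  obtain ps where ps: "aliquot_cycle W D ps" and d: "d = prod_list ps"
    using assms(2) by (auto simp: aliquot_numbers_def)
  note A = aliquotD[OF ps]
  have dist: "distinct ps" "ps \<noteq> []" using ps by (auto simp: aliquot_cycle_def)
  have d0: "d \<ge> 1" unfolding d by (auto simp: Suc_le_eq prod_list_zero_iff intro!: Nat.gr0I dest!: A(1))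
  have dd: "q dvd d" if "q \<in> set ps" for q using that unfolding d by (rule elem_dvd_prod_list)
  have nd: "n * d \<ge> 1" using n d0 by simp
  have "d dvd D (n * d)" unfolding d
  proof (rule prod_list_primes_dvd[OF dist(1)])
    fix q assume q: "q \<in> set ps"
    have "rank_app D q dvd n * prod_list ps" using dd[OF A(2)[OF q]] by (simp add: d)
    then show "prime q \<and> q dvd D (n * prod_list ps)"
      using A(1)[OF q] rank_app_dvd_iff[OF A(1)[OF q] A(3)[OF q]] nd by (simp add: d)
  qed
  moreover have "n dvd D (n * d)" using D_dvd[OF n(1) nd] n(2) by (meson dvd_trans dvd_triv_left)
  ultimately have "n * d dvd D (n * d)" using assms(3) by (simp add: divides_mult)
  then have S: "n * d \<in> index_set D" using nd by (simp add: index_set_def)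
  have d1: "d \<noteq> 1" using dist(2) dd A(1) by (metis nat_dvd_1_iff_1 not_prime_1 list.set_intros(1) neq_Nil_conv)
  have between: "k = n \<or> k = n * d" if k: "k \<in> index_set D" "n dvd k" "k dvd n * d" for k
  proof -
    obtain e where e: "k = n * e" using k(2) by (rule dvdE)
    then have ed: "e dvd d" using k(3) n by simp
    have k1: "k \<ge> 1" "k dvd D k" using k(1) by (auto simp: index_set_def)
    show ?thesis
    proof (cases "e = 1")
      case False
      then obtain q where q: "prime q" "q dvd e" by (metis prime_factor_nat)
      have "q \<in> set ps"
        by (rule prime_dvd_prod_list_primes[OF q(1)]) (use A(1) q(2) ed d dvd_trans in auto)
      then obtain i where i: "i < length ps" "q = ps ! i" by (metis in_set_conv_nth)
      have step: "ps ! ((i + 1) mod length ps) dvd e" if "i < length ps" "ps ! i dvd e" for i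
      proof -
        have m: "ps ! i \<in> set ps" using that by simp
        have r: "rank_app D (ps ! i) = ps ! ((i + 1) mod length ps)" using ps that by (simp add: aliquot_cycle_def)
        have "ps ! i dvd D k" using that(2) e k1(2) by (metis dvd_trans dvd_triv_right)
        then have "rank_app D (ps ! i) dvd n * e"
          using rank_app_dvd_iff[OF A(1)[OF m] A(3)[OF m] k1(1)] e by simp
        moreover have "coprime (rank_app D (ps ! i)) n"
          using assms(3) dd[OF A(2)[OF m]] by (metis coprime_commute coprime_divisors dvd_refl)
        ultimately show ?thesis unfolding r by (simp add: coprime_dvd_mult_right_iff)
      qed
      have "ps ! j dvd e" if "j < length ps" for j
        by (rule cyclic_closed[where P = "\<lambda>j. ps ! j dvd e", OF i(1)]) (use i q that step in auto)
      then have "d dvd e" unfolding d using A(1)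
        by (intro prod_list_primes_dvd[OF dist(1)]) (auto simp: in_set_conv_nth)
      then show ?thesis using ed e by (simp add: dvd_antisym)
    qed (use e in simp)
  qed
  have "n \<noteq> n * d" using n d1 by simp
  then show ?thesis using ArrI[OF assms(1) S] between by simp
qed

text \<open>If p does not divide D n, the rank r divides n p but not n, so p divides r. The Hasse
  bound gives r < 2 p, hence r = p and (p) is an aliquot cycle.\<close>

lemma Arr_prime_cases:
  assumes "p \<ge> 7" "prime p" "good_reduction W p" "(n, n * p) \<in> Arr D"
  shows "p dvd D n \<or> p \<in> aliquot_numbers W D"
proof (rule disjCI)
  assume na: "p \<notin> aliquot_numbers W D"
  show "p dvd D n"
  proof (rule ccontr)
    assume nd: "\<not> p dvd D n"
    have n: "n \<ge> 1" and np: "n * p \<ge> 1" "n * p dvd D (n * p)" using assms(4) by (auto simp: Arr_def index_set_def)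
    note ex = ex_dvd[OF assms(2,3)]
    let ?r = "rank_app D p"
    have r1: "?r \<ge> 1" using rank_app[OF assms(2) ex] by simp
    have "p dvd D (n * p)" using np(2) by (meson dvd_trans dvd_triv_right)
    then have r: "?r dvd n * p" using rank_app_dvd_iff[OF assms(2) ex np(1)] by simp
    have rn: "\<not> ?r dvd n" using rank_app_dvd_iff[OF assms(2) ex n] nd by simp
    have pr: "p dvd ?r"
    proof (rule ccontr)
      assume "\<not> p dvd ?r"
      then have "coprime ?r p" using assms(2) by (metis coprime_commute prime_imp_coprime)
      then show False using r rn by (simp add: coprime_dvd_mult_left_iff)
    qed
    have odd: "odd p" using assms(1,2) prime_odd_nat by simp
    \<comment> \<open>This is where p \<ge> 7 enters: (p - 1)^2 - (4 p + 1) = p (p - 6).\<close>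
    have "excess W p < int p - 1"
    proof (rule ccontr)
      assume "\<not> ?thesis"
      then have e: "excess W p \<ge> int p - 1" by simp
      then have "(int p - 1)^2 \<le> (excess W p)^2" using assms(1) by (intro power_mono) auto
      also have "\<dots> \<le> 4 * int p + 1" using hasse_bound[OF assms(2) odd] e assms(1) by simp
      finally have "int p * (int p - 6) \<le> 0" by (simp add: power2_eq_square algebra_simps)
      then show False using assms(1) by (simp add: mult_le_0_iff)
    qed
    then have "?r < 2 * p" using rank_bound[OF assms(2,3)] by simp
    then have "?r = p" using pr r1 by (auto elim!: dvdE simp: less_2_cases_iff)
    then have "aliquot_cycle W D [p]" using assms by (simp add: aliquot_cycle_def)
    then have "p \<in> aliquot_numbers W D" unfolding aliquot_numbers_def by force
    then show False using na by simp
  qed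
qed

text \<open>With s the square root of p, the Hasse bound gives r \<le> s^2 + 2 s + 2, and the
  hypothesis on p says u < 1 - 1 / s. Finally (s^2 + 2 s + 2) (s - 1)^2 = s^4 - s^2 - 2 s + 2 is
  less than s^4.\<close>

lemma rank_real_bound:
  assumes "prime p" "good_reduction W p" "1 / 2 < u" "u < 1" "real p > 1 / (1 - u)^2"
  shows "real (rank_app D p) * u^2 < real p"
proof -
  define s where "s = sqrt (real p)"
  have s2: "s^2 = real p" by (simp add: s_def)
  have u1: "1 - u > 0" using assms(4) by simp
  have "1 / (1 - u) < s"
    unfolding s_def using assms(5) u1 by (intro real_less_rsqrt) (simp add: power_divide)
  then have us: "u < 1 - 1 / s" and s: "s > 2"
  proof -
    assume h: "1 / (1 - u) < s"
    have "1 / (1 - u) > 2" using assms(3,4) by (simp add: field_simps)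
    then show s: "s > 2" using h by simp
    have "1 < s * (1 - u)" using h u1 by (simp add: field_simps)
    then show "u < 1 - 1 / s" using s by (simp add: field_simps)
  qed
  have "s^2 > 2^2" using s by (intro power_strict_mono) auto
  then have "p > 2" using s2 by simp
  then have odd: "odd p" using assms(1) prime_odd_nat by simp
  have e: "real_of_int (excess W p) \<le> 2 * s + 1"
  proof (cases "excess W p \<ge> 0")
    case True
    have "real_of_int ((excess W p)^2) \<le> real_of_int (4 * int p + 1)"
      using hasse_bound[OF assms(1) odd True] by (simp only: of_int_le_iff)
    then have "(real_of_int (excess W p))^2 \<le> 4 * s^2 + 1" by (simp add: s2)
    also have "\<dots> \<le> (2 * s + 1)^2" using s by (simp add: power2_eq_square algebra_simps)
    finally have "(real_of_int (excess W p))^2 \<le> (2 * s + 1)^2" .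
    then show ?thesis by (rule power2_le_imp_le) (use s in simp)
  qed (use s in simp)
  have "real_of_int (int (rank_app D p)) \<le> real_of_int (int p + 1 + excess W p)"
    using rank_bound[OF assms(1,2)] by (simp only: of_int_le_iff)
  then have r: "real (rank_app D p) \<le> s^2 + 2 * s + 2" using e s2 by simp
  have r0: "real (rank_app D p) > 0" using rank_app[OF assms(1) ex_dvd[OF assms(1,2)]] by simp
  have "u^2 < (1 - 1 / s)^2" using us assms(3) by (intro power_strict_mono) auto
  then have "real (rank_app D p) * u^2 < real (rank_app D p) * (1 - 1 / s)^2" using r0 by simp
  also have "\<dots> \<le> (s^2 + 2 * s + 2) * (1 - 1 / s)^2" using r by (intro mult_right_mono) auto
  also have "\<dots> = (s^4 - s^2 - 2 * s + 2) / s^2"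
    using s by (simp add: field_simps power2_eq_square power4_eq_xxxx)
  also have "\<dots> \<le> s^4 / s^2"
  proof (rule divide_right_mono)
    have "0 \<le> s^2" by simp
    then show "s^4 - s^2 - 2 * s + 2 \<le> s^4" using s by linarith
  qed simp
  also have "\<dots> = real p" using s s2 by (simp add: power4_eq_xxxx power2_eq_square)
  finally show ?thesis .
qed

lemma Arr_product:
  assumes cop: "coprime n d" and arr: "(n, n * d) \<in> Arr D"
    and l: "l \<ge> 2" "length ps = l" "distinct ps"
    and ps: "\<And>p. p \<in> set ps \<Longrightarrow> prime p \<and> good_reduction W p" and d: "d = prod_list ps"
    and min: "real (Min (set ps)) > (2 powr (- 1 / (2 * real l)) - 1) powi (- 2)"
  shows "d \<in> aliquot_numbers W D"
proof -
  \<comment> \<open>With this u, u^(2 l) = 1 / 2, and \<open>min\<close> says that p > 1 / (1 - u)^2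
    for every prime p in \<open>ps\<close>.\<close>
  define u :: real where "u = 2 powr (- 1 / (2 * real l))"
  have n: "n \<in> index_set D" "n \<ge> 1" and nd: "n * d \<ge> 1" "n * d dvd D (n * d)"
    using arr by (auto simp: Arr_def index_set_def)
  have u1: "u < 1" unfolding u_def using l(1) by (simp add: powr_less_one)
  have u2: "u ^ (2 * l) = 1 / 2"
  proof -
    have "u ^ (2 * l) = 2 powr (- 1 / (2 * real l) * real (2 * l))"
      unfolding u_def by (subst powr_realpow[symmetric]) (auto simp: powr_powr)
    also have "- 1 / (2 * real l) * real (2 * l) = - 1" using l(1) by simp
    finally show ?thesis by (simp add: powr_minus)
  qed
  have uh: "1 / 2 < u"
  proof -
    have "2 powr (- 1) < 2 powr (- 1 / (2 * real l))" using l(1) by (intro powr_less_mono) (auto simp: field_simps)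
    then show ?thesis by (simp add: u_def powr_minus)
  qed
  have big: "real p > 1 / (1 - u)^2" if "p \<in> set ps" for p
  proof -
    have "1 / (1 - u)^2 = (u - 1) powi (- 2)"
      by (simp add: power_int_minus power2_commute[of u] divide_inverse)
    also have "\<dots> < real (Min (set ps))" using min unfolding u_def .
    also have "\<dots> \<le> real p" using that by simp
    finally show ?thesis .
  qed
  note pr = ps[THEN conjunct1] and gd = ps[THEN conjunct2]
  have dd: "q dvd d" if "q \<in> set ps" for q using that unfolding d by (rule elem_dvd_prod_list)
  have ne: "ps \<noteq> []" using l by auto
  \<comment> \<open>Otherwise \<open>Arr_prime\<close> puts n p into the index set, strictly between
    n and n d because d has at least two prime factors.\<close>
  have notdvd: "\<not> p dvd D n" if p: "p \<in> set ps" for p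
  proof
    assume "p dvd D n"
    then have "n * p \<in> index_set D" using Arr_prime[OF n(1) pr[OF p]] by (simp add: Arr_def)
    moreover have "n dvd n * p" "n * p dvd n * d" using dd[OF p] by simp_all
    moreover have "n * p \<noteq> n" using n(2) pr[OF p] by (metis mult_eq_self_implies_10 not_one_le_zero not_prime_1)
    moreover have "p \<noteq> d"
    proof
      assume "p = d"
      have "\<exists>q\<in>set ps. q \<noteq> p"
      proof (rule ccontr)
        assume "\<not> ?thesis"
        then have "set ps \<subseteq> {p}" by auto
        then have "card (set ps) \<le> card {p}" by (intro card_mono) auto
        then show False using l by (simp add: distinct_card)
      qed
      then obtain q where "q \<in> set ps" "q \<noteq> p" by blast
      then show False using dd[of q] pr[OF p] pr[of q] \<open>p = d\<close> primes_dvd_imp_eq by blast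
    qed
    then have "n * p \<noteq> n * d" using n(2) by simp
    ultimately show False using ArrD[OF arr, of "n * p"] by blast
  qed
  \<comment> \<open>Otherwise the rank of p, a divisor of n d prime to d, would divide n, and p
    would divide D n.\<close>
  have ex: "\<exists>q\<in>set ps. q dvd rank_app D p" if p: "p \<in> set ps" for p
  proof (rule ccontr)
    assume c: "\<not> ?thesis"
    have "coprime (rank_app D p) d" unfolding d
      by (rule prod_list_coprime_right) (use c pr prime_imp_coprime coprime_commute in metis)
    moreover have "p dvd D (n * d)" using dd[OF p] nd(2) by (meson dvd_trans dvd_triv_right)
    then have "rank_app D p dvd n * d" using rank_app_dvd_iff[OF pr[OF p] ex_dvd[OF pr[OF p] gd[OF p]] nd(1)] by simp
    ultimately have "rank_app D p dvd n" by (simp add: coprime_dvd_mult_left_iff)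
    then show False using notdvd[OF p] rank_app_dvd_iff[OF pr[OF p] ex_dvd[OF pr[OF p] gd[OF p]] n(2)] by simp
  qed
  then obtain f where f: "\<And>p. p \<in> set ps \<Longrightarrow> f p \<in> set ps \<and> f p dvd rank_app D p" by metis
  obtain cs where cs: "cs \<noteq> []" "distinct cs" "set cs \<subseteq> set ps"
    "\<And>i. i < length cs \<Longrightarrow> f (cs ! i) = cs ! ((i + 1) mod length cs)"
    using ex_functional_cycle[of "set ps" f] ne f by (metis List.finite_set image_subsetI set_empty)
  let ?k = "length cs" and ?r = "\<lambda>i. rank_app D (cs ! i)"
  have mem: "cs ! i \<in> set ps" if "i < ?k" for i using that cs(3) by auto
  have "card (set cs) \<le> card (set ps)" using cs(3) by (intro card_mono) auto
  then have k: "0 < ?k" "?k \<le> l" using cs(1,2) l(2,3) by (simp_all add: distinct_card)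
  have dv: "cs ! ((i + 1) mod ?k) dvd ?r i" if "i < ?k" for i
    using f[OF mem[OF that]] cs(4)[OF that] by simp
  define m where "m i = ?r i div cs ! ((i + 1) mod ?k)" for i
  have m: "?r i = m i * cs ! ((i + 1) mod ?k)" if "i < ?k" for i
    using dv[OF that] by (simp add: m_def)
  have r0: "?r i \<ge> 1" if "i < ?k" for i
    using rank_app[OF pr[OF mem] ex_dvd[OF pr[OF mem] gd[OF mem]]] that by blast
  have m0: "m i \<ge> 1" if "i < ?k" for i using r0[OF that] m[OF that] by (cases "m i") auto
  let ?C = "\<Prod>i<?k. cs ! i"
  have C0: "?C > 0" using pr mem prime_gt_0_nat by (intro prod_pos) auto
  have prod: "(\<Prod>i<?k. ?r i) = (\<Prod>i<?k. m i) * ?C"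
  proof -
    have "(\<Prod>i<?k. ?r i) = (\<Prod>i<?k. m i) * (\<Prod>i<?k. cs ! ((i + 1) mod ?k))"
      unfolding prod.distrib[symmetric] by (intro prod.cong) (use m in auto)
    then show ?thesis unfolding prod_cyclic_shift[of "\<lambda>i. cs ! i"] .
  qed
  have lt_cs: "real (?r i) * u^2 < real (cs ! i)" if "i < ?k" for i
    using rank_real_bound[OF pr gd uh u1 big] mem[OF that] by simp
  \<comment> \<open>Multiplied around the cycle, the primes themselves cancel and only the product
    of the quotients m i times u^(2 k) remains, k being the length of the cycle.\<close>
  have "(\<Prod>i<?k. real (?r i) * u^2) < (\<Prod>i<?k. real (cs ! i))"
  proof (rule prod_mono_strict[of 0])
    show "0 \<le> real (?r i) * u^2 \<and> real (?r i) * u^2 \<le> real (cs ! i)" if "i \<in> {..<?k}" for i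
      using lt_cs[of i] that by simp
    show "0 < real (cs ! i)" if "i \<in> {..<?k}" for i
      using prime_gt_0_nat[OF pr[OF mem[of i]]] that by simp
  qed (use k lt_cs in auto)
  also have "(\<Prod>i<?k. real (cs ! i)) = real ?C" by simp
  also have "(\<Prod>i<?k. real (?r i) * u^2) = real (\<Prod>i<?k. m i) * real ?C * u ^ (2 * ?k)"
    using prod by (simp add: prod.distrib power_mult[symmetric] flip: of_nat_prod)
  finally have "real (\<Prod>i<?k. m i) * u ^ (2 * ?k) * real ?C < 1 * real ?C" by (simp add: mult_ac)
  then have "real (\<Prod>i<?k. m i) * u ^ (2 * ?k) < 1" using C0 by (simp only: mult_less_cancel_right)
  \<comment> \<open>Since k \<le> l and u < 1, u^(2 k) \<ge> 1 / 2; so the product of the m i is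
    below 2.\<close>
  moreover have "u ^ (2 * l) \<le> u ^ (2 * ?k)" using k u1 uh by (intro power_decreasing) auto
  then have "real (\<Prod>i<?k. m i) * (1 / 2) \<le> real (\<Prod>i<?k. m i) * u ^ (2 * ?k)"
    unfolding u2 by (rule mult_left_mono[OF _ of_nat_0_le_iff])
  ultimately have "real (\<Prod>i<?k. m i) < 2" by linarith
  then have lt: "(\<Prod>i<?k. m i) < 2" by linarith
  have m1: "m i = 1" if "i < ?k" for i
  proof -
    have "m i dvd (\<Prod>i<?k. m i)" using that by (intro dvd_prodI) auto
    moreover have "(\<Prod>i<?k. m i) > 0" using m0 by (intro prod_pos) (auto simp: Suc_le_eq)
    ultimately have "m i \<le> (\<Prod>i<?k. m i)" by (intro dvd_imp_le)
    then show ?thesis using lt m0[OF that] by linarith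
  qed
  have cyc: "aliquot_cycle W D cs"
    unfolding aliquot_cycle_def using cs(1-3) k ps m m1 by (auto simp: Suc_le_eq)
  let ?e = "prod_list cs"
  have al: "?e \<in> aliquot_numbers W D" using cyc by (auto simp: aliquot_numbers_def)
  have ed: "?e dvd d" by (rule prod_list_primes_dvd[OF cs(2)]) (use cs(3) pr dd in auto)
  \<comment> \<open>The cycle might involve only some of the primes of d; then n times its product
    would lie strictly between n and n d in the index set.\<close>
  have "coprime n ?e" using cop ed by (metis coprime_divisors dvd_refl)
  then have "(n, n * ?e) \<in> Arr D" by (rule Arr_aliquot[OF n(1) al])
  note e = Arr_basic(2,3)[OF this]
  have "n dvd n * ?e" "n * ?e dvd n * d" using ed by simp_all
  then have "n * ?e = n * d" using ArrD[OF arr e(1)] e(2) by metis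
  then have "?e = d" using n(2) by simp
  then show ?thesis using al by simp
qed

end

theorem theorem3:
  fixes W :: "int weierstrass" and P :: "rat point" and D :: "nat \<Rightarrow> nat"
  assumes "minimal_eds W P D" and "regular_eds W P D"
  shows "(\<forall>n p. n \<in> index_set D \<and> prime p \<and> p dvd D n \<longrightarrow> (n, n * p) \<in> Arr D)
    \<and> (\<forall>n d. n \<in> index_set D \<and> d \<in> aliquot_numbers W D \<and> coprime n d \<longrightarrow> (n, n * d) \<in> Arr D)
    \<and> (\<forall>n p. p \<ge> 7 \<and> prime p \<and> good_reduction W p \<and> (n, n * p) \<in> Arr D
          \<longrightarrow> p dvd D n \<or> p \<in> aliquot_numbers W D)
    \<and> (\<forall>n d l ps. coprime n d \<and> (n, n * d) \<in> Arr D
          \<and> l \<ge> 2 \<and> length ps = l \<and> distinct ps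
          \<and> (\<forall>p \<in> set ps. prime p \<and> good_reduction W p)
          \<and> d = prod_list ps
          \<and> real (Min (set ps)) > (2 powr (- 1 / (2 * real l)) - 1) powi (- 2)
          \<longrightarrow> d \<in> aliquot_numbers W D)"
proof -
  interpret eds W P D using assms(1) by unfold_locales (simp add: minimal_eds_def)
  show ?thesis
  proof (intro conjI allI impI)
    fix n p assume "n \<in> index_set D \<and> prime p \<and> p dvd D n"
    then show "(n, n * p) \<in> Arr D" by (elim conjE) (rule Arr_prime)
  next
    fix n d assume "n \<in> index_set D \<and> d \<in> aliquot_numbers W D \<and> coprime n d"
    then show "(n, n * d) \<in> Arr D" by (elim conjE) (rule Arr_aliquot)
  next
    fix n p assume "p \<ge> 7 \<and> prime p \<and> good_reduction W p \<and> (n, n * p) \<in> Arr D"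
    then show "p dvd D n \<or> p \<in> aliquot_numbers W D" by (elim conjE) (rule Arr_prime_cases)
  next
    fix n d l ps
    assume h: "coprime n d \<and> (n, n * d) \<in> Arr D
          \<and> l \<ge> 2 \<and> length ps = l \<and> distinct ps
          \<and> (\<forall>p \<in> set ps. prime p \<and> good_reduction W p)
          \<and> d = prod_list ps
          \<and> real (Min (set ps)) > (2 powr (- 1 / (2 * real l)) - 1) powi (- 2)"
    then show "d \<in> aliquot_numbers W D"
      by (elim conjE) (rule Arr_product[of n d l ps]; (assumption | drule (1) bspec))
  qed
qed

end
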